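(* Let $\Omega$ be a compact Hausdorff space and let $\sigma:\Omega\to\Omega$ be a topologically free covering map. Let $\mathcal{G}_{\mathrm{EV}}(\Omega,\sigma)=(\mathcal{G}^0,\mathcal{G}^1,r,s)$ be the topological graph with $\mathcal{G}^0=\mathcal{G}^1=\Omega$, $r=\mathrm{id}$ and $s=\sigma$, and let $\mathcal{T}^+_{\mathrm{EV}}(\Omega,\sigma)$ be its tensor algebra. Then every approximately local derivation on $\mathcal{T}^+_{\mathrm{EV}}(\Omega,\sigma)$ is a derivation.
   Context: The covering map $\sigma$ is topologically free if for all $m\ne n$ the set $\Omega_{m,n}=\{v\in\Omega:\sigma^{(m)}(v)=\sigma^{(n)}(v)\}$ has empty interior, where $\sigma^{(k)}$ is the $k$-fold iterate. A $C^*$-correspondence $X$ over a $C^*$-algebra $A$ is a right Hilbert $A$-module with a left action of $A$ by adjointable operators (given by a $*$-homomorphism $A\to\mathcal{L}(X)$). A Toeplitz representation of $X$ is a pair $(\pi,t)$ of a $*$-homomorphism $\pi$ of $A$ and a linear map $t$ of $X$ into a $C^*$-algebra with $\pi(a)t(\xi)=t(a\xi)$ and $t(\xi)^*t(\eta)=\pi(\langle\xi,\eta\rangle)$; the tensor algebra $\mathcal{T}_X^+$ is the norm-closed algebra generated by the images of $A$ and $X$ under the universal Toeplitz representation. The tensor algebra $\mathcal{T}^+_{\mathrm{EV}}(\Omega,\sigma)$ is $\mathcal{T}_X^+$ for the $C^*$-correspondence $X=C(\Omega)$ over $C(\Omega)$ of the graph $\mathcal{G}_{\mathrm{EV}}(\Omega,\sigma)$,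 with actions $(fFg)(e)=f(e)F(e)g(\sigma(e))$ and inner product $\langle F,G\rangle(v)=\sum_{e\in\sigma^{-1}(v)}\overline{F(e)}G(e)$. All linear maps are bounded. A derivation of a Banach algebra $\mathcal{A}$ is a bounded linear map $\delta:\mathcal{A}\to\mathcal{A}$ with $\delta(AB)=\delta(A)B+A\delta(B)$. A bounded linear map $\delta:\mathcal{A}\to\mathcal{A}$ is an approximately local derivation if for every $A\in\mathcal{A}$ there is a sequence of derivations $\delta_{A,k}$ of $\mathcal{A}$ with $\delta(A)=\lim_k\delta_{A,k}(A)$. *)

theory Defs
  imports "HOL-Analysis.Analysis" "HOL-Algebra.Module"
begin

section \<open>Complex normed algebras and C*-algebras on carriers\<close>

text \<open>
  Vector spaces over the complex numbers are modules, in the sense of HOL-Algebra, over the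
  ring below.  Algebras reuse the multiplication of the module record.  They are not assumed to
  be unital, and the unit field of the record carries no meaning.
\<close>

definition complex_ring :: "complex ring" where
  "complex_ring = \<lparr>carrier = UNIV, mult = (*), one = 1, zero = 0, add = (+)\<rparr>"

record 'b normed_alg = "(complex, 'b) module" +
  nrm :: "'b \<Rightarrow> real"

record 'b cstar_alg = "'b normed_alg" +
  star :: "'b \<Rightarrow> 'b"

text \<open>
  The distance is set to 0 off the carrier because the library locale for metric spaces asks for
  symmetry and nonnegativity on the whole type.
\<close>

definition norm_dist :: "('b, 'm) ring_scheme \<Rightarrow> ('b \<Rightarrow> real) \<Rightarrow> 'b \<Rightarrow> 'b \<Rightarrow> real" where
  "norm_dist V N x y = (if x \<in> carrier V \<and> y \<in> carrier V then N (x \<ominus>\<^bsub>V\<^esub> y) else 0)"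

definition norm_topology :: "('b, 'm) normed_alg_scheme \<Rightarrow> 'b topology" where
  "norm_topology B = Metric_space.mtopology (carrier B) (norm_dist B (nrm B))"

locale complex_normed_algebra = Module.module complex_ring B for B (structure) +
  assumes mult_closed: "\<lbrakk>x \<in> carrier B; y \<in> carrier B\<rbrakk> \<Longrightarrow> x \<otimes> y \<in> carrier B"
    and mult_assoc: "\<lbrakk>x \<in> carrier B; y \<in> carrier B; z \<in> carrier B\<rbrakk> \<Longrightarrow> (x \<otimes> y) \<otimes> z = x \<otimes> (y \<otimes> z)"
    and distr_left: "\<lbrakk>x \<in> carrier B; y \<in> carrier B; z \<in> carrier B\<rbrakk> \<Longrightarrow> (x \<oplus> y) \<otimes> z = x \<otimes> z \<oplus> y \<otimes> z"
    and distr_right: "\<lbrakk>x \<in> carrier B; y \<in> carrier B; z \<in> carrier B\<rbrakk> \<Longrightarrow> z \<otimes> (x \<oplus> y) = z \<otimes> x \<oplus> z \<otimes> y"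
    and scale_mult_left: "\<lbrakk>x \<in> carrier B; y \<in> carrier B\<rbrakk> \<Longrightarrow> (c \<odot> x) \<otimes> y = c \<odot> (x \<otimes> y)"
    and scale_mult_right: "\<lbrakk>x \<in> carrier B; y \<in> carrier B\<rbrakk> \<Longrightarrow> x \<otimes> (c \<odot> y) = c \<odot> (x \<otimes> y)"
    and nrm_nonneg: "x \<in> carrier B \<Longrightarrow> 0 \<le> nrm B x"
    and nrm_eq_0: "x \<in> carrier B \<Longrightarrow> nrm B x = 0 \<longleftrightarrow> x = \<zero>"
    and nrm_scale: "x \<in> carrier B \<Longrightarrow> nrm B (c \<odot> x) = cmod c * nrm B x"
    and nrm_triangle: "\<lbrakk>x \<in> carrier B; y \<in> carrier B\<rbrakk> \<Longrightarrow> nrm B (x \<oplus> y) \<le> nrm B x + nrm B y"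
    and nrm_mult: "\<lbrakk>x \<in> carrier B; y \<in> carrier B\<rbrakk> \<Longrightarrow> nrm B (x \<otimes> y) \<le> nrm B x * nrm B y"

locale complex_banach_algebra = complex_normed_algebra +
  assumes complete: "Metric_space.mcomplete (carrier B) (norm_dist B (nrm B))"

locale cstar_algebra = complex_banach_algebra +
  assumes star_closed: "x \<in> carrier B \<Longrightarrow> star B x \<in> carrier B"
    and star_star: "x \<in> carrier B \<Longrightarrow> star B (star B x) = x"
    and star_add: "\<lbrakk>x \<in> carrier B; y \<in> carrier B\<rbrakk> \<Longrightarrow> star B (x \<oplus> y) = star B x \<oplus> star B y"
    and star_scale: "x \<in> carrier B \<Longrightarrow> star B (c \<odot> x) = cnj c \<odot> star B x"
    and star_mult: "\<lbrakk>x \<in> carrier B; y \<in> carrier B\<rbrakk> \<Longrightarrow> star B (x \<otimes> y) = star B y \<otimes> star B x"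
    and cstar_identity: "x \<in> carrier B \<Longrightarrow> nrm B (star B x \<otimes> x) = (nrm B x)\<^sup>2"

definition linear_map ::
  "(complex, 'x, 'm) module_scheme \<Rightarrow> (complex, 'y, 'n) module_scheme \<Rightarrow> ('x \<Rightarrow> 'y) \<Rightarrow> bool" where
  "linear_map V W T \<longleftrightarrow> T \<in> carrier V \<rightarrow> carrier W
     \<and> (\<forall>x\<in>carrier V. \<forall>y\<in>carrier V. T (x \<oplus>\<^bsub>V\<^esub> y) = T x \<oplus>\<^bsub>W\<^esub> T y)
     \<and> (\<forall>c. \<forall>x\<in>carrier V. T (c \<odot>\<^bsub>V\<^esub> x) = c \<odot>\<^bsub>W\<^esub> T x)"

definition star_hom :: "('a, 'm) cstar_alg_scheme \<Rightarrow> ('b, 'n) cstar_alg_scheme \<Rightarrow> ('a \<Rightarrow> 'b) \<Rightarrow> bool" where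
  "star_hom A B \<phi> \<longleftrightarrow> linear_map A B \<phi>
     \<and> (\<forall>x\<in>carrier A. \<forall>y\<in>carrier A. \<phi> (x \<otimes>\<^bsub>A\<^esub> y) = \<phi> x \<otimes>\<^bsub>B\<^esub> \<phi> y)
     \<and> (\<forall>x\<in>carrier A. \<phi> (star A x) = star B (\<phi> x))"

definition closed_subalgebra :: "('b, 'm) normed_alg_scheme \<Rightarrow> 'b set \<Rightarrow> bool" where
  "closed_subalgebra B M \<longleftrightarrow> submodule M complex_ring B
     \<and> (\<forall>x\<in>M. \<forall>y\<in>M. x \<otimes>\<^bsub>B\<^esub> y \<in> M) \<and> closedin (norm_topology B) M"

definition closed_algebra_generated :: "('b, 'm) normed_alg_scheme \<Rightarrow> 'b set \<Rightarrow> 'b set" where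
  "closed_algebra_generated B S = \<Inter> {M. S \<subseteq> M \<and> closed_subalgebra B M}"

definition cstar_algebra_generated :: "('b, 'm) cstar_alg_scheme \<Rightarrow> 'b set \<Rightarrow> 'b set" where
  "cstar_algebra_generated B S = \<Inter> {M. S \<subseteq> M \<and> closed_subalgebra B M \<and> star B ` M \<subseteq> M}"


section \<open>Derivations\<close>

definition bounded_linear_map ::
  "('a, 'm) normed_alg_scheme \<Rightarrow> ('b, 'n) normed_alg_scheme \<Rightarrow> ('a \<Rightarrow> 'b) \<Rightarrow> bool" where
  "bounded_linear_map A B T \<longleftrightarrow> linear_map A B T
     \<and> (\<exists>K. \<forall>x\<in>carrier A. nrm B (T x) \<le> K * nrm A x)"

definition derivation :: "('a, 'm) normed_alg_scheme \<Rightarrow> ('a \<Rightarrow> 'a) \<Rightarrow> bool" where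
  "derivation A \<delta> \<longleftrightarrow> bounded_linear_map A A \<delta>
     \<and> (\<forall>x\<in>carrier A. \<forall>y\<in>carrier A. \<delta> (x \<otimes>\<^bsub>A\<^esub> y) = \<delta> x \<otimes>\<^bsub>A\<^esub> y \<oplus>\<^bsub>A\<^esub> x \<otimes>\<^bsub>A\<^esub> \<delta> y)"

definition approximately_local_derivation :: "('a, 'm) normed_alg_scheme \<Rightarrow> ('a \<Rightarrow> 'a) \<Rightarrow> bool" where
  "approximately_local_derivation A \<delta> \<longleftrightarrow> bounded_linear_map A A \<delta>
     \<and> (\<forall>x\<in>carrier A. \<exists>D :: nat \<Rightarrow> 'a \<Rightarrow> 'a. (\<forall>k. derivation A (D k))
          \<and> limitin (norm_topology A) (\<lambda>k. D k x) (\<delta> x) sequentially)"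


section \<open>C*-correspondences and their tensor algebras\<close>

record ('a, 'x) hilbert_mod = "(complex, 'x) module" +
  ract :: "'x \<Rightarrow> 'a \<Rightarrow> 'x"
  ip :: "'x \<Rightarrow> 'x \<Rightarrow> 'a"

record ('a, 'x) correspondence = "('a, 'x) hilbert_mod" +
  lact :: "'a \<Rightarrow> 'x \<Rightarrow> 'x"

definition hilbert_nrm :: "('a, 'm) normed_alg_scheme \<Rightarrow> ('a, 'x, 'n) hilbert_mod_scheme \<Rightarrow> 'x \<Rightarrow> real" where
  "hilbert_nrm A X x = sqrt (nrm A (ip X x x))"

locale hilbert_module = A: cstar_algebra A + X: Module.module complex_ring X
  for A (structure) and X (structure) +
  assumes ract_closed: "\<lbrakk>x \<in> carrier X; a \<in> carrier A\<rbrakk> \<Longrightarrow> ract X x a \<in> carrier X"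
    and ract_add_left: "\<lbrakk>x \<in> carrier X; y \<in> carrier X; a \<in> carrier A\<rbrakk>
      \<Longrightarrow> ract X (x \<oplus>\<^bsub>X\<^esub> y) a = ract X x a \<oplus>\<^bsub>X\<^esub> ract X y a"
    and ract_add_right: "\<lbrakk>x \<in> carrier X; a \<in> carrier A; b \<in> carrier A\<rbrakk>
      \<Longrightarrow> ract X x (a \<oplus>\<^bsub>A\<^esub> b) = ract X x a \<oplus>\<^bsub>X\<^esub> ract X x b"
    and ract_scale_left: "\<lbrakk>x \<in> carrier X; a \<in> carrier A\<rbrakk>
      \<Longrightarrow> ract X (c \<odot>\<^bsub>X\<^esub> x) a = c \<odot>\<^bsub>X\<^esub> ract X x a"
    and ract_scale_right: "\<lbrakk>x \<in> carrier X; a \<in> carrier A\<rbrakk>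
      \<Longrightarrow> ract X x (c \<odot>\<^bsub>A\<^esub> a) = c \<odot>\<^bsub>X\<^esub> ract X x a"
    and ract_mult: "\<lbrakk>x \<in> carrier X; a \<in> carrier A; b \<in> carrier A\<rbrakk>
      \<Longrightarrow> ract X x (a \<otimes>\<^bsub>A\<^esub> b) = ract X (ract X x a) b"
    and ip_closed: "\<lbrakk>x \<in> carrier X; y \<in> carrier X\<rbrakk> \<Longrightarrow> ip X x y \<in> carrier A"
    and ip_add: "\<lbrakk>x \<in> carrier X; y \<in> carrier X; z \<in> carrier X\<rbrakk>
      \<Longrightarrow> ip X x (y \<oplus>\<^bsub>X\<^esub> z) = ip X x y \<oplus>\<^bsub>A\<^esub> ip X x z"
    and ip_scale: "\<lbrakk>x \<in> carrier X; y \<in> carrier X\<rbrakk>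
      \<Longrightarrow> ip X x (c \<odot>\<^bsub>X\<^esub> y) = c \<odot>\<^bsub>A\<^esub> ip X x y"
    and ip_ract: "\<lbrakk>x \<in> carrier X; y \<in> carrier X; a \<in> carrier A\<rbrakk>
      \<Longrightarrow> ip X x (ract X y a) = ip X x y \<otimes>\<^bsub>A\<^esub> a"
    and ip_star: "\<lbrakk>x \<in> carrier X; y \<in> carrier X\<rbrakk> \<Longrightarrow> star A (ip X x y) = ip X y x"
    and ip_pos: "x \<in> carrier X \<Longrightarrow> \<exists>a\<in>carrier A. ip X x x = star A a \<otimes>\<^bsub>A\<^esub> a"
    and ip_definite: "\<lbrakk>x \<in> carrier X; ip X x x = \<zero>\<^bsub>A\<^esub>\<rbrakk> \<Longrightarrow> x = \<zero>\<^bsub>X\<^esub>"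
    and module_complete: "Metric_space.mcomplete (carrier X) (norm_dist X (hilbert_nrm A X))"

text \<open>
  The left action is a *-homomorphism into the adjointable operators: the last axiom says that
  the operator of \<open>star A a\<close> is an adjoint of the operator of \<open>a\<close>.  An operator that has an adjoint is
  automatically linear, commutes with the right action and is bounded.
\<close>

locale cstar_correspondence = hilbert_module +
  assumes lact_closed: "\<lbrakk>a \<in> carrier A; x \<in> carrier X\<rbrakk> \<Longrightarrow> lact X a x \<in> carrier X"
    and lact_add: "\<lbrakk>a \<in> carrier A; b \<in> carrier A; x \<in> carrier X\<rbrakk>
      \<Longrightarrow> lact X (a \<oplus>\<^bsub>A\<^esub> b) x = lact X a x \<oplus>\<^bsub>X\<^esub> lact X b x"
    and lact_scale: "\<lbrakk>a \<in> carrier A; x \<in> carrier X\<rbrakk>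
      \<Longrightarrow> lact X (c \<odot>\<^bsub>A\<^esub> a) x = c \<odot>\<^bsub>X\<^esub> lact X a x"
    and lact_mult: "\<lbrakk>a \<in> carrier A; b \<in> carrier A; x \<in> carrier X\<rbrakk>
      \<Longrightarrow> lact X (a \<otimes>\<^bsub>A\<^esub> b) x = lact X a (lact X b x)"
    and lact_adjoint: "\<lbrakk>a \<in> carrier A; x \<in> carrier X; y \<in> carrier X\<rbrakk>
      \<Longrightarrow> ip X (lact X a x) y = ip X x (lact X (star A a) y)"

text \<open>
  Boundedness of the linear map \<open>t\<close> follows from the last axiom, since
  \<open>\<parallel>t x\<parallel>\<^sup>2 = \<parallel>\<pi> \<langle>x, x\<rangle>\<parallel>\<close> and *-homomorphisms of C*-algebras are contractive.
\<close>

locale toeplitz_representation = cstar_correspondence A X + B: cstar_algebra B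
  for A (structure) and X (structure) and B (structure) +
  fixes \<pi> :: "'a \<Rightarrow> 'c" and t :: "'x \<Rightarrow> 'c"
  assumes rep_hom: "star_hom A B \<pi>"
    and rep_linear: "linear_map X B t"
    and rep_lact: "\<lbrakk>a \<in> carrier A; x \<in> carrier X\<rbrakk> \<Longrightarrow> \<pi> a \<otimes>\<^bsub>B\<^esub> t x = t (lact X a x)"
    and rep_ip: "\<lbrakk>x \<in> carrier X; y \<in> carrier X\<rbrakk> \<Longrightarrow> star B (t x) \<otimes>\<^bsub>B\<^esub> t y = \<pi> (ip X x y)"


text \<open>
  Formal *-polynomials in the elements of the coefficient algebra and of the module.
\<close>

datatype ('a, 'x) star_polynomial =
    Coeff 'a
  | Vec 'x
  | Scale complex "('a, 'x) star_polynomial"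
  | Plus "('a, 'x) star_polynomial" "('a, 'x) star_polynomial"
  | Times "('a, 'x) star_polynomial" "('a, 'x) star_polynomial"
  | Adj "('a, 'x) star_polynomial"

text \<open>
  The universal property quantifies over C*-algebras \<open>D\<close> whose carriers are subsets of the type of
  sequences of *-polynomials.  This loses no generality: every element of the C*-algebra
  generated by the images of a Toeplitz representation is the limit of a sequence of values of
  *-polynomials, so choosing such a sequence for each element embeds that C*-algebra into the
  type, and a *-homomorphism into it is one into any larger C*-algebra.
\<close>

locale universal_toeplitz_representation = toeplitz_representation A X B \<pi> t
  for A :: "('a, 'm) cstar_alg_scheme" (structure)
    and X :: "('a, 'x, 'n) correspondence_scheme" (structure)
    and B :: "('b, 'k) cstar_alg_scheme" (structure)
    and \<pi> :: "'a \<Rightarrow> 'b" and t :: "'x \<Rightarrow> 'b" +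
  assumes generated: "cstar_algebra_generated B (\<pi> ` carrier A \<union> t ` carrier X) = carrier B"
    and universal: "\<And>(D :: (nat \<Rightarrow> ('a, 'x) star_polynomial) cstar_alg) \<pi>' t'.
      toeplitz_representation A X D \<pi>' t' \<Longrightarrow>
        \<exists>\<phi>. star_hom B D \<phi> \<and> (\<forall>a\<in>carrier A. \<phi> (\<pi> a) = \<pi>' a) \<and> (\<forall>x\<in>carrier X. \<phi> (t x) = t' x)"

text \<open>
  The tensor algebra, computed inside the C*-algebra \<open>B\<close> of a given Toeplitz representation; it is
  the tensor algebra of \<open>X\<close> when this representation is universal.
\<close>

definition tensor_algebra ::
  "('a, 'm) cstar_alg_scheme \<Rightarrow> ('a, 'x, 'n) correspondence_scheme \<Rightarrow> ('b, 'k) cstar_alg_scheme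
    \<Rightarrow> ('a \<Rightarrow> 'b) \<Rightarrow> ('x \<Rightarrow> 'b) \<Rightarrow> ('b, 'k) cstar_alg_scheme" where
  "tensor_algebra A X B \<pi> t =
     B\<lparr>carrier := closed_algebra_generated B (\<pi> ` carrier A \<union> t ` carrier X)\<rparr>"


section \<open>Topological graphs and dynamical systems\<close>

definition C_algebra :: "('v::topological_space \<Rightarrow> complex) cstar_alg" where
  "C_algebra = \<lparr>carrier = {f. continuous_on UNIV f},
     mult = (\<lambda>f g v. f v * g v), one = (\<lambda>v. 1),
     zero = (\<lambda>v. 0), add = (\<lambda>f g v. f v + g v),
     smult = (\<lambda>c f v. c * f v),
     nrm = (\<lambda>f. SUP v. cmod (f v)), star = (\<lambda>f v. cnj (f v))\<rparr>"

text \<open>The vertex and edge spaces of a topological graph are the types \<open>'v\<close> and \<open>'e\<close>.\<close>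

record ('v, 'e) topological_graph =
  range_map :: "'e \<Rightarrow> 'v"
  source_map :: "'e \<Rightarrow> 'v"

text \<open>
  The correspondence of a topological graph with compact edge space, so that the module consists
  of all continuous functions on the edges.  The sum in the inner product is over a finite fibre
  because the source map is a local homeomorphism.  The multiplication and unit fields, inherited
  from the module record, play no role.
\<close>

definition graph_correspondence ::
  "('v::topological_space, 'e::topological_space) topological_graph
    \<Rightarrow> ('v \<Rightarrow> complex, 'e \<Rightarrow> complex) correspondence" where
  "graph_correspondence G = \<lparr>carrier = {F. continuous_on UNIV F},
     mult = (\<lambda>F H e. F e * H e), one = (\<lambda>e. 1),
     zero = (\<lambda>e. 0), add = (\<lambda>F H e. F e + H e),
     smult = (\<lambda>c F e. c * F e),
     ract = (\<lambda>F g e. F e * g (source_map G e)),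
     ip = (\<lambda>F H v. \<Sum>e | source_map G e = v. cnj (F e) * H e),
     lact = (\<lambda>f F e. f (range_map G e) * F e)\<rparr>"

definition EV_graph :: "('a \<Rightarrow> 'a) \<Rightarrow> ('a, 'a) topological_graph" where
  "EV_graph \<sigma> = \<lparr>range_map = id, source_map = \<sigma>\<rparr>"

definition EV_tensor_algebra ::
  "('a::topological_space \<Rightarrow> 'a) \<Rightarrow> ('b, 'k) cstar_alg_scheme
    \<Rightarrow> (('a \<Rightarrow> complex) \<Rightarrow> 'b) \<Rightarrow> (('a \<Rightarrow> complex) \<Rightarrow> 'b) \<Rightarrow> ('b, 'k) cstar_alg_scheme" where
  "EV_tensor_algebra \<sigma> = tensor_algebra C_algebra (graph_correspondence (EV_graph \<sigma>))"

definition topologically_free :: "('a::topological_space \<Rightarrow> 'a) \<Rightarrow> bool" where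
  "topologically_free \<sigma> \<longleftrightarrow> (\<forall>m n. m \<noteq> n \<longrightarrow> interior {v. (\<sigma> ^^ m) v = (\<sigma> ^^ n) v} = {})"


section \<open>The data of a covering map form a C*-correspondence\<close>

text \<open>
  The lemmas below show that, for a covering map of a compact Hausdorff space, the records
  \<open>C_algebra\<close> and \<open>graph_correspondence (EV_graph \<sigma>)\<close> satisfy the axioms of a C*-algebra and
  of a C*-correspondence, so the locale of Toeplitz representations imposes nothing on them.
\<close>


lemma cring_complex_ring: "cring complex_ring"
proof (rule cringI)
  show "abelian_group complex_ring"
  proof (rule abelian_groupI)
    fix x assume "x \<in> carrier complex_ring"
    show "\<exists>y\<in>carrier complex_ring. y \<oplus>\<^bsub>complex_ring\<^esub> x = \<zero>\<^bsub>complex_ring\<^esub>"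
      by (rule bexI[of _ "- x"]) (auto simp: complex_ring_def)
  qed (auto simp: complex_ring_def)
  show "comm_monoid complex_ring"
    by (rule comm_monoidI) (auto simp: complex_ring_def)
qed (auto simp: complex_ring_def algebra_simps)

lemma module_functions:
  fixes X :: "(complex, 'x::topological_space \<Rightarrow> complex, 'm) module_scheme"
  assumes "carrier X = {f. continuous_on UNIV f}" "zero X = (\<lambda>v. 0)"
    "add X = (\<lambda>f g v. f v + g v)" "smult X = (\<lambda>c f v. c * f v)"
  shows "Module.module complex_ring X"
proof (rule moduleI)
  show "cring complex_ring" by (rule cring_complex_ring)
  show "abelian_group X"
  proof (rule abelian_groupI)
    fix x assume "x \<in> carrier X"
    then show "\<exists>y\<in>carrier X. y \<oplus>\<^bsub>X\<^esub> x = \<zero>\<^bsub>X\<^esub>"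
      by (intro bexI[of _ "\<lambda>v. - x v"]) (auto simp: assms intro!: continuous_intros)
  qed (auto simp: assms intro!: continuous_intros)
qed (auto simp: assms complex_ring_def algebra_simps intro!: continuous_intros)

lemma minus_functions:
  fixes X :: "(complex, 'x::topological_space \<Rightarrow> complex, 'm) module_scheme"
  assumes "carrier X = {f. continuous_on UNIV f}" "zero X = (\<lambda>v. 0)"
    "add X = (\<lambda>f g v. f v + g v)" "smult X = (\<lambda>c f v. c * f v)"
    and f: "continuous_on UNIV f" "continuous_on UNIV g"
  shows "f \<ominus>\<^bsub>X\<^esub> g = (\<lambda>v. f v - g v)"
proof -
  interpret Module.module complex_ring X by (rule module_functions) fact+
  have "\<ominus>\<^bsub>X\<^esub> g = (\<lambda>v. - g v)"
  proof (rule M.minus_equality)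
    show "(\<lambda>v. - g v) \<oplus>\<^bsub>X\<^esub> g = \<zero>\<^bsub>X\<^esub>" by (auto simp: assms)
  qed (auto simp: assms f intro!: continuous_intros)
  then show ?thesis by (simp add: a_minus_def assms)
qed

lemma C_algebra_simps:
  "carrier C_algebra = {f. continuous_on UNIV f}" "zero C_algebra = (\<lambda>v. 0)" "mult C_algebra = (\<lambda>f g v. f v * g v)"
  "add C_algebra = (\<lambda>f g v. f v + g v)" "smult C_algebra = (\<lambda>c f v. c * f v)"
  "nrm C_algebra = (\<lambda>f. SUP v. cmod (f v))" "star C_algebra = (\<lambda>f v. cnj (f v))"
  by (auto simp: C_algebra_def)

context
  fixes u :: "'v::topological_space itself"
  assumes cpt: "compact (UNIV :: 'v set)"
begin

lemma bdd_above_cmod: "continuous_on UNIV f \<Longrightarrow> bdd_above (range (\<lambda>v::'v. cmod (f v)))"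
proof -
  assume "continuous_on UNIV f"
  then have "compact (range (\<lambda>v. cmod (f v)))"
    by (intro compact_continuous_image cpt continuous_intros)
  then show ?thesis by (intro bounded_imp_bdd_above compact_imp_bounded)
qed

lemma cmod_le_SUP: "continuous_on UNIV f \<Longrightarrow> cmod (f v) \<le> (SUP v::'v. cmod (f v))"
  by (rule cSUP_upper) (auto intro: bdd_above_cmod)

lemma SUP_square:
  assumes f: "continuous_on UNIV f"
  shows "(SUP v::'v. cmod (f v) * cmod (f v)) = (SUP v::'v. cmod (f v))\<^sup>2"
proof (rule antisym)
  have "0 \<le> (SUP v. cmod (f v))" using cmod_le_SUP[OF f, of undefined] norm_ge_zero order_trans by blast
  then show "(SUP v. cmod (f v) * cmod (f v)) \<le> (SUP v. cmod (f v))\<^sup>2"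
    by (intro cSUP_least) (auto simp: power2_eq_square intro!: mult_mono cmod_le_SUP f)
  obtain w where w: "\<And>v. cmod (f v) \<le> cmod (f w)"
    using continuous_attains_sup[OF cpt _ continuous_on_norm[OF f]] by auto
  have "(SUP v. cmod (f v)) = cmod (f w)"
    using w by (intro cSup_eq_maximum) auto
  moreover have "cmod (f w) * cmod (f w) \<le> (SUP v. cmod (f v) * cmod (f v))"
    by (rule cSUP_upper) (auto intro!: bdd_aboveI[of _ "cmod (f w) * cmod (f w)"] mult_mono w)
  ultimately show "(SUP v. cmod (f v))\<^sup>2 \<le> (SUP v. cmod (f v) * cmod (f v))"
    by (simp add: power2_eq_square)
qed

lemma mcomplete_functions:
  fixes X :: "(complex, 'v \<Rightarrow> complex, 'm) module_scheme"
  assumes X: "carrier X = {f. continuous_on UNIV f}" "zero X = (\<lambda>v. 0)"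
    "add X = (\<lambda>f g v. f v + g v)" "smult X = (\<lambda>c f v. c * f v)"
    and ms: "Metric_space (carrier X) (norm_dist X N)"
    and ge: "\<And>f v. continuous_on UNIV f \<Longrightarrow> cmod (f v) \<le> N f"
    and lim: "\<And>s f e. \<lbrakk>\<And>n. continuous_on UNIV (s n); continuous_on UNIV f; \<And>v. (\<lambda>n. s n v) \<longlonglongrightarrow> f v;
        \<And>n. N (s n) \<le> e; e > 0\<rbrakk> \<Longrightarrow> N f \<le> e"
  shows "Metric_space.mcomplete (carrier X) (norm_dist X N)"
proof -
  interpret Metric_space "carrier X" "norm_dist X N" by (rule ms)
  note minus = minus_functions[OF X]
  show ?thesis unfolding mcomplete_def
  proof (intro allI impI)
    fix s assume "MCauchy s"
    then have s: "\<And>n. continuous_on UNIV (s n)"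
      and C: "\<And>e. e > 0 \<Longrightarrow> \<exists>M. \<forall>n m. M \<le> n \<longrightarrow> M \<le> m \<longrightarrow> N (\<lambda>v. s n v - s m v) < e"
      unfolding MCauchy_def by (auto simp: X norm_dist_def minus image_subset_iff)
    have "uniformly_Cauchy_on UNIV s"
      unfolding uniformly_Cauchy_on_def
    proof (intro allI impI)
      fix e :: real assume "e > 0"
      then obtain M where M: "\<And>n m. M \<le> n \<Longrightarrow> M \<le> m \<Longrightarrow> N (\<lambda>v. s n v - s m v) < e"
        using C by blast
      have "dist (s m x) (s n x) < e" if "M \<le> m" "M \<le> n" for m n x
        using ge[OF continuous_on_diff[OF s[of m] s[of n]], of x] M[OF that] by (simp add: dist_norm)
      then show "\<exists>M. \<forall>x\<in>UNIV. \<forall>m\<ge>M. \<forall>n\<ge>M. dist (s m x) (s n x) < e" by blast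
    qed
    then have "uniformly_convergent_on UNIV s" by (rule Cauchy_uniformly_convergent)
    then obtain f where f: "uniform_limit UNIV s f sequentially"
      by (auto simp: uniformly_convergent_on_def)
    have cf: "continuous_on UNIV f"
      by (rule uniform_limit_theorem[OF _ f]) (auto simp: s)
    have pf: "(\<lambda>n. s n v) \<longlonglongrightarrow> f v" for v
      using f by (rule tendsto_uniform_limitI) auto
    have "\<forall>\<^sub>F n in sequentially. N (\<lambda>v. s n v - f v) < e" if "e > 0" for e
    proof -
      obtain M where M: "\<And>n m. M \<le> n \<Longrightarrow> M \<le> m \<Longrightarrow> N (\<lambda>v. s n v - s m v) < e/2"
        using C[of "e/2"] \<open>e > 0\<close> by auto
      have "N (\<lambda>v. s n v - f v) \<le> e/2" if "n \<ge> M" for n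
      proof (rule lim[of "\<lambda>m v. s n v - s (m + M) v"])
        show "(\<lambda>m. s n v - s (m + M) v) \<longlonglongrightarrow> s n v - f v" for v
          by (intro tendsto_intros LIMSEQ_ignore_initial_segment pf)
        show "N (\<lambda>v. s n v - s (m + M) v) \<le> e/2" for m
          using M[OF that, of "m + M"] by auto
      qed (use \<open>e > 0\<close> s cf in \<open>auto intro!: continuous_intros\<close>)
      then show ?thesis using \<open>e > 0\<close> by (force simp: eventually_sequentially)
    qed
    then have "limitin mtopology s f sequentially"
      unfolding limitin_metric by (simp add: X cf s norm_dist_def minus)
    then show "\<exists>x. limitin mtopology s x sequentially" by blast
  qed
qed

lemma cstar_algebra_C_algebra: "cstar_algebra (C_algebra :: ('v \<Rightarrow> complex) cstar_alg)"
proof -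
  let ?C = "C_algebra :: ('v \<Rightarrow> complex) cstar_alg"
  have SUP0: "0 \<le> (SUP v::'v. cmod (f v))" if "continuous_on UNIV f" for f
    using cmod_le_SUP[OF that, of undefined] norm_ge_zero order_trans by blast
  interpret complex_normed_algebra ?C
  proof (intro complex_normed_algebra.intro complex_normed_algebra_axioms.intro)
    show "Module.module complex_ring ?C" by (rule module_functions) (auto simp: C_algebra_simps)
  next
    fix x assume "x \<in> carrier ?C"
    then have x: "continuous_on UNIV x" by (simp add: C_algebra_simps)
    show "(nrm ?C x = 0) \<longleftrightarrow> x = \<zero>\<^bsub>?C\<^esub>"
    proof
      assume "nrm ?C x = 0" then have "cmod (x v) \<le> 0" for v
        using cmod_le_SUP[OF x, of v] by (simp add: C_algebra_simps)
      then show "x = \<zero>\<^bsub>?C\<^esub>" by (auto simp: C_algebra_simps)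
    qed (simp add: C_algebra_simps)
    fix c
    obtain w where w: "\<And>v. cmod (x v) \<le> cmod (x w)"
      using continuous_attains_sup[OF cpt _ continuous_on_norm[OF x]] by auto
    have "(SUP v. cmod (x v)) = cmod (x w)" using w by (intro cSup_eq_maximum) auto
    moreover have "(SUP v. cmod (c * x v)) = cmod (c * x w)"
      using w by (intro cSup_eq_maximum) (auto simp: norm_mult mult_left_mono)
    ultimately show "nrm ?C (c \<odot>\<^bsub>?C\<^esub> x) = cmod c * nrm ?C x"
      by (simp add: C_algebra_simps norm_mult)
    fix y assume "y \<in> carrier ?C"
    then have y: "continuous_on UNIV y" by (simp add: C_algebra_simps)
    show "nrm ?C (x \<oplus>\<^bsub>?C\<^esub> y) \<le> nrm ?C x + nrm ?C y"
      unfolding C_algebra_simps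
      by (intro cSUP_least) (auto intro: norm_triangle_le add_mono cmod_le_SUP x y)
    show "nrm ?C (x \<otimes>\<^bsub>?C\<^esub> y) \<le> nrm ?C x * nrm ?C y"
      unfolding C_algebra_simps
      by (intro cSUP_least) (auto simp: norm_mult intro!: mult_mono cmod_le_SUP x y SUP0)
  qed (auto simp: C_algebra_simps algebra_simps SUP0 intro!: continuous_intros)
  have ms: "Metric_space (carrier ?C) (norm_dist ?C (nrm ?C))"
  proof
    fix x y show "0 \<le> norm_dist ?C (nrm ?C) x y"
      by (auto simp: norm_dist_def intro: nrm_nonneg)
    show "norm_dist ?C (nrm ?C) x y = norm_dist ?C (nrm ?C) y x"
      by (auto simp: norm_dist_def C_algebra_simps minus_functions norm_minus_commute)
    fix z
    assume "x \<in> carrier ?C" "y \<in> carrier ?C" 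
    then have x: "continuous_on UNIV x" and y: "continuous_on UNIV y" by (auto simp: C_algebra_simps)
    have "nrm ?C (x \<ominus>\<^bsub>?C\<^esub> y) = 0 \<longleftrightarrow> (\<lambda>v. x v - y v) = (\<lambda>v. 0)"
      using nrm_eq_0[of "\<lambda>v. x v - y v"] x y
      by (auto simp: C_algebra_simps minus_functions continuous_on_diff)
    then show "norm_dist ?C (nrm ?C) x y = 0 \<longleftrightarrow> x = y"
      using x y by (auto simp: norm_dist_def C_algebra_simps fun_eq_iff)
    assume "z \<in> carrier ?C" then have z: "continuous_on UNIV z"  by (auto simp: C_algebra_simps)
    show "norm_dist ?C (nrm ?C) x z \<le> norm_dist ?C (nrm ?C) x y + norm_dist ?C (nrm ?C) y z"
      using nrm_triangle[of "\<lambda>v. x v - y v" "\<lambda>v. y v - z v"] x y z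
      by (auto simp: norm_dist_def C_algebra_simps minus_functions continuous_on_diff)
  qed
  show ?thesis
  proof (unfold_locales, goal_cases)
    case 1 show ?case
    proof (rule mcomplete_functions[OF _ _ _ _ ms])
      fix s and f :: "'v \<Rightarrow> complex" and e :: real
      assume s: "\<And>n. continuous_on UNIV (s n)" and *: "\<And>v. (\<lambda>n. s n v) \<longlonglongrightarrow> f v"
        and le: "\<And>n. nrm ?C (s n) \<le> e"
      have "cmod (f v) \<le> e" for v
      proof (rule LIMSEQ_le_const2[OF tendsto_norm[OF *]])
        show "\<exists>N. \<forall>n\<ge>N. cmod (s n v) \<le> e"
          using le cmod_le_SUP[OF s, of _ v] by (auto simp: C_algebra_simps intro: order_trans)
      qed
      then show "nrm ?C f \<le> e" unfolding C_algebra_simps by (intro cSUP_least) auto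
    qed (auto simp: C_algebra_simps cmod_le_SUP)
  qed (auto simp: C_algebra_simps norm_mult SUP_square intro!: continuous_intros)
qed


end

lemma covering_space_sheets:
  fixes \<sigma> :: "'a::t2_space \<Rightarrow> 'a"
  assumes cpt: "compact (UNIV :: 'a set)" and cov: "covering_space UNIV \<sigma> UNIV"
  obtains T Q where "open T" "v \<in> T" "finite Q"
    "\<And>q. q \<in> Q \<Longrightarrow> continuous_on T q"
    "\<And>w. w \<in> T \<Longrightarrow> bij_betw (\<lambda>q. q w) Q {e. \<sigma> e = w}"
proof -
  have "\<exists>T. v \<in> T \<and> open T \<and> (\<exists>\<V>. \<Union>\<V> = \<sigma> -` T \<and> (\<forall>u\<in>\<V>. open u) \<and> pairwise disjnt \<V>
      \<and> (\<forall>u\<in>\<V>. \<exists>q. homeomorphism u T \<sigma> q))"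
    using cov unfolding covering_space_def subtopology_UNIV open_openin[symmetric] Int_UNIV_left
    by (elim conjE) (erule bspec[OF _ UNIV_I])
  then obtain T \<V> where T: "open T" "v \<in> T" and V: "\<Union>\<V> = \<sigma> -` T" "\<forall>u\<in>\<V>. open u"
    "pairwise disjnt \<V>" "\<forall>u\<in>\<V>. \<exists>q. homeomorphism u T \<sigma> q"
    by (elim exE conjE)
  from bchoice[OF V(4)] obtain q where q: "\<And>u. u \<in> \<V> \<Longrightarrow> homeomorphism u T \<sigma> (q u)"
    by auto
  have q1: "q u w \<in> u" "\<sigma> (q u w) = w" if "u \<in> \<V>" "w \<in> T" for u w
    using q[OF that(1)] that(2) by (auto simp: homeomorphism_def)
  have q2: "q u (\<sigma> e) = e" if "u \<in> \<V>" "e \<in> u" for u e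
    using q[OF that(1)] that(2) by (auto simp: homeomorphism_def)
  have disj: "u = u'" if "u \<in> \<V>" "u' \<in> \<V>" "e \<in> u" "e \<in> u'" for u u' e
    using V(3) that by (auto simp: pairwise_def disjnt_def)
  have "continuous_on UNIV \<sigma>" by (rule covering_space_imp_continuous[OF cov])
  then have "closed (\<sigma> -` {v})" by (intro closed_vimage) auto
  then have "compact (\<sigma> -` {v})" using compact_Int_closed[OF cpt] by simp
  moreover have "\<sigma> -` {v} \<subseteq> \<Union>\<V>" using V(1) T by auto
  ultimately obtain \<W> where W: "\<W> \<subseteq> \<V>" "finite \<W>" "\<sigma> -` {v} \<subseteq> \<Union>\<W>"
    using V(2) by (elim compactE) auto
  have "\<V> \<subseteq> \<W>"
  proof
    fix u assume u: "u \<in> \<V>"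
    then have "q u v \<in> \<Union>\<W>" using q1[OF u T(2)] W(3) by auto
    then obtain u' where "u' \<in> \<W>" "q u v \<in> u'" by auto
    then show "u \<in> \<W>" using disj[OF u _ q1(1)[OF u T(2)]] W(1) by blast
  qed
  then have fin: "finite \<V>" using W(2) finite_subset by blast
  have qinj: "u = u'" if "u \<in> \<V>" "u' \<in> \<V>" "q u w = q u' w" "w \<in> T" for u u' w
    using disj[OF that(1,2)] q1(1)[OF that(1,4)] q1(1)[OF that(2,4)] that(3) by auto
  show ?thesis
  proof (rule that[of T "q ` \<V>"])
    show "continuous_on T p" if "p \<in> q ` \<V>" for p
      using that q by (auto simp: homeomorphism_def)
    show "bij_betw (\<lambda>p. p w) (q ` \<V>) {e. \<sigma> e = w}" if w: "w \<in> T" for w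
      unfolding bij_betw_def
    proof
      show "inj_on (\<lambda>p. p w) (q ` \<V>)"
        using qinj[OF _ _ _ w] by (auto simp: inj_on_def)
      show "(\<lambda>p. p w) ` q ` \<V> = {e. \<sigma> e = w}"
      proof (intro equalityI subsetI)
        fix e assume "e \<in> {e. \<sigma> e = w}"
        then have e: "\<sigma> e = w" by simp
        then have "e \<in> \<Union>\<V>" unfolding V(1) using w by simp
        then obtain u where u: "u \<in> \<V>" "e \<in> u" by (rule UnionE)
        show "e \<in> (\<lambda>p. p w) ` q ` \<V>"
          unfolding image_image by (rule image_eqI[OF _ u(1)]) (use q2[OF u] e in simp)
      qed (use q1(2)[OF _ w] in auto)
    qed
  qed (use T fin in auto)
qed

lemma finite_fibre:
  fixes \<sigma> :: "'a::t2_space \<Rightarrow> 'a"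
  assumes "compact (UNIV :: 'a set)" "covering_space UNIV \<sigma> UNIV"
  shows "finite {e. \<sigma> e = v}"
  by (metis covering_space_sheets[OF assms] bij_betw_finite)

lemma continuous_fibre_sum:
  fixes \<sigma> :: "'a::t2_space \<Rightarrow> 'a" and h :: "'a \<Rightarrow> complex"
  assumes "compact (UNIV :: 'a set)" "covering_space UNIV \<sigma> UNIV" and h: "continuous_on UNIV h"
  shows "continuous_on UNIV (\<lambda>v. \<Sum>e | \<sigma> e = v. h e)"
  unfolding continuous_on_eq_continuous_at[OF open_UNIV]
proof
  fix v
  obtain T Q where T: "open T" "v \<in> T" "finite Q"
    and Q: "\<And>q. q \<in> Q \<Longrightarrow> continuous_on T q"
    "\<And>w. w \<in> T \<Longrightarrow> bij_betw (\<lambda>q. q w) Q {e. \<sigma> e = w}"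
    using covering_space_sheets[OF assms(1,2)] by metis
  have "continuous_on T (\<lambda>w. \<Sum>q\<in>Q. h (q w))"
    by (intro continuous_on_sum continuous_on_compose2[OF h] Q(1)) auto
  then have "continuous_on T (\<lambda>v. \<Sum>e | \<sigma> e = v. h e)"
    by (rule continuous_on_eq) (rule sum.reindex_bij_betw[OF Q(2)])
  then show "isCont (\<lambda>v. \<Sum>e | \<sigma> e = v. h e) v"
    using T by (simp add: continuous_on_eq_continuous_at)
qed

lemma graph_correspondence_simps:
  "carrier (graph_correspondence G) = {F. continuous_on UNIV F}"
  "zero (graph_correspondence G) = (\<lambda>e. 0)"
  "add (graph_correspondence G) = (\<lambda>F H e. F e + H e)"
  "smult (graph_correspondence G) = (\<lambda>c F e. c * F e)"
  "ract (graph_correspondence G) = (\<lambda>F g e. F e * g (source_map G e))"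
  "ip (graph_correspondence G) = (\<lambda>F H v. \<Sum>e | source_map G e = v. cnj (F e) * H e)"
  "lact (graph_correspondence G) = (\<lambda>f F e. f (range_map G e) * F e)"
  "range_map (EV_graph \<sigma>) = id" "source_map (EV_graph \<sigma>) = \<sigma>"
  by (auto simp: graph_correspondence_def EV_graph_def)

lemma EV_cstar_correspondence:
  fixes \<sigma> :: "'a::t2_space \<Rightarrow> 'a"
  assumes cpt: "compact (UNIV :: 'a set)" and cov: "covering_space UNIV \<sigma> UNIV"
  shows "cstar_correspondence C_algebra (graph_correspondence (EV_graph \<sigma>))"
proof -
  let ?C = "C_algebra :: ('a \<Rightarrow> complex) cstar_alg"
  let ?X = "graph_correspondence (EV_graph \<sigma>)"
  note fin = finite_fibre[OF cpt cov]
  note cont = continuous_fibre_sum[OF cpt cov]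
  note simps = C_algebra_simps graph_correspondence_simps
  have c\<sigma>: "continuous_on UNIV \<sigma>" by (rule covering_space_imp_continuous[OF cov])
  have cg\<sigma>: "continuous_on UNIV (\<lambda>e. g (\<sigma> e))" if "continuous_on UNIV g" for g :: "'a \<Rightarrow> complex"
    using continuous_on_compose2[OF that c\<sigma>] by auto
  interpret A: cstar_algebra ?C by (rule cstar_algebra_C_algebra[OF cpt])
  interpret X: Module.module complex_ring ?X
    by (rule module_functions) (auto simp: simps)
  define S where "S F v = (\<Sum>e | \<sigma> e = v. (cmod (F e))\<^sup>2)" for F :: "'a \<Rightarrow> complex" and v
  have S_nonneg: "0 \<le> S F v" for F v by (simp add: S_def sum_nonneg)
  have ip_S: "ip ?X F F = (\<lambda>v. of_real (S F v))" for F
    by (auto simp: simps S_def complex_norm_square mult.commute of_real_sum simp del: of_real_power)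
  have cont_cS: "continuous_on UNIV (\<lambda>v. complex_of_real (S F v))" if "continuous_on UNIV F" for F
    unfolding ip_S[symmetric] simps
    by (intro cont continuous_on_mult continuous_on_cnj that)
  have cont_S: "continuous_on UNIV (S F)" if "continuous_on UNIV F" for F
    using continuous_on_Re[OF cont_cS[OF that]] by simp
  let ?N = "hilbert_nrm ?C ?X"
  have N: "?N F = sqrt (SUP v. S F v)" for F
    by (simp add: hilbert_nrm_def ip_S simps(6) S_nonneg)
  have S_le: "S F v \<le> (SUP v. S F v)" if "continuous_on UNIV F" for F v
    using cmod_le_SUP[OF cpt cont_cS[OF that], of v] by (simp add: S_nonneg)
  have S_le_N: "sqrt (S F v) \<le> ?N F" if "continuous_on UNIV F" for F v
    unfolding N using S_le[OF that] by simp
  have le_S: "cmod (F e) \<le> sqrt (S F (\<sigma> e))" for F e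
  proof (rule real_le_rsqrt)
    show "(cmod (F e))\<^sup>2 \<le> S F (\<sigma> e)" unfolding S_def
      by (rule member_le_sum) (auto simp: fin)
  qed
  have le_N: "cmod (F e) \<le> ?N F" if "continuous_on UNIV F" for F e
    using le_S S_le_N[OF that] order_trans by blast
  have N_leI: "?N F \<le> c" if "\<And>v. sqrt (S F v) \<le> c" for F c
  proof -
    have c: "0 \<le> c" using that[of undefined] S_nonneg by (meson order_trans real_sqrt_ge_zero)
    have "(SUP v. S F v) \<le> c\<^sup>2"
      using that by (intro cSUP_least) (auto simp: sqrt_le_D)
    then show ?thesis unfolding N using c real_le_lsqrt S_nonneg by (simp add: real_sqrt_le_iff real_le_lsqrt)
  qed
  have S_tri: "sqrt (S (\<lambda>e. F e + H e) v) \<le> sqrt (S F v) + sqrt (S H v)" for F H v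
  proof -
    have "sqrt (S (\<lambda>e. F e + H e) v) = L2_set (\<lambda>e. cmod (F e + H e)) {e. \<sigma> e = v}"
      by (simp add: S_def L2_set_def)
    also have "\<dots> \<le> L2_set (\<lambda>e. cmod (F e) + cmod (H e)) {e. \<sigma> e = v}"
      by (rule L2_set_mono) (auto simp: norm_triangle_ineq)
    also have "\<dots> \<le> L2_set (\<lambda>e. cmod (F e)) {e. \<sigma> e = v} + L2_set (\<lambda>e. cmod (H e)) {e. \<sigma> e = v}"
      by (rule L2_set_triangle_ineq)
    finally show ?thesis by (simp add: S_def L2_set_def)
  qed
  have N_tri: "?N (\<lambda>e. F e + H e) \<le> ?N F + ?N H" if "continuous_on UNIV F" "continuous_on UNIV H" for F H
    using S_tri[of F H] S_le_N[OF that(1)] S_le_N[OF that(2)]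
    by (intro N_leI) (meson add_mono order_trans)
  have N_nonneg: "0 \<le> ?N F" if "continuous_on UNIV F" for F
    using le_N[OF that] norm_ge_zero order_trans by blast
  have minus: "F \<ominus>\<^bsub>?X\<^esub> H = (\<lambda>e. F e - H e)" if "continuous_on UNIV F" "continuous_on UNIV H" for F H
    by (rule minus_functions) (auto simp: simps that)
  have N0: "?N (\<lambda>e. 0) = 0" by (simp add: N S_def)
  have ms: "Metric_space (carrier ?X) (norm_dist ?X ?N)"
  proof
    fix x y z
    show "0 \<le> norm_dist ?X ?N x y"
      by (auto simp: norm_dist_def simps minus intro!: N_nonneg continuous_on_diff)
    show "norm_dist ?X ?N x y = norm_dist ?X ?N y x"
      by (auto simp: norm_dist_def simps minus N S_def norm_minus_commute)
    assume "x \<in> carrier ?X" "y \<in> carrier ?X"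
    then have x: "continuous_on UNIV x" and y: "continuous_on UNIV y" by (auto simp: simps)
    show "norm_dist ?X ?N x y = 0 \<longleftrightarrow> x = y"
    proof
      assume "norm_dist ?X ?N x y = 0"
      then have "cmod (x v - y v) \<le> 0" for v
        using le_N[OF continuous_on_diff[OF x y], of v] x y by (simp add: norm_dist_def simps minus)
      then show "x = y" by auto
    next
      assume "x = y"
      then show "norm_dist ?X ?N x y = 0"
        using x y by (auto simp: norm_dist_def minus simps N0)
    qed
    assume "z \<in> carrier ?X"
    then have z: "continuous_on UNIV z" by (auto simp: simps)
    show "norm_dist ?X ?N x z \<le> norm_dist ?X ?N x y + norm_dist ?X ?N y z"
      using N_tri[OF continuous_on_diff[OF x y] continuous_on_diff[OF y z]] x y z
      by (auto simp: norm_dist_def simps minus)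
  qed
  have complete: "Metric_space.mcomplete (carrier ?X) (norm_dist ?X ?N)"
  proof (rule mcomplete_functions[OF cpt _ _ _ _ ms])
    fix s f and e :: real
    assume s: "\<And>n. continuous_on UNIV (s n)" and *: "\<And>v. (\<lambda>n. s n v) \<longlonglongrightarrow> f v"
      and le: "\<And>n. ?N (s n) \<le> e"
    show "?N f \<le> e"
    proof (rule N_leI)
      fix v
      have "(\<lambda>n. sqrt (S (s n) v)) \<longlonglongrightarrow> sqrt (S f v)"
        unfolding S_def by (intro tendsto_intros *)
      then show "sqrt (S f v) \<le> e"
        by (rule LIMSEQ_le_const2) (use le S_le_N[OF s] order_trans in blast)
    qed
  qed (auto simp: simps le_N)
  show ?thesis
  proof (unfold_locales, goal_cases)
    case (12 x)
    then have x: "continuous_on UNIV x" by (simp add: simps)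
    show ?case
    proof (rule bexI[of _ "\<lambda>v. complex_of_real (sqrt (S x v))"])
      show "ip ?X x x = star ?C (\<lambda>v. complex_of_real (sqrt (S x v))) \<otimes>\<^bsub>?C\<^esub> (\<lambda>v. complex_of_real (sqrt (S x v)))"
        by (auto simp: ip_S C_algebra_simps S_nonneg simp flip: of_real_mult)
    qed (auto simp: simps intro!: continuous_intros cont_S[OF x])
  next
    case (13 x)
    then have "S x v = 0" for v by (auto simp: ip_S C_algebra_simps fun_eq_iff)
    then show ?case using le_S[of x] by (auto simp: simps)
  next
    case 14
    show ?case by (rule complete)
  qed (auto simp: simps sum.distrib sum_distrib_left sum_distrib_right algebra_simps
        intro!: continuous_intros cont cg\<sigma>)
qed

end

theory Submission
  imports Defs
begin

text \<open>
  Write \<open>s = t 1\<close>.  The tensor algebra is the closed span of the monomials \<open>\<pi> f s\<^sup>n\<close>, and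
  \<open>s (\<pi> g) = \<pi> (g \<circ> \<sigma>) s\<close>.  The Fock representation yields bounded coefficient maps
  \<open>c n x :: \<Omega> \<Rightarrow> \<complex>\<close>, and Fejer summation along the gauge action shows that they determine \<open>x\<close>.
  If \<open>e, \<sigma> e, \<dots>, \<sigma>\<^sup>n e\<close> are distinct, the numbers \<open>c (j - i) x (\<sigma>\<^sup>i e)\<close> form an upper triangular
  matrix, and \<open>x\<close> goes to this matrix under a homomorphism onto all upper triangular matrices.  Its
  kernel is spanned by products of its elements, hence invariant under derivations; so an
  approximately local derivation induces one on the triangular matrices, where it is a derivation
  because that algebra is spanned by idempotents.  By topological freeness such points \<open>e\<close>
  are dense, so the coefficients of \<open>\<delta> (x y) - \<delta> x y - x \<delta> y\<close> vanish.
\<close>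


section \<open>Carrier-based normed algebras\<close>

text \<open>The norm of \<open>B\<close> is reached only through the universal property, which is
  purely algebraic. So homomorphisms must first be shown to be bounded; this is done without a unit
  or spectral theory, at the price of a factor 2 that persists in later estimates.

  The derivations that approximate \<delta> at x depend on x, so the Leibniz rule, which involves
  three values of \<delta>, does not pass to the limit. What passes are bounded linear conditions on
  a single value: if x b and b y are zero, then x D(b) y is zero for every derivation D, hence x
  \<delta>(b) y is zero. With b built from idempotents p, q and their complements, four such
  conditions combine to the Leibniz rule for p and q. Quotient algebras are never formed: ideals,
  and bounded functionals that vanish on them, take their place.\<close>

context complex_normed_algebra
begin

lemma smult_add_left: "x \<in> carrier B \<Longrightarrow> (a + b) \<odot> x = a \<odot> x \<oplus> b \<odot> x"
  using smult_l_distr[of a b x] by (simp add: complex_ring_def)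

lemma smult_assoc: "x \<in> carrier B \<Longrightarrow> (a * b) \<odot> x = a \<odot> (b \<odot> x)"
  using smult_assoc1[of a b x] by (simp add: complex_ring_def)

lemma smult_in_carrier: "x \<in> carrier B \<Longrightarrow> a \<odot> x \<in> carrier B"
  using smult_closed[of a x] by (simp add: complex_ring_def)

lemma smult_one_left: "x \<in> carrier B \<Longrightarrow> 1 \<odot> x = x"
  using smult_one[of x] by (simp add: complex_ring_def)

lemma smult_add_right: "\<lbrakk>x \<in> carrier B; y \<in> carrier B\<rbrakk> \<Longrightarrow> a \<odot> (x \<oplus> y) = a \<odot> x \<oplus> a \<odot> y"
  using smult_r_distr[of a x y] by (simp add: complex_ring_def)

lemma smult_zero_left: "x \<in> carrier B \<Longrightarrow> 0 \<odot> x = \<zero>"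
  using smult_l_null[of x] by (simp add: complex_ring_def)

lemma smult_zero_right: "a \<odot> \<zero> = \<zero>"
  using smult_r_null[of a] by (simp add: complex_ring_def)

lemma a_inv_eq_smult: "x \<in> carrier B \<Longrightarrow> \<ominus> x = (-1) \<odot> x"
proof (rule M.minus_equality)
  assume x: "x \<in> carrier B"
  have "(-1) \<odot> x \<oplus> 1 \<odot> x = 0 \<odot> x" using smult_add_left[OF x, of "-1" 1] by simp
  then show "(-1) \<odot> x \<oplus> x = \<zero>" using x by (simp add: smult_one_left smult_zero_left)
qed (auto simp: smult_in_carrier)

lemma minus_eq_smult: "y \<in> carrier B \<Longrightarrow> x \<ominus> y = x \<oplus> (-1) \<odot> y"
  by (simp add: a_minus_def a_inv_eq_smult)

lemma minus_in_carrier: "\<lbrakk>x \<in> carrier B; y \<in> carrier B\<rbrakk> \<Longrightarrow> x \<ominus> y \<in> carrier B"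
  by (simp add: a_minus_def)

lemma smult_minus: "\<lbrakk>x \<in> carrier B; y \<in> carrier B\<rbrakk> \<Longrightarrow> a \<odot> (x \<ominus> y) = a \<odot> x \<ominus> a \<odot> y"
  by (simp add: minus_eq_smult smult_add_right smult_in_carrier flip: smult_assoc)

lemma mult_minus_left: "\<lbrakk>x \<in> carrier B; y \<in> carrier B; z \<in> carrier B\<rbrakk> \<Longrightarrow> (x \<ominus> y) \<otimes> z = x \<otimes> z \<ominus> y \<otimes> z"
  by (simp add: minus_eq_smult distr_left smult_in_carrier scale_mult_left mult_closed)

lemma mult_minus_right: "\<lbrakk>x \<in> carrier B; y \<in> carrier B; z \<in> carrier B\<rbrakk> \<Longrightarrow> z \<otimes> (x \<ominus> y) = z \<otimes> x \<ominus> z \<otimes> y"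
  by (simp add: minus_eq_smult distr_right smult_in_carrier scale_mult_right mult_closed)

lemma nrm_zero [simp]: "nrm B \<zero> = 0"
  using nrm_eq_0[OF M.zero_closed] by simp

lemma minus_add_cancel: "\<lbrakk>x \<in> carrier B; y \<in> carrier B\<rbrakk> \<Longrightarrow> (x \<ominus> y) \<oplus> y = x"
  by (simp add: a_minus_def M.a_assoc M.l_neg)

lemma minus_eq_zero_iff: "\<lbrakk>x \<in> carrier B; y \<in> carrier B\<rbrakk> \<Longrightarrow> x \<ominus> y = \<zero> \<longleftrightarrow> x = y"
  by (metis M.l_zero M.r_neg a_minus_def minus_add_cancel)

lemma minus_self: "x \<in> carrier B \<Longrightarrow> x \<ominus> x = \<zero>"
  by (simp add: minus_eq_zero_iff)

lemma minus_telescope: "\<lbrakk>x \<in> carrier B; y \<in> carrier B; z \<in> carrier B\<rbrakk> \<Longrightarrow> (x \<ominus> y) \<oplus> (y \<ominus> z) = x \<ominus> z"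
  by (metis M.a_assoc a_minus_def M.add.inv_closed minus_add_cancel minus_in_carrier)

lemma minus_add_minus:
  "\<lbrakk>x \<in> carrier B; y \<in> carrier B; x' \<in> carrier B; y' \<in> carrier B\<rbrakk>
    \<Longrightarrow> (x \<oplus> y) \<ominus> (x' \<oplus> y') = (x \<ominus> x') \<oplus> (y \<ominus> y')"
  by (simp add: a_minus_def M.minus_add M.a_ac)

lemma nrm_minus_commute: "\<lbrakk>x \<in> carrier B; y \<in> carrier B\<rbrakk> \<Longrightarrow> nrm B (x \<ominus> y) = nrm B (y \<ominus> x)"
proof -
  assume *: "x \<in> carrier B" "y \<in> carrier B"
  then have "x \<ominus> y = (-1) \<odot> (y \<ominus> x)"
    by (simp add: minus_eq_smult smult_add_right smult_in_carrier smult_one_left M.a_comm flip: smult_assoc)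
  then show ?thesis using * by (simp add: nrm_scale minus_in_carrier)
qed

lemma nrm_minus_triangle:
  "\<lbrakk>x \<in> carrier B; y \<in> carrier B; z \<in> carrier B\<rbrakk> \<Longrightarrow> nrm B (x \<ominus> z) \<le> nrm B (x \<ominus> y) + nrm B (y \<ominus> z)"
  by (metis minus_telescope nrm_triangle minus_in_carrier)

lemma nrm_le_minus: "\<lbrakk>x \<in> carrier B; y \<in> carrier B\<rbrakk> \<Longrightarrow> nrm B x \<le> nrm B (x \<ominus> y) + nrm B y"
  by (metis minus_add_cancel nrm_triangle minus_in_carrier)

lemma nrm_minus_le: "\<lbrakk>x \<in> carrier B; y \<in> carrier B\<rbrakk> \<Longrightarrow> nrm B (x \<ominus> y) \<le> nrm B x + nrm B y"
  by (simp add: minus_eq_smult order_trans[OF nrm_triangle] smult_in_carrier nrm_scale)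

lemma metric_space: "Metric_space (carrier B) (norm_dist B (nrm B))"
proof
  fix x y z
  show "0 \<le> norm_dist B (nrm B) x y" "norm_dist B (nrm B) x y = norm_dist B (nrm B) y x"
    by (auto simp: norm_dist_def nrm_nonneg minus_in_carrier nrm_minus_commute)
  show "norm_dist B (nrm B) x y = 0 \<longleftrightarrow> x = y" if "x \<in> carrier B" "y \<in> carrier B"
    using that by (simp add: norm_dist_def nrm_eq_0 minus_in_carrier minus_eq_zero_iff)
  show "norm_dist B (nrm B) x z \<le> norm_dist B (nrm B) x y + norm_dist B (nrm B) y z"
    if "x \<in> carrier B" "y \<in> carrier B" "z \<in> carrier B"
    using that nrm_minus_triangle by (simp add: norm_dist_def)
qed

sublocale metric: Metric_space "carrier B" "norm_dist B (nrm B)"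
  by (rule metric_space)

lemma limitin_norm_topology:
  "limitin (norm_topology B) X l F \<longleftrightarrow>
    l \<in> carrier B \<and> (\<forall>\<epsilon>>0. \<forall>\<^sub>F k in F. X k \<in> carrier B \<and> nrm B (X k \<ominus> l) < \<epsilon>)"
  unfolding norm_topology_def metric.limitin_metric
  by (rule conj_cong[OF refl], intro all_cong eventually_subst eventuallyI) (auto simp: norm_dist_def)

lemma closedin_norm_topology:
  "closedin (norm_topology B) S \<longleftrightarrow>
    S \<subseteq> carrier B \<and> (\<forall>x\<in>carrier B. (\<forall>\<epsilon>>0. \<exists>y\<in>S. nrm B (x \<ominus> y) < \<epsilon>) \<longrightarrow> x \<in> S)"
proof -
  have *: "disjnt S (metric.mball x r) \<longleftrightarrow> \<not> (\<exists>y\<in>S. nrm B (x \<ominus> y) < r)"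
    if "S \<subseteq> carrier B" "x \<in> carrier B" for x r
    using that by (force simp: disjnt_iff norm_dist_def)
  show ?thesis unfolding norm_topology_def metric.closedin_metric
    using * by (metis DiffD1 DiffD2 DiffI)
qed

end

lemma (in complex_banach_algebra) Cauchy_limit:
  assumes X: "\<And>k. X k \<in> carrier B"
    and C: "\<And>\<epsilon>. \<epsilon> > 0 \<Longrightarrow> \<exists>N. \<forall>m\<ge>N. \<forall>n\<ge>N. nrm B (X m \<ominus> X n) < \<epsilon>"
  obtains l where "l \<in> carrier B" "(\<lambda>k. nrm B (X k \<ominus> l)) \<longlonglongrightarrow> 0"
proof -
  have "metric.MCauchy X"
    unfolding metric.MCauchy_def using X C by (fastforce simp: norm_dist_def)
  then obtain l where l: "limitin metric.mtopology X l sequentially"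
    using complete by (auto simp: metric.mcomplete_def)
  then have l': "l \<in> carrier B" "\<And>\<epsilon>. \<epsilon> > 0 \<Longrightarrow> \<forall>\<^sub>F k in sequentially. nrm B (X k \<ominus> l) < \<epsilon>"
    unfolding norm_topology_def[symmetric] limitin_norm_topology by (auto elim: eventually_mono)
  have "(\<lambda>k. nrm B (X k \<ominus> l)) \<longlonglongrightarrow> 0"
    by (rule tendstoI) (use l' X in \<open>auto simp: nrm_nonneg minus_in_carrier\<close>)
  then show ?thesis using that l' by blast
qed

lemma (in complex_normed_algebra) mcompleteI:
  assumes "\<And>X. \<lbrakk>\<And>k. X k \<in> carrier B; \<And>\<epsilon>. \<epsilon> > 0 \<Longrightarrow> \<exists>N. \<forall>m\<ge>N. \<forall>n\<ge>N. nrm B (X m \<ominus> X n) < \<epsilon>\<rbrakk>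
    \<Longrightarrow> \<exists>l\<in>carrier B. (\<lambda>k. nrm B (X k \<ominus> l)) \<longlonglongrightarrow> 0"
  shows "metric.mcomplete"
  unfolding metric.mcomplete_def
proof (intro allI impI)
  fix X assume "metric.MCauchy X"
  then have X: "\<And>k. X k \<in> carrier B"
    and C: "\<And>\<epsilon>. \<epsilon> > 0 \<Longrightarrow> \<exists>N. \<forall>m n. N \<le> m \<longrightarrow> N \<le> n \<longrightarrow> norm_dist B (nrm B) (X m) (X n) < \<epsilon>"
    unfolding metric.MCauchy_def by blast+
  from C X have C: "\<And>\<epsilon>. \<epsilon> > 0 \<Longrightarrow> \<exists>N. \<forall>m\<ge>N. \<forall>n\<ge>N. nrm B (X m \<ominus> X n) < \<epsilon>"
    by (simp add: norm_dist_def)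
  obtain l where l: "l \<in> carrier B" "(\<lambda>k. nrm B (X k \<ominus> l)) \<longlonglongrightarrow> 0"
    using assms[OF X C] by blast
  have "limitin (norm_topology B) X l sequentially"
    unfolding limitin_norm_topology using l X order_tendstoD(2)[OF l(2)] by simp
  then show "\<exists>x. limitin metric.mtopology X x sequentially" unfolding norm_topology_def by blast
qed


section \<open>Homomorphisms of C*-algebras are bounded\<close>

context cstar_algebra
begin

lemma nrm_star: "x \<in> carrier B \<Longrightarrow> nrm B (star B x) = nrm B x"
proof -
  have le: "nrm B x \<le> nrm B (star B x)" if x: "x \<in> carrier B" for x
  proof (cases "nrm B x = 0")
    case False
    have "nrm B x * nrm B x \<le> nrm B (star B x) * nrm B x"
      using nrm_mult[OF star_closed[OF x] x] cstar_identity[OF x] by (simp add: power2_eq_square)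
    then show ?thesis using False nrm_nonneg[OF x] by simp
  qed (simp add: nrm_nonneg star_closed x)
  assume "x \<in> carrier B"
  then show ?thesis using le[of x] le[of "star B x"] by (simp add: star_closed star_star)
qed

lemma star_minus: "\<lbrakk>x \<in> carrier B; y \<in> carrier B\<rbrakk> \<Longrightarrow> star B (x \<ominus> y) = star B x \<ominus> star B y"
  by (simp add: minus_eq_smult star_add star_scale smult_in_carrier star_closed)

text \<open>
  The square root of \<open>1 - h\<^sup>2\<close> is \<open>1 - y\<close> with \<open>y\<close> as below; this form makes sense without a unit.
\<close>

lemma selfadjoint_square_root:
  assumes h: "h \<in> carrier B" "star B h = h" "nrm B h \<le> 1/2"
  obtains y where "y \<in> carrier B" "star B y = y" "y \<otimes> h = h \<otimes> y" "y \<oplus> y = h \<otimes> h \<oplus> y \<otimes> y"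
proof -
  \<comment> \<open>A fixed point of \<open>F\<close> solves the required equation. On the ball of
    radius 1/2 the map is a contraction with factor 1/2, because x x - y y = x (x - y) + (x - y)
    y.\<close>
  define F where "F y = (1/2) \<odot> (h \<otimes> h \<oplus> y \<otimes> y)" for y
  define Y where "Y n = (F ^^ n) \<zero>" for n
  have YS: "Y (Suc n) = F (Y n)" for n by (simp add: Y_def)
  note cl = smult_in_carrier mult_closed minus_in_carrier star_closed h(1) nrm_nonneg
  have F: "F y \<in> carrier B" if "y \<in> carrier B" for y using that by (simp add: F_def cl)
  have hh: "nrm B (h \<otimes> h) \<le> 1/4"
    using nrm_mult[OF h(1) h(1)] mult_mono[OF h(3) h(3)] by (simp add: cl)
  have Y: "Y n \<in> carrier B \<and> nrm B (Y n) \<le> 1/2 \<and> star B (Y n) = Y n \<and> Y n \<otimes> h = h \<otimes> Y n" for n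
  proof (induction n)
    case 0
    have "star B \<zero> = star B (0 \<odot> h)" by (simp add: smult_zero_left h)
    also have "\<dots> = \<zero>" using h star_scale[of h 0] by (simp add: smult_zero_left)
    finally have "star B \<zero> = \<zero>" .
    moreover have "\<zero> \<otimes> h = \<zero>" "h \<otimes> \<zero> = \<zero>"
      using scale_mult_left[OF h(1) h(1), of 0] scale_mult_right[OF h(1) h(1), of 0]
      by (simp_all add: smult_zero_left cl)
    ultimately show ?case by (simp add: Y_def)
  next
    case (Suc n)
    then have n: "Y n \<in> carrier B" "nrm B (Y n) \<le> 1/2" "star B (Y n) = Y n" "Y n \<otimes> h = h \<otimes> Y n" by auto
    have "nrm B (Y n \<otimes> Y n) \<le> 1/4"
      using nrm_mult[OF n(1) n(1)] mult_mono[OF n(2) n(2)] n(1) by (simp add: cl)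
    then have "nrm B (h \<otimes> h \<oplus> Y n \<otimes> Y n) \<le> 1/2"
      using nrm_triangle[of "h \<otimes> h" "Y n \<otimes> Y n"] hh n by (simp add: cl)
    then have 1: "nrm B (F (Y n)) \<le> 1/2"
      using n by (simp add: F_def nrm_scale cl norm_divide)
    have 2: "star B (F (Y n)) = F (Y n)"
      using n h by (simp add: F_def star_scale star_add star_mult cl)
    have "(Y n \<otimes> Y n) \<otimes> h = h \<otimes> (Y n \<otimes> Y n)"
      using n h by (metis mult_assoc)
    then have 3: "F (Y n) \<otimes> h = h \<otimes> F (Y n)"
      using n h by (simp add: F_def scale_mult_left scale_mult_right distr_left distr_right cl mult_assoc)
    show ?case using 1 2 3 F n by (simp add: YS)
  qed
  have lip: "nrm B (F x \<ominus> F y) \<le> (1/2) * nrm B (x \<ominus> y)"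
    if "x \<in> carrier B" "y \<in> carrier B" "nrm B x \<le> 1/2" "nrm B y \<le> 1/2" for x y
  proof -
    have "F x \<ominus> F y = (1/2) \<odot> (x \<otimes> x \<ominus> y \<otimes> y)"
      using that by (simp add: F_def cl minus_add_minus M.r_neg flip: smult_minus) (simp add: a_minus_def M.r_neg cl)
    moreover have "x \<otimes> x \<ominus> y \<otimes> y = x \<otimes> (x \<ominus> y) \<oplus> (x \<ominus> y) \<otimes> y"
      using that minus_telescope[of "x \<otimes> x" "x \<otimes> y" "y \<otimes> y"]
      by (simp add: mult_minus_left mult_minus_right cl)
    moreover have "nrm B (x \<otimes> (x \<ominus> y) \<oplus> (x \<ominus> y) \<otimes> y) \<le> nrm B x * nrm B (x \<ominus> y) + nrm B (x \<ominus> y) * nrm B y"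
      using that by (intro order_trans[OF nrm_triangle] add_mono nrm_mult) (auto simp: cl)
    moreover have "nrm B x * nrm B (x \<ominus> y) + nrm B (x \<ominus> y) * nrm B y \<le> (1/2) * nrm B (x \<ominus> y) + nrm B (x \<ominus> y) * (1/2)"
      using that by (intro add_mono mult_mono) (auto simp: cl)
    ultimately show ?thesis using that by (simp add: nrm_scale cl norm_divide)
  qed
  have step: "nrm B (Y (Suc n) \<ominus> Y n) \<le> (1/2)^n" for n
  proof (induction n)
    case 0
    then show ?case using Y[of 0] Y[of 1] nrm_minus_le[of "Y 1" "Y 0"] by simp
  next
    case (Suc n)
    then show ?case using lip[of "Y (Suc n)" "Y n"] Y[of n] Y[of "Suc n"] by (simp add: YS)
  qed
  have far: "nrm B (Y (n + k) \<ominus> Y n) \<le> 2 * (1/2)^n - 2 * (1/2)^(n+k)" for n k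
  proof (induction k)
    case 0
    then show ?case using Y[of n] by (simp add: a_minus_def M.r_neg)
  next
    case (Suc k)
    then show ?case
      using nrm_minus_triangle[of "Y (n + Suc k)" "Y (n + k)" "Y n"] step[of "n+k"] Y by simp
  qed
  have far': "nrm B (Y m \<ominus> Y n) \<le> 2 * (1/2)^n" if "n \<le> m" for n m
    using far[of n "m - n"] that by (smt (verit) le_add_diff_inverse zero_le_power zero_less_divide_iff)
  obtain y where y: "y \<in> carrier B" and lim: "(\<lambda>k. nrm B (Y k \<ominus> y)) \<longlonglongrightarrow> 0"
  proof (rule Cauchy_limit[of Y])
    fix \<epsilon> :: real assume "\<epsilon> > 0"
    have "(\<lambda>n. 2 * (1/2::real)^n) \<longlonglongrightarrow> 2 * 0"
      by (intro tendsto_intros) (simp add: LIMSEQ_power_zero)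
    from order_tendstoD(2)[OF this, of \<epsilon>] \<open>\<epsilon> > 0\<close> obtain N where N: "\<And>n. n \<ge> N \<Longrightarrow> 2 * (1/2::real)^n < \<epsilon>"
      by (auto simp: eventually_sequentially)
    have "nrm B (Y m \<ominus> Y n) < \<epsilon>" if "m \<ge> N" "n \<ge> N" for m n
    proof (cases "n \<le> m")
      case True then show ?thesis using far'[of n m] N[of n] that by simp
    next
      case False then show ?thesis using far'[of m n] N[of m] that nrm_minus_commute[of "Y m" "Y n"] Y by simp
    qed
    then show "\<exists>N. \<forall>m\<ge>N. \<forall>n\<ge>N. nrm B (Y m \<ominus> Y n) < \<epsilon>" by blast
  qed (use Y in auto)
  \<comment> \<open>Each identity for the limit will follow by bounding the norm of the difference
    of its sides by a fixed multiple of the distance from \<open>Y k\<close> to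
    \<open>y\<close>.\<close>
  have zero: "x = x'" if "x \<in> carrier B" "x' \<in> carrier B" "\<And>k. nrm B (x \<ominus> x') \<le> C * nrm B (Y k \<ominus> y)" for x x' C
  proof -
    have "nrm B (x \<ominus> x') \<le> C * 0"
      by (rule LIMSEQ_le_const[OF tendsto_mult[OF tendsto_const lim]]) (use that in blast)
    then have "nrm B (x \<ominus> x') = 0" using that by (intro antisym nrm_nonneg minus_in_carrier) auto
    then show ?thesis using that nrm_eq_0[of "x \<ominus> x'"] by (simp add: minus_eq_zero_iff cl)
  qed
  have ny: "nrm B y \<le> 1/2"
  proof -
    have "nrm B y - 1/2 \<le> nrm B (Y k \<ominus> y)" for k
      using nrm_le_minus[of y "Y k"] Y[of k] y nrm_minus_commute[of y "Y k"] by simp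
    then have "nrm B y - 1/2 \<le> 0" by (intro LIMSEQ_le_const[OF lim]) auto
    then show ?thesis by simp
  qed
  show ?thesis
  proof (rule that[OF y])
    show "star B y = y"
    proof (rule zero[of _ _ 2])
      fix k
      have "nrm B (star B y \<ominus> y) \<le> nrm B (star B y \<ominus> star B (Y k)) + nrm B (Y k \<ominus> y)"
        using nrm_minus_triangle[of "star B y" "Y k" y] Y[of k] y by (simp add: cl)
      also have "star B y \<ominus> star B (Y k) = star B (y \<ominus> Y k)" using y Y by (simp add: star_minus)
      finally show "nrm B (star B y \<ominus> y) \<le> 2 * nrm B (Y k \<ominus> y)"
        using y Y[of k] nrm_star[of "y \<ominus> Y k"] nrm_minus_commute[of y "Y k"] by (simp add: cl)
    qed (use y cl in auto)
    show "y \<otimes> h = h \<otimes> y"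
    proof (rule zero[of _ _ 1])
      fix k
      have "nrm B (y \<otimes> h \<ominus> h \<otimes> y) \<le> nrm B (y \<otimes> h \<ominus> Y k \<otimes> h) + nrm B (h \<otimes> Y k \<ominus> h \<otimes> y)"
        using nrm_minus_triangle[of "y \<otimes> h" "Y k \<otimes> h" "h \<otimes> y"] Y[of k] y by (simp add: cl)
      also have "\<dots> = nrm B ((y \<ominus> Y k) \<otimes> h) + nrm B (h \<otimes> (Y k \<ominus> y))"
        using y Y[of k] by (simp add: mult_minus_left mult_minus_right cl)
      also have "\<dots> \<le> nrm B (Y k \<ominus> y) * nrm B h + nrm B h * nrm B (Y k \<ominus> y)"
        using y Y[of k] nrm_mult[of "y \<ominus> Y k" h] nrm_mult[of h "Y k \<ominus> y"] nrm_minus_commute[of y "Y k"]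
        by (intro add_mono) (auto simp: cl)
      also have "\<dots> \<le> nrm B (Y k \<ominus> y) * (1/2) + (1/2) * nrm B (Y k \<ominus> y)"
        using y Y[of k] h by (intro add_mono mult_mono) (auto simp: cl)
      finally show "nrm B (y \<otimes> h \<ominus> h \<otimes> y) \<le> 1 * nrm B (Y k \<ominus> y)" by simp
    qed (use y cl in auto)
    \<comment> \<open>Letting j tend to infinity in the estimate through \<open>Y (Suc j)\<close>
      already gives norm 0, so any nonnegative constant fits here.\<close>
    have "y = F y"
    proof (rule zero[of _ _ "3/2"])
      fix k
      have lim': "(\<lambda>k. nrm B (Y (Suc k) \<ominus> y)) \<longlonglongrightarrow> 0" using lim by (rule LIMSEQ_Suc)
      have "nrm B (y \<ominus> F y) \<le> nrm B (Y (Suc j) \<ominus> y) + (1/2) * nrm B (Y j \<ominus> y)" for j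
        using nrm_minus_triangle[of y "Y (Suc j)" "F y"] lip[of "Y j" y] Y[of j] Y[of "Suc j"] y ny F[OF y]
          nrm_minus_commute[of y "Y (Suc j)"] by (simp add: YS)
      then have "nrm B (y \<ominus> F y) \<le> 0 + (1/2) * 0"
        by (intro LIMSEQ_le_const[OF tendsto_add[OF lim' tendsto_mult[OF tendsto_const lim]]]) auto
      moreover have "0 \<le> nrm B (Y k \<ominus> y)" using Y y by (simp add: cl)
      ultimately show "nrm B (y \<ominus> F y) \<le> 3/2 * nrm B (Y k \<ominus> y)" by simp
    qed (use y F in auto)
    then have "y \<oplus> y = (1/2 + 1/2) \<odot> (h \<otimes> h \<oplus> y \<otimes> y)"
      unfolding F_def using y by (subst smult_add_left) (auto simp: cl)
    then show "y \<oplus> y = h \<otimes> h \<oplus> y \<otimes> y" using y by (simp add: smult_one_left cl)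
  qed
qed

end

locale cstar_algebra_hom = B: cstar_algebra B + D: cstar_algebra D
  for B (structure) and D (structure) +
  fixes \<phi>
  assumes hom: "star_hom B D \<phi>"
begin

lemma hom_closed: "x \<in> carrier B \<Longrightarrow> \<phi> x \<in> carrier D"
  and hom_add: "\<lbrakk>x \<in> carrier B; y \<in> carrier B\<rbrakk> \<Longrightarrow> \<phi> (x \<oplus> y) = \<phi> x \<oplus>\<^bsub>D\<^esub> \<phi> y"
  and hom_smult: "x \<in> carrier B \<Longrightarrow> \<phi> (a \<odot> x) = a \<odot>\<^bsub>D\<^esub> \<phi> x"
  and hom_mult: "\<lbrakk>x \<in> carrier B; y \<in> carrier B\<rbrakk> \<Longrightarrow> \<phi> (x \<otimes> y) = \<phi> x \<otimes>\<^bsub>D\<^esub> \<phi> y"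
  and hom_star: "x \<in> carrier B \<Longrightarrow> \<phi> (star B x) = star D (\<phi> x)"
  using hom by (auto simp: star_hom_def linear_map_def)

lemma hom_minus: "\<lbrakk>x \<in> carrier B; y \<in> carrier B\<rbrakk> \<Longrightarrow> \<phi> (x \<ominus> y) = \<phi> x \<ominus>\<^bsub>D\<^esub> \<phi> y"
  by (simp add: B.minus_eq_smult D.minus_eq_smult hom_add hom_smult B.smult_in_carrier hom_closed)

text \<open>
  The bound is not sharp, but suffices.  It comes from \<open>w = y + i h\<close>, where \<open>1 - w\<close> would be
  unitary: the relation \<open>w* w = w + w*\<close> passes to \<open>\<phi> w\<close> and forces norm at most 2.
\<close>

lemma hom_bounded_selfadjoint:
  assumes h: "h \<in> carrier B" "star B h = h" "nrm B h \<le> 1/2"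
  shows "nrm D (\<phi> h) \<le> 2"
proof -
  obtain y where y: "y \<in> carrier B" "star B y = y" "y \<otimes> h = h \<otimes> y"
    and yy: "y \<oplus> y = h \<otimes> h \<oplus> y \<otimes> y"
    using B.selfadjoint_square_root[OF h] by metis
  define w where "w = y \<oplus> \<i> \<odot> h"
  define v where "v = y \<oplus> (-\<i>) \<odot> h"
  note cl = B.smult_in_carrier B.mult_closed h(1) y(1) B.star_closed
  have w: "w \<in> carrier B" "v \<in> carrier B" by (auto simp: w_def v_def cl)
  have sw: "star B w = v" by (simp add: w_def v_def B.star_add B.star_scale h y cl)
  have cancel: "(-\<i>) \<odot> x \<oplus> \<i> \<odot> x = \<zero>" if "x \<in> carrier B" for x
    using B.smult_add_left[OF that, of "-\<i>" \<i>] B.smult_zero_left[OF that] by simp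
  have cancel': "(a \<oplus> (-\<i>) \<odot> x) \<oplus> (\<i> \<odot> x \<oplus> b) = a \<oplus> b"
    if "x \<in> carrier B" "a \<in> carrier B" "b \<in> carrier B" for a b x
  proof -
    have "(a \<oplus> (-\<i>) \<odot> x) \<oplus> (\<i> \<odot> x \<oplus> b) = a \<oplus> (((-\<i>) \<odot> x \<oplus> \<i> \<odot> x) \<oplus> b)"
      using that by (simp add: B.M.a_assoc B.smult_in_carrier)
    then show ?thesis using that by (simp add: cancel)
  qed
  \<comment> \<open>The terms in \<open>h \<otimes> y\<close> cancel because \<open>y\<close>
    commutes with \<open>h\<close>. The outcome v w = v + w is (1 - v)(1 - w) = 1 written without a
    unit.\<close>
  have "v \<otimes> w = (y \<otimes> y \<oplus> (-\<i>) \<odot> (h \<otimes> y)) \<oplus> (\<i> \<odot> (h \<otimes> y) \<oplus> h \<otimes> h)"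
    by (simp add: v_def w_def B.distr_left B.distr_right B.scale_mult_left B.scale_mult_right B.smult_add_right cl y(3) B.smult_one_left flip: B.smult_assoc)
  also have "\<dots> = y \<otimes> y \<oplus> h \<otimes> h" by (rule cancel') (auto simp: cl)
  also have "\<dots> = y \<oplus> y" by (simp add: yy B.M.a_comm cl)
  also have "\<dots> = v \<oplus> w"
    using cancel'[of h y y] by (simp add: v_def w_def B.M.a_comm cl)
  finally have vw: "v \<otimes> w = v \<oplus> w" .
  have c: "nrm D (\<phi> w) \<le> 2"
  proof (cases "nrm D (\<phi> w) = 0")
    case False
    have "(nrm D (\<phi> w))\<^sup>2 = nrm D (\<phi> v \<otimes>\<^bsub>D\<^esub> \<phi> w)"
      using D.cstar_identity[of "\<phi> w"] w hom_star[OF w(1)] by (simp add: hom_closed sw)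
    also have "\<dots> = nrm D (\<phi> v \<oplus>\<^bsub>D\<^esub> \<phi> w)"
      using w by (simp add: vw hom_add flip: hom_mult)
    also have "\<dots> \<le> nrm D (\<phi> v) + nrm D (\<phi> w)" using w by (intro D.nrm_triangle hom_closed)
    also have "nrm D (\<phi> v) = nrm D (\<phi> w)"
      using D.nrm_star[of "\<phi> w"] hom_star[OF w(1)] w by (simp add: hom_closed sw)
    finally have "nrm D (\<phi> w) * nrm D (\<phi> w) \<le> 2 * nrm D (\<phi> w)" by (simp add: power2_eq_square)
    then show ?thesis using False D.nrm_nonneg[of "\<phi> w"] w hom_closed by simp
  qed simp
  have c': "nrm D (\<phi> v) \<le> 2"
    using D.nrm_star[of "\<phi> w"] hom_star[OF w(1)] w c by (simp add: hom_closed sw)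
  have "h = (-\<i>/2) \<odot> (w \<ominus> v)"
  proof -
    have "w \<ominus> v = (2 * \<i>) \<odot> h"
      unfolding w_def v_def using B.smult_add_left[OF h(1), of "\<i>" "\<i>"]
      by (subst B.minus_add_minus) (auto simp: cl B.minus_eq_smult B.M.r_neg simp flip: B.smult_assoc B.smult_add_left B.a_inv_eq_smult)
    then show ?thesis by (simp add: h B.smult_one_left flip: B.smult_assoc)
  qed
  then have "\<phi> h = (-\<i>/2) \<odot>\<^bsub>D\<^esub> (\<phi> w \<ominus>\<^bsub>D\<^esub> \<phi> v)"
    using w by (metis hom_smult hom_minus B.minus_in_carrier)
  then have "nrm D (\<phi> h) = (1/2) * nrm D (\<phi> w \<ominus>\<^bsub>D\<^esub> \<phi> v)"
    using w by (simp add: D.nrm_scale D.minus_in_carrier hom_closed norm_divide)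
  also have "\<dots> \<le> (1/2) * (nrm D (\<phi> w) + nrm D (\<phi> v))"
    using D.nrm_minus_le[of "\<phi> w" "\<phi> v"] w by (simp add: hom_closed)
  finally show ?thesis using c c' by simp
qed

text \<open>The C*-identity reduces the claim to the self-adjoint element x* x, which
  \<open>r\<close> scales to norm 1/2. The bound 2 for its image becomes the factor 4 between the
  squares of the norms.\<close>

lemma hom_bounded:
  assumes x: "x \<in> carrier B"
  shows "nrm D (\<phi> x) \<le> 2 * nrm B x"
proof (cases "nrm B x = 0")
  case True
  then have "\<phi> x = \<phi> (0 \<odot> x)" using x by (simp add: B.nrm_eq_0 B.smult_zero_right)
  also have "\<dots> = \<zero>\<^bsub>D\<^esub>" using x by (subst hom_smult) (auto simp: D.smult_zero_left hom_closed)
  finally show ?thesis using True by simp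
next
  case False
  then have pos: "nrm B x > 0" using B.nrm_nonneg[OF x] by simp
  define r where "r = 1 / (2 * (nrm B x)\<^sup>2)"
  have r: "r > 0" using pos by (simp add: r_def)
  let ?y = "star B x \<otimes> x"
  have y: "?y \<in> carrier B" using x by (simp add: B.mult_closed B.star_closed)
  have "nrm D (\<phi> (of_real r \<odot> ?y)) \<le> 2"
  proof (rule hom_bounded_selfadjoint)
    show "star B (of_real r \<odot> ?y) = of_real r \<odot> ?y"
      using x y by (simp add: B.star_scale B.star_mult B.star_closed B.star_star)
    show "nrm B (of_real r \<odot> ?y) \<le> 1/2"
      using x y r pos by (simp add: B.nrm_scale B.cstar_identity) (simp add: r_def)
  qed (use y B.smult_in_carrier in auto)
  also have "\<phi> (of_real r \<odot> ?y) = of_real r \<odot>\<^bsub>D\<^esub> (star D (\<phi> x) \<otimes>\<^bsub>D\<^esub> \<phi> x)"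
    using x y by (simp add: hom_smult hom_mult hom_star B.star_closed)
  also have "nrm D \<dots> = r * (nrm D (\<phi> x))\<^sup>2"
    using x r by (simp add: D.nrm_scale D.cstar_identity hom_closed D.mult_closed D.star_closed)
  finally have "(nrm D (\<phi> x))\<^sup>2 \<le> (2 * nrm B x)\<^sup>2"
    using pos by (simp add: r_def field_simps power2_eq_square)
  then show ?thesis by (rule power2_le_imp_le) (use pos in simp)
qed

end


section \<open>The universal property in arbitrary types\<close>

text \<open>Transport of structure along an injective map: equational axioms are checked after
  applying \<open>\<kappa>\<close>. It serves both for a copy of a C*-algebra inside the type of
  sequences and, with the identity as \<open>\<kappa>\<close>, for the tensor algebra inside
  \<open>B\<close>.\<close>

lemma complex_normed_algebra_pullback:
  fixes D (structure) and S and \<kappa>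
  assumes "complex_normed_algebra D" and inj: "inj_on \<kappa> (carrier S)"
    and \<kappa>: "\<And>x. x \<in> carrier S \<Longrightarrow> \<kappa> x \<in> carrier D"
    and zero: "\<zero>\<^bsub>S\<^esub> \<in> carrier S" "\<kappa> \<zero>\<^bsub>S\<^esub> = \<zero>"
    and add: "\<And>x y. \<lbrakk>x \<in> carrier S; y \<in> carrier S\<rbrakk> \<Longrightarrow> x \<oplus>\<^bsub>S\<^esub> y \<in> carrier S \<and> \<kappa> (x \<oplus>\<^bsub>S\<^esub> y) = \<kappa> x \<oplus> \<kappa> y"
    and smult: "\<And>a x. x \<in> carrier S \<Longrightarrow> a \<odot>\<^bsub>S\<^esub> x \<in> carrier S \<and> \<kappa> (a \<odot>\<^bsub>S\<^esub> x) = a \<odot> \<kappa> x"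
    and mult: "\<And>x y. \<lbrakk>x \<in> carrier S; y \<in> carrier S\<rbrakk> \<Longrightarrow> x \<otimes>\<^bsub>S\<^esub> y \<in> carrier S \<and> \<kappa> (x \<otimes>\<^bsub>S\<^esub> y) = \<kappa> x \<otimes> \<kappa> y"
    and nrm: "\<And>x. x \<in> carrier S \<Longrightarrow> nrm S x = nrm D (\<kappa> x)"
  shows "complex_normed_algebra S"
proof -
  interpret D: complex_normed_algebra D by fact
  note eqI = inj[THEN inj_onD]
  have "Module.module complex_ring S"
  proof (rule moduleI)
    show "cring complex_ring" by (rule cring_complex_ring)
    show "abelian_group S"
    proof (rule abelian_groupI)
      fix x assume x: "x \<in> carrier S"
      show "\<exists>y\<in>carrier S. y \<oplus>\<^bsub>S\<^esub> x = \<zero>\<^bsub>S\<^esub>"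
      proof (rule bexI)
        have "(-1) \<odot> \<kappa> x \<oplus> \<kappa> x = \<zero>"
          using x by (simp add: \<kappa> D.M.l_neg flip: D.a_inv_eq_smult)
        then show "(-1) \<odot>\<^bsub>S\<^esub> x \<oplus>\<^bsub>S\<^esub> x = \<zero>\<^bsub>S\<^esub>"
          using x by (intro eqI) (auto simp: add smult zero)
      qed (use x smult in auto)
    qed (auto simp: add zero \<kappa> D.M.a_ac intro!: eqI)
  qed (auto simp: complex_ring_def add zero smult \<kappa> D.smult_add_left D.smult_add_right D.smult_assoc
      D.smult_one_left D.smult_in_carrier intro!: eqI)
  then show ?thesis
  proof (rule complex_normed_algebra.intro, unfold_locales)
    fix x assume x: "x \<in> carrier S"
    show "nrm S x = 0 \<longleftrightarrow> x = \<zero>\<^bsub>S\<^esub>"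
      using x inj zero by (auto simp: nrm \<kappa> D.nrm_eq_0 intro: eqI)
  qed (auto simp: add smult mult nrm \<kappa> D.mult_assoc D.mult_closed D.distr_left D.distr_right D.scale_mult_left
      D.scale_mult_right D.nrm_nonneg D.nrm_scale D.nrm_triangle D.nrm_mult D.smult_in_carrier intro!: eqI)
qed

text \<open>Completeness is the axiom that does not transport elementwise: a limit exists in
  \<open>D\<close>, and closedness of the image brings it back to \<open>S\<close>.\<close>

lemma cstar_algebra_pullback:
  fixes D (structure) and S and \<kappa>
  assumes D: "cstar_algebra D" and inj: "inj_on \<kappa> (carrier S)"
    and \<kappa>: "\<And>x. x \<in> carrier S \<Longrightarrow> \<kappa> x \<in> carrier D"
    and zero: "\<zero>\<^bsub>S\<^esub> \<in> carrier S" "\<kappa> \<zero>\<^bsub>S\<^esub> = \<zero>"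
    and add: "\<And>x y. \<lbrakk>x \<in> carrier S; y \<in> carrier S\<rbrakk> \<Longrightarrow> x \<oplus>\<^bsub>S\<^esub> y \<in> carrier S \<and> \<kappa> (x \<oplus>\<^bsub>S\<^esub> y) = \<kappa> x \<oplus> \<kappa> y"
    and smult: "\<And>a x. x \<in> carrier S \<Longrightarrow> a \<odot>\<^bsub>S\<^esub> x \<in> carrier S \<and> \<kappa> (a \<odot>\<^bsub>S\<^esub> x) = a \<odot> \<kappa> x"
    and mult: "\<And>x y. \<lbrakk>x \<in> carrier S; y \<in> carrier S\<rbrakk> \<Longrightarrow> x \<otimes>\<^bsub>S\<^esub> y \<in> carrier S \<and> \<kappa> (x \<otimes>\<^bsub>S\<^esub> y) = \<kappa> x \<otimes> \<kappa> y"
    and nrm: "\<And>x. x \<in> carrier S \<Longrightarrow> nrm S x = nrm D (\<kappa> x)"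
    and star: "\<And>x. x \<in> carrier S \<Longrightarrow> star S x \<in> carrier S \<and> \<kappa> (star S x) = star D (\<kappa> x)"
    and closed: "closedin (norm_topology D) (\<kappa> ` carrier S)"
  shows "cstar_algebra S"
proof -
  interpret D: cstar_algebra D by fact
  interpret S: complex_normed_algebra S
    by (rule complex_normed_algebra_pullback[OF D.complex_normed_algebra_axioms inj \<kappa> zero add smult mult nrm])
  note eqI = inj[THEN inj_onD]
  have minus: "\<kappa> (x \<ominus>\<^bsub>S\<^esub> y) = \<kappa> x \<ominus> \<kappa> y" if "x \<in> carrier S" "y \<in> carrier S" for x y
    using that by (simp add: S.minus_eq_smult D.minus_eq_smult add smult \<kappa>)
  have nrm': "nrm S (x \<ominus>\<^bsub>S\<^esub> y) = nrm D (\<kappa> x \<ominus> \<kappa> y)" if "x \<in> carrier S" "y \<in> carrier S" for x y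
    using that by (simp add: nrm minus S.minus_in_carrier)
  show ?thesis
  proof unfold_locales
    show "S.metric.mcomplete"
    proof (rule S.mcompleteI)
      fix X :: "nat \<Rightarrow> _" assume X: "\<And>k. X k \<in> carrier S"
        and C: "\<And>\<epsilon>. \<epsilon> > 0 \<Longrightarrow> \<exists>N. \<forall>m\<ge>N. \<forall>n\<ge>N. nrm S (X m \<ominus>\<^bsub>S\<^esub> X n) < \<epsilon>"
      obtain l where l: "l \<in> carrier D" "(\<lambda>k. nrm D (\<kappa> (X k) \<ominus> l)) \<longlonglongrightarrow> 0"
        by (rule D.Cauchy_limit[of "\<lambda>k. \<kappa> (X k)"]) (use X \<kappa> C nrm' in auto)
      have "l \<in> \<kappa> ` carrier S"
      proof -
        have "\<exists>y\<in>\<kappa> ` carrier S. nrm D (l \<ominus> y) < \<epsilon>" if "\<epsilon> > 0" for \<epsilon>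
        proof -
          obtain k where "nrm D (\<kappa> (X k) \<ominus> l) < \<epsilon>"
            using order_tendstoD(2)[OF l(2) \<open>\<epsilon> > 0\<close>] by (auto simp: eventually_sequentially)
          then show ?thesis using X \<kappa> l by (intro bexI[of _ "\<kappa> (X k)"]) (auto simp: D.nrm_minus_commute)
        qed
        then show ?thesis using closed l by (simp add: D.closedin_norm_topology)
      qed
      then obtain x where "x \<in> carrier S" "l = \<kappa> x" by auto
      then show "\<exists>l\<in>carrier S. (\<lambda>k. nrm S (X k \<ominus>\<^bsub>S\<^esub> l)) \<longlonglongrightarrow> 0"
        using l X by (intro bexI[of _ x]) (auto simp: nrm')
    qed
  qed (auto simp: add smult mult nrm star \<kappa> D.star_star D.star_add D.star_scale D.star_mult D.star_closed
      D.cstar_identity D.mult_closed D.smult_in_carrier intro!: eqI)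
qed

section \<open>Norm closures of subspaces and subalgebras\<close>

context complex_normed_algebra
begin

definition norm_closure :: "'a set \<Rightarrow> 'a set" where
  "norm_closure V = {x \<in> carrier B. \<forall>\<epsilon>>0. \<exists>y\<in>V. nrm B (x \<ominus> y) < \<epsilon>}"

lemma norm_closureD:
  assumes "x \<in> norm_closure V" "\<epsilon> > 0"
  obtains y where "y \<in> V" "nrm B (x \<ominus> y) < \<epsilon>"
  using assms by (auto simp: norm_closure_def)

lemma norm_closure_carrier: "x \<in> norm_closure V \<Longrightarrow> x \<in> carrier B"
  by (simp add: norm_closure_def)

lemma norm_closure_subset: "V \<subseteq> carrier B \<Longrightarrow> V \<subseteq> norm_closure V"
  by (auto simp: norm_closure_def a_minus_def M.r_neg subset_iff intro!: bexI)

lemma norm_closure_closed: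
  assumes V: "V \<subseteq> carrier B"
  shows "closedin (norm_topology B) (norm_closure V)"
  unfolding closedin_norm_topology
proof (intro conjI ballI impI)
  fix x assume x: "x \<in> carrier B" and ex: "\<forall>\<epsilon>>0. \<exists>y\<in>norm_closure V. nrm B (x \<ominus> y) < \<epsilon>"
  show "x \<in> norm_closure V"
    unfolding norm_closure_def
  proof (intro CollectI conjI allI impI x)
    fix \<epsilon> :: real assume "\<epsilon> > 0"
    then obtain y where y: "y \<in> norm_closure V" "nrm B (x \<ominus> y) < \<epsilon>/2"
      using ex by (meson half_gt_zero)
    then obtain z where z: "z \<in> V" "nrm B (y \<ominus> z) < \<epsilon>/2"
      using \<open>\<epsilon> > 0\<close> by (meson half_gt_zero norm_closureD)
    have "nrm B (x \<ominus> z) \<le> nrm B (x \<ominus> y) + nrm B (y \<ominus> z)"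
      using x y z V norm_closure_carrier by (intro nrm_minus_triangle) auto
    then show "\<exists>y\<in>V. nrm B (x \<ominus> y) < \<epsilon>" using y z by (intro bexI[of _ z]) auto
  qed
qed (auto simp: norm_closure_def)

text \<open>The Lipschitz estimate is centred at the one point \<open>x\<close>, so that scalar
  multiplication, the adjoint and a product with one factor fixed are all instances.\<close>

lemma norm_closure_map:
  assumes V: "V \<subseteq> carrier B" and x: "x \<in> norm_closure V"
    and f: "\<And>y. y \<in> V \<Longrightarrow> f y \<in> V" "f x \<in> carrier B"
    "\<And>y. y \<in> V \<Longrightarrow> nrm B (f x \<ominus> f y) \<le> C * nrm B (x \<ominus> y)"
  shows "f x \<in> norm_closure V"
  unfolding norm_closure_def
proof (intro CollectI conjI allI impI f)
  fix \<epsilon> :: real assume \<epsilon>: "\<epsilon> > 0"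
  \<comment> \<open>\<open>\<bar>C\<bar> + 1\<close> is a positive replacement for \<open>C\<close>,
    which may be zero.\<close>
  then have "\<epsilon> / (\<bar>C\<bar> + 1) > 0" by simp
  then obtain y where y: "y \<in> V" "nrm B (x \<ominus> y) < \<epsilon> / (\<bar>C\<bar> + 1)" using x norm_closureD by blast
  have "nrm B (f x \<ominus> f y) \<le> C * nrm B (x \<ominus> y)" using f y by blast
  also have "\<dots> \<le> (\<bar>C\<bar> + 1) * nrm B (x \<ominus> y)"
    using V x y norm_closure_carrier by (intro mult_right_mono nrm_nonneg minus_in_carrier) auto
  also have "\<dots> < \<epsilon>" using y(2) by (simp add: field_simps)
  finally show "\<exists>y\<in>V. nrm B (f x \<ominus> y) < \<epsilon>" using y f by blast
qed

lemma norm_closure_idem: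
  "V \<subseteq> carrier B \<Longrightarrow> norm_closure (norm_closure V) = norm_closure V"
  using norm_closure_closed[of V] norm_closure_subset[of "norm_closure V"] norm_closure_carrier
  unfolding closedin_norm_topology by (auto simp: norm_closure_def[of "norm_closure V"])

lemma norm_closure_smult:
  assumes V: "V \<subseteq> carrier B" and cl: "\<And>y. y \<in> V \<Longrightarrow> a \<odot> y \<in> V" and x: "x \<in> norm_closure V"
  shows "a \<odot> x \<in> norm_closure V"
  by (rule norm_closure_map[OF V x, where C = "cmod a"])
    (use V x norm_closure_carrier in \<open>auto simp: cl smult_in_carrier subset_iff nrm_scale minus_in_carrier simp flip: smult_minus\<close>)

text \<open>Two passes: first the second argument runs through the closure with the first one in
  \<open>V\<close>, then the first argument does, which lands in the closure of the closure. The
  Lipschitz constant in one argument may depend on the other, as it does for products.\<close>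

lemma norm_closure_binary:
  assumes V: "V \<subseteq> carrier B" and x: "x \<in> norm_closure V" and y: "y \<in> norm_closure V"
    and cl: "\<And>x y. \<lbrakk>x \<in> V; y \<in> V\<rbrakk> \<Longrightarrow> f x y \<in> V" "\<And>x y. \<lbrakk>x \<in> carrier B; y \<in> carrier B\<rbrakk> \<Longrightarrow> f x y \<in> carrier B"
    and l: "\<And>x x' y. \<lbrakk>x \<in> carrier B; x' \<in> carrier B; y \<in> carrier B\<rbrakk>
      \<Longrightarrow> nrm B (f x y \<ominus> f x' y) \<le> C y * nrm B (x \<ominus> x')"
    and r: "\<And>x y y'. \<lbrakk>x \<in> carrier B; y \<in> carrier B; y' \<in> carrier B\<rbrakk>
      \<Longrightarrow> nrm B (f x y \<ominus> f x y') \<le> C' x * nrm B (y \<ominus> y')"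
  shows "f x y \<in> norm_closure V"
proof -
  note V' = subsetD[OF V] and cc = norm_closure_carrier
  have 1: "f x' y \<in> norm_closure V" if "x' \<in> V" for x'
    by (rule norm_closure_map[OF V y, where C = "C' x'"]) (use that V' y cc cl r in auto)
  have sub: "norm_closure V \<subseteq> carrier B" using cc by blast
  have "f x y \<in> norm_closure (norm_closure V)"
    unfolding norm_closure_def[of "norm_closure V"]
  proof (intro CollectI conjI allI impI)
    fix \<epsilon> :: real assume \<epsilon>: "\<epsilon> > 0"
    then have "\<epsilon> / (\<bar>C y\<bar> + 1) > 0" by simp
    then obtain z where z: "z \<in> V" "nrm B (x \<ominus> z) < \<epsilon> / (\<bar>C y\<bar> + 1)" using x norm_closureD by blast
    have "nrm B (f x y \<ominus> f z y) \<le> C y * nrm B (x \<ominus> z)" using l z x y V' cc by blast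
    also have "\<dots> \<le> (\<bar>C y\<bar> + 1) * nrm B (x \<ominus> z)"
      using V' x z cc by (intro mult_right_mono nrm_nonneg minus_in_carrier) auto
    also have "\<dots> < \<epsilon>" using z(2) by (simp add: field_simps)
    finally show "\<exists>y'\<in>norm_closure V. nrm B (f x y \<ominus> y') < \<epsilon>" using 1[OF z(1)] by blast
  qed (use cl x y cc in auto)
  then show ?thesis using norm_closure_idem[OF V] by simp
qed

lemma norm_closure_add:
  assumes V: "V \<subseteq> carrier B" and cl: "\<And>x y. \<lbrakk>x \<in> V; y \<in> V\<rbrakk> \<Longrightarrow> x \<oplus> y \<in> V"
    and x: "x \<in> norm_closure V" and y: "y \<in> norm_closure V"
  shows "x \<oplus> y \<in> norm_closure V"
  by (rule norm_closure_binary[OF V x y, where C = "\<lambda>_. 1" and C' = "\<lambda>_. 1"])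
    (auto simp: cl minus_add_minus minus_self minus_in_carrier)

lemma norm_closure_mult:
  assumes V: "V \<subseteq> carrier B" and cl: "\<And>x y. \<lbrakk>x \<in> V; y \<in> V\<rbrakk> \<Longrightarrow> x \<otimes> y \<in> V"
    and x: "x \<in> norm_closure V" and y: "y \<in> norm_closure V"
  shows "x \<otimes> y \<in> norm_closure V"
proof (rule norm_closure_binary[OF V x y, where C = "nrm B" and C' = "nrm B"])
  fix x x' y assume "x \<in> carrier B" "x' \<in> carrier B" "y \<in> carrier B"
  then show "nrm B (x \<otimes> y \<ominus> x' \<otimes> y) \<le> nrm B y * nrm B (x \<ominus> x')"
    using nrm_mult[of "x \<ominus> x'" y] by (simp add: mult_minus_left minus_in_carrier mult.commute)
next
  fix x y y' assume "x \<in> carrier B" "y \<in> carrier B" "y' \<in> carrier B"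
  then show "nrm B (x \<otimes> y \<ominus> x \<otimes> y') \<le> nrm B x * nrm B (y \<ominus> y')"
    using nrm_mult[of x "y \<ominus> y'"] by (simp add: mult_minus_right minus_in_carrier)
qed (auto simp: cl mult_closed)

lemma closed_subalgebraI:
  assumes sub: "V \<subseteq> carrier B" and "v \<in> V"
    and add: "\<And>x y. \<lbrakk>x \<in> V; y \<in> V\<rbrakk> \<Longrightarrow> x \<oplus> y \<in> V" and smult: "\<And>a x. x \<in> V \<Longrightarrow> a \<odot> x \<in> V"
    and mult: "\<And>x y. \<lbrakk>x \<in> V; y \<in> V\<rbrakk> \<Longrightarrow> x \<otimes> y \<in> V"
    and closed: "closedin (norm_topology B) V"
  shows "closed_subalgebra B V"
  unfolding closed_subalgebra_def
proof (intro conjI ballI)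
  show "submodule V complex_ring B"
  proof (rule submoduleI)
    show "\<zero> \<in> V" using smult[OF \<open>v \<in> V\<close>, of 0] sub \<open>v \<in> V\<close> by (simp add: smult_zero_left subset_iff)
    show "\<ominus> x \<in> V" if "x \<in> V" for x
      using smult[OF that, of "-1"] sub that by (simp add: a_inv_eq_smult subset_iff)
  qed (use sub add smult in auto)
qed (use mult closed in auto)

lemma closed_subalgebra_norm_closure:
  assumes V: "V \<subseteq> carrier B" and v: "v \<in> V"
    and add: "\<And>x y. \<lbrakk>x \<in> V; y \<in> V\<rbrakk> \<Longrightarrow> x \<oplus> y \<in> V" and smult: "\<And>a x. x \<in> V \<Longrightarrow> a \<odot> x \<in> V"
    and mult: "\<And>x y. \<lbrakk>x \<in> V; y \<in> V\<rbrakk> \<Longrightarrow> x \<otimes> y \<in> V"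
  shows "closed_subalgebra B (norm_closure V)"
  by (rule closed_subalgebraI[where v = v])
    (use V v norm_closure_subset[OF V] norm_closure_carrier in
      \<open>auto intro: norm_closure_add[OF V add] norm_closure_smult[OF V smult] norm_closure_mult[OF V mult]
        norm_closure_closed[OF V]\<close>)

end

lemma (in cstar_algebra) norm_closure_star:
  assumes V: "V \<subseteq> carrier B" and cl: "\<And>y. y \<in> V \<Longrightarrow> star B y \<in> V" and x: "x \<in> norm_closure V"
  shows "star B x \<in> norm_closure V"
  by (rule norm_closure_map[OF V x, where C = 1])
    (use V x norm_closure_carrier in \<open>auto simp: cl star_closed subset_iff minus_in_carrier nrm_star simp flip: star_minus\<close>)

section \<open>Values of *-polynomials and transport of representations\<close>

primrec star_polynomial_eval ::
  "('d, 'm) cstar_alg_scheme \<Rightarrow> ('a \<Rightarrow> 'd) \<Rightarrow> ('x \<Rightarrow> 'd) \<Rightarrow> ('a, 'x) star_polynomial \<Rightarrow> 'd" where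
  "star_polynomial_eval D \<pi> t (Coeff a) = \<pi> a"
| "star_polynomial_eval D \<pi> t (Vec x) = t x"
| "star_polynomial_eval D \<pi> t (Scale z p) = z \<odot>\<^bsub>D\<^esub> star_polynomial_eval D \<pi> t p"
| "star_polynomial_eval D \<pi> t (Plus p q) = star_polynomial_eval D \<pi> t p \<oplus>\<^bsub>D\<^esub> star_polynomial_eval D \<pi> t q"
| "star_polynomial_eval D \<pi> t (Times p q) = star_polynomial_eval D \<pi> t p \<otimes>\<^bsub>D\<^esub> star_polynomial_eval D \<pi> t q"
| "star_polynomial_eval D \<pi> t (Adj p) = star D (star_polynomial_eval D \<pi> t p)"

text \<open>The letters of a polynomial range over whole types, but a representation says nothing
  about elements outside the carriers.\<close>

primrec star_polynomial_over :: "'a set \<Rightarrow> 'x set \<Rightarrow> ('a, 'x) star_polynomial \<Rightarrow> bool" where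
  "star_polynomial_over P Q (Coeff a) \<longleftrightarrow> a \<in> P"
| "star_polynomial_over P Q (Vec x) \<longleftrightarrow> x \<in> Q"
| "star_polynomial_over P Q (Scale z p) \<longleftrightarrow> star_polynomial_over P Q p"
| "star_polynomial_over P Q (Plus p q) \<longleftrightarrow> star_polynomial_over P Q p \<and> star_polynomial_over P Q q"
| "star_polynomial_over P Q (Times p q) \<longleftrightarrow> star_polynomial_over P Q p \<and> star_polynomial_over P Q q"
| "star_polynomial_over P Q (Adj p) \<longleftrightarrow> star_polynomial_over P Q p"

context toeplitz_representation
begin

lemma \<pi>_closed: "a \<in> carrier A \<Longrightarrow> \<pi> a \<in> carrier B"
  and \<pi>_add: "\<lbrakk>a \<in> carrier A; b \<in> carrier A\<rbrakk> \<Longrightarrow> \<pi> (a \<oplus>\<^bsub>A\<^esub> b) = \<pi> a \<oplus>\<^bsub>B\<^esub> \<pi> b"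
  and \<pi>_smult: "a \<in> carrier A \<Longrightarrow> \<pi> (z \<odot>\<^bsub>A\<^esub> a) = z \<odot>\<^bsub>B\<^esub> \<pi> a"
  and \<pi>_mult: "\<lbrakk>a \<in> carrier A; b \<in> carrier A\<rbrakk> \<Longrightarrow> \<pi> (a \<otimes>\<^bsub>A\<^esub> b) = \<pi> a \<otimes>\<^bsub>B\<^esub> \<pi> b"
  and \<pi>_star: "a \<in> carrier A \<Longrightarrow> \<pi> (star A a) = star B (\<pi> a)"
  using rep_hom by (auto simp: star_hom_def linear_map_def)

lemma t_closed: "x \<in> carrier X \<Longrightarrow> t x \<in> carrier B"
  and t_add: "\<lbrakk>x \<in> carrier X; y \<in> carrier X\<rbrakk> \<Longrightarrow> t (x \<oplus>\<^bsub>X\<^esub> y) = t x \<oplus>\<^bsub>B\<^esub> t y"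
  and t_smult: "x \<in> carrier X \<Longrightarrow> t (z \<odot>\<^bsub>X\<^esub> x) = z \<odot>\<^bsub>B\<^esub> t x"
  using rep_linear by (auto simp: linear_map_def)

text \<open>The relations of a representation involve only elements of \<open>G\<close>. This
  matters for the map that chooses a sequence of polynomials, which makes sense only on the closure
  of their values.\<close>

lemma transported_representation:
  fixes S :: "('s, 'l) cstar_alg_scheme" and q :: "'c \<Rightarrow> 's" and G :: "'c set"
  assumes S: "cstar_algebra S"
    and gen: "\<pi> ` carrier A \<subseteq> G" "t ` carrier X \<subseteq> G"
    and q: "\<And>x. x \<in> G \<Longrightarrow> q x \<in> carrier S"
      "\<And>x y. \<lbrakk>x \<in> G; y \<in> G\<rbrakk> \<Longrightarrow> q (x \<oplus>\<^bsub>B\<^esub> y) = q x \<oplus>\<^bsub>S\<^esub> q y"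
      "\<And>a x. x \<in> G \<Longrightarrow> q (a \<odot>\<^bsub>B\<^esub> x) = a \<odot>\<^bsub>S\<^esub> q x"
      "\<And>x y. \<lbrakk>x \<in> G; y \<in> G\<rbrakk> \<Longrightarrow> q (x \<otimes>\<^bsub>B\<^esub> y) = q x \<otimes>\<^bsub>S\<^esub> q y"
      "\<And>x. x \<in> G \<Longrightarrow> q (star B x) = star S (q x)"
    and G: "\<And>x. x \<in> G \<Longrightarrow> star B x \<in> G"
  shows "toeplitz_representation A X S (q \<circ> \<pi>) (q \<circ> t)"
proof -
  interpret S: cstar_algebra S by fact
  have g: "a \<in> carrier A \<Longrightarrow> \<pi> a \<in> G" "x \<in> carrier X \<Longrightarrow> t x \<in> G" for a x using gen by auto
  show ?thesis
  proof unfold_locales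
    show "star_hom A S (q \<circ> \<pi>)"
      by (auto simp: star_hom_def linear_map_def g q \<pi>_add \<pi>_smult \<pi>_mult \<pi>_star)
    show "linear_map X S (q \<circ> t)"
      by (auto simp: linear_map_def g q t_add t_smult)
  qed (auto simp: g q G rep_lact rep_ip simp flip: q(4,5))
qed

end

text \<open>
  The universal property extends to targets of arbitrary type: the closure of the values of
  *-polynomials embeds into the type of sequences of *-polynomials by choosing, for each element,
  a sequence of *-polynomials whose values converge to it.
\<close>

lemma (in universal_toeplitz_representation) universal_any_type:
  fixes D :: "('d, 'l) cstar_alg_scheme"
  assumes "toeplitz_representation A X D \<pi>' t'"
  obtains \<phi> where "star_hom B D \<phi>" "\<And>a. a \<in> carrier A \<Longrightarrow> \<phi> (\<pi> a) = \<pi>' a"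
    "\<And>x. x \<in> carrier X \<Longrightarrow> \<phi> (t x) = t' x"
proof -
  interpret T: toeplitz_representation A X D \<pi>' t' by fact
  let ?ev = "star_polynomial_eval D \<pi>' t'" and ?ok = "star_polynomial_over (carrier A) (carrier X)"
  define V where "V = ?ev ` Collect ?ok"
  have V: "V \<subseteq> carrier D"
  proof -
    have "?ok p \<Longrightarrow> ?ev p \<in> carrier D" for p
      by (induction p) (auto simp: T.\<pi>_closed T.t_closed T.B.smult_in_carrier T.B.mult_closed T.B.star_closed)
    then show ?thesis by (auto simp: V_def)
  qed
  have Vgen: "\<pi>' a \<in> V" "t' x \<in> V" if "a \<in> carrier A" "x \<in> carrier X" for a x
    using that by (auto simp: V_def intro: image_eqI[of _ _ "Coeff a"] image_eqI[of _ _ "Vec x"])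
  have Vop: "x \<oplus>\<^bsub>D\<^esub> y \<in> V" "a \<odot>\<^bsub>D\<^esub> x \<in> V" "x \<otimes>\<^bsub>D\<^esub> y \<in> V" "star D x \<in> V"
    if "x \<in> V" "y \<in> V" for a x y
  proof -
    from that obtain p r where "x = ?ev p" "?ok p" "y = ?ev r" "?ok r" unfolding V_def by blast
    then show "x \<oplus>\<^bsub>D\<^esub> y \<in> V" "a \<odot>\<^bsub>D\<^esub> x \<in> V" "x \<otimes>\<^bsub>D\<^esub> y \<in> V" "star D x \<in> V"
      by (auto simp: V_def intro: image_eqI[of _ _ "Plus p r"] image_eqI[of _ _ "Scale a p"]
          image_eqI[of _ _ "Times p r"] image_eqI[of _ _ "Adj p"])
  qed
  define G where "G = T.B.norm_closure V"
  have GD: "x \<in> carrier D" if "x \<in> G" for x using that T.B.norm_closure_carrier by (simp add: G_def)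
  have Gop: "x \<oplus>\<^bsub>D\<^esub> y \<in> G" "a \<odot>\<^bsub>D\<^esub> x \<in> G" "x \<otimes>\<^bsub>D\<^esub> y \<in> G" "star D x \<in> G"
    if "x \<in> G" "y \<in> G" for a x y
    using that Vop unfolding G_def
    by (auto intro!: T.B.norm_closure_add[OF V] T.B.norm_closure_smult[OF V]
        T.B.norm_closure_mult[OF V] T.B.norm_closure_star[OF V])
  have gen: "\<pi>' ` carrier A \<subseteq> G" "t' ` carrier X \<subseteq> G"
    using Vgen T.B.norm_closure_subset[OF V] A.M.zero_closed X.M.zero_closed unfolding G_def by blast+
  have G0: "\<zero>\<^bsub>D\<^esub> \<in> G"
    using Gop(2)[of "\<pi>' \<zero>\<^bsub>A\<^esub>" "\<pi>' \<zero>\<^bsub>A\<^esub>" 0] gen GD A.M.zero_closed by (auto simp: T.B.smult_zero_left image_subset_iff)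
  \<comment> \<open>The explicit rate makes the choice injective: two elements with the same
    sequence are within 2 / (k + 1) of each other for every k.\<close>
  define good where "good x P \<longleftrightarrow> (\<forall>k. ?ok (P k) \<and> nrm D (x \<ominus>\<^bsub>D\<^esub> ?ev (P k)) < 1 / real (Suc k))" for x P
  define q where "q x = (SOME P. good x P)" for x
  have q: "good x (q x)" if "x \<in> G" for x
  proof -
    have "\<exists>p. ?ok p \<and> nrm D (x \<ominus>\<^bsub>D\<^esub> ?ev p) < 1 / real (Suc k)" for k
      using T.B.norm_closureD[of x V "1 / real (Suc k)"] that unfolding G_def V_def by force
    then have "\<exists>P. good x P" unfolding good_def by (intro choice allI)
    then show ?thesis unfolding q_def by (rule someI_ex)
  qed
  have inj: "inj_on q G"
  proof (rule inj_onI)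
    fix x y assume x: "x \<in> G" and y: "y \<in> G" and eq: "q x = q y"
    have le: "nrm D (x \<ominus>\<^bsub>D\<^esub> y) \<le> 2 / real (Suc k)" for k
    proof -
      let ?v = "?ev (q x k)"
      have v: "?v \<in> carrier D" using q[OF x] V unfolding good_def V_def by blast
      have "nrm D (x \<ominus>\<^bsub>D\<^esub> ?v) < 1 / real (Suc k)" "nrm D (y \<ominus>\<^bsub>D\<^esub> ?v) < 1 / real (Suc k)"
        using q[OF x] q[OF y] eq unfolding good_def by metis+
      moreover have "nrm D (x \<ominus>\<^bsub>D\<^esub> y) \<le> nrm D (x \<ominus>\<^bsub>D\<^esub> ?v) + nrm D (?v \<ominus>\<^bsub>D\<^esub> y)"
        by (intro T.B.nrm_minus_triangle GD x y v)
      ultimately show ?thesis using T.B.nrm_minus_commute[OF v GD[OF y]] by simp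
    qed
    have "(\<lambda>k. 2 / real (Suc k)) \<longlonglongrightarrow> 0" by (rule LIMSEQ_Suc) (rule lim_const_over_n)
    then have "nrm D (x \<ominus>\<^bsub>D\<^esub> y) \<le> 0" by (rule LIMSEQ_le_const) (use le in auto)
    then show "x = y"
      using T.B.nrm_nonneg[of "x \<ominus>\<^bsub>D\<^esub> y"] x y GD
      by (metis T.B.minus_eq_zero_iff T.B.minus_in_carrier T.B.nrm_eq_0 antisym)
  qed
  define \<kappa> where "\<kappa> = inv_into G q"
  have \<kappa>q: "\<kappa> (q x) = x" if "x \<in> G" for x using inj that by (simp add: \<kappa>_def)
  define S :: "(nat \<Rightarrow> ('a, 'x) star_polynomial) cstar_alg" where
    "S = \<lparr>carrier = q ` G, mult = (\<lambda>u v. q (\<kappa> u \<otimes>\<^bsub>D\<^esub> \<kappa> v)), one = q \<zero>\<^bsub>D\<^esub>, zero = q \<zero>\<^bsub>D\<^esub>,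
      add = (\<lambda>u v. q (\<kappa> u \<oplus>\<^bsub>D\<^esub> \<kappa> v)), smult = (\<lambda>a u. q (a \<odot>\<^bsub>D\<^esub> \<kappa> u)), nrm = (\<lambda>u. nrm D (\<kappa> u)),
      star = (\<lambda>u. q (star D (\<kappa> u)))\<rparr>"
  have S: "cstar_algebra S"
  proof (rule cstar_algebra_pullback[OF T.B.cstar_algebra_axioms, where \<kappa> = \<kappa>])
    show "inj_on \<kappa> (carrier S)" by (auto simp: S_def \<kappa>q intro!: inj_onI)
    have "\<kappa> ` carrier S = G" by (auto simp: S_def \<kappa>q image_image)
    then show "closedin (norm_topology D) (\<kappa> ` carrier S)"
      using T.B.norm_closure_closed[OF V] by (simp add: G_def)
  qed (auto simp: S_def \<kappa>q Gop GD G0)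
  have rep: "toeplitz_representation A X S (q \<circ> \<pi>') (q \<circ> t')"
    by (rule T.transported_representation[OF S gen]) (auto simp: S_def \<kappa>q Gop)
  obtain \<psi> where \<psi>: "star_hom B S \<psi>" "\<And>a. a \<in> carrier A \<Longrightarrow> \<psi> (\<pi> a) = (q \<circ> \<pi>') a"
    "\<And>x. x \<in> carrier X \<Longrightarrow> \<psi> (t x) = (q \<circ> t') x"
    using universal[OF rep] by blast
  show ?thesis
  proof (rule that[of "\<kappa> \<circ> \<psi>"])
    have \<psi>G: "\<psi> x \<in> q ` G" if "x \<in> carrier B" for x
      using \<psi>(1) that by (auto simp: star_hom_def linear_map_def S_def)
    then have \<kappa>G: "\<kappa> (\<psi> x) \<in> G" if "x \<in> carrier B" for x
      using that \<kappa>q by fastforce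
    show "star_hom B D (\<kappa> \<circ> \<psi>)"
      using \<psi>(1) unfolding star_hom_def linear_map_def
      by (auto simp: S_def \<kappa>q Gop \<kappa>G GD)
  qed (use gen in \<open>auto simp: \<psi> \<kappa>q image_subset_iff\<close>)
qed


section \<open>Approximately local derivations of skew power series algebras\<close>

lemma separating_function:
  fixes S T :: "'a::t2_space set"
  assumes cpt: "compact (UNIV :: 'a set)" and "finite S" "finite T" "S \<inter> T = {}"
  obtains g :: "'a \<Rightarrow> complex" where "continuous_on UNIV g"
    "\<And>v. v \<in> S \<Longrightarrow> g v = 0" "\<And>v. v \<in> T \<Longrightarrow> g v = 1"
proof -
  have "Hausdorff_space (euclidean :: 'a topology)"
    unfolding Hausdorff_space_def using hausdorff by (simp add: disjnt_def) blast
  then have "normal_space (euclidean :: 'a topology)"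
    using cpt by (intro compact_Hausdorff_or_regular_imp_normal_space) (auto simp: compact_space_def)
  moreover have "closedin euclidean S" "closedin euclidean T" "disjnt S T"
    using assms by (auto simp: finite_imp_closed disjnt_def)
  ultimately obtain f where f: "continuous_map euclidean (top_of_set {0..1::real}) f"
    "f ` S \<subseteq> {0}" "f ` T \<subseteq> {1}"
    using Urysohn_lemma[of euclidean S T 0 1] by auto
  have "continuous_on UNIV f" using f(1) by (auto simp: continuous_map_in_subtopology)
  then show ?thesis
    by (intro that[of "\<lambda>v. of_real (f v)"]) (use f in \<open>auto intro!: continuous_intros\<close>)
qed

lemma interior_Un_empty:
  "\<lbrakk>finite I; \<And>i. i \<in> I \<Longrightarrow> closed (S i) \<and> interior (S i) = {}\<rbrakk> \<Longrightarrow> interior (\<Union>i\<in>I. S i) = {}"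
proof (induction I rule: finite_induct)
  case (insert i I)
  have "interior (S i \<union> (\<Union>i\<in>I. S i)) = interior (S i)"
    by (rule interior_closed_Un_empty_interior) (use insert in auto)
  then show ?case using insert by simp
qed simp

lemma continuous_funpow: "continuous_on UNIV \<sigma> \<Longrightarrow> continuous_on UNIV (\<sigma> ^^ n)"
  for \<sigma> :: "'a::topological_space \<Rightarrow> 'a"
  by (induction n) (auto simp: o_def intro: continuous_on_compose2)

lemma closed_eq_funpow:
  fixes \<sigma> :: "'a::t2_space \<Rightarrow> 'a"
  assumes "continuous_on UNIV \<sigma>"
  shows "closed {v. (\<sigma> ^^ m) v = (\<sigma> ^^ n) v}"
  by (intro closed_Collect_eq continuous_funpow assms)

text \<open>Only finitely many pairs of exponents up to \<open>N\<close> occur, so finite unions of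
  closed sets with empty interior suffice and no Baire category argument enters.\<close>

lemma interior_nongeneric:
  fixes \<sigma> :: "'a::t2_space \<Rightarrow> 'a"
  assumes "continuous_on UNIV \<sigma>" "topologically_free \<sigma>"
  shows "interior {v. \<not> inj_on (\<lambda>i. (\<sigma> ^^ i) v) {..N::nat}} = {}"
proof -
  have "{v. \<not> inj_on (\<lambda>i. (\<sigma> ^^ i) v) {..N}}
      = (\<Union>(m,n)\<in>{(m,n). m \<le> N \<and> n \<le> N \<and> m \<noteq> n}. {v. (\<sigma> ^^ m) v = (\<sigma> ^^ n) v})"
    by (auto simp: inj_on_def)
  moreover have "finite {(m,n). m \<le> N \<and> n \<le> N \<and> m \<noteq> n}"
    by (rule finite_subset[of _ "{..N} \<times> {..N}"]) auto
  ultimately show ?thesis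
    using assms by (auto simp: topologically_free_def closed_eq_funpow split: prod.splits intro!: interior_Un_empty)
qed

section \<open>Bounded functionals\<close>

context complex_normed_algebra
begin

text \<open>Membership in the ideals below is a finite list of conditions of the form l x = 0. Their
  kernels are closed, so such conditions pass to limits and from monomials to the whole
  algebra.\<close>

definition functional :: "('a \<Rightarrow> complex) \<Rightarrow> bool" where
  "functional l \<longleftrightarrow> (\<forall>x\<in>carrier B. \<forall>y\<in>carrier B. l (x \<oplus> y) = l x + l y)
     \<and> (\<forall>x\<in>carrier B. \<forall>a. l (a \<odot> x) = a * l x) \<and> (\<exists>C. \<forall>x\<in>carrier B. cmod (l x) \<le> C * nrm B x)"

lemma functionalI:
  assumes "\<And>x y. \<lbrakk>x \<in> carrier B; y \<in> carrier B\<rbrakk> \<Longrightarrow> l (x \<oplus> y) = l x + l y"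
    "\<And>x a. x \<in> carrier B \<Longrightarrow> l (a \<odot> x) = a * l x" "\<And>x. x \<in> carrier B \<Longrightarrow> cmod (l x) \<le> C * nrm B x"
  shows "functional l"
  unfolding functional_def using assms by blast

lemma functional_add: "\<lbrakk>functional l; x \<in> carrier B; y \<in> carrier B\<rbrakk> \<Longrightarrow> l (x \<oplus> y) = l x + l y"
  and functional_smult: "\<lbrakk>functional l; x \<in> carrier B\<rbrakk> \<Longrightarrow> l (a \<odot> x) = a * l x"
  by (auto simp: functional_def)

lemma functional_minus: "\<lbrakk>functional l; x \<in> carrier B; y \<in> carrier B\<rbrakk> \<Longrightarrow> l (x \<ominus> y) = l x - l y"
  by (simp add: minus_eq_smult functional_add functional_smult smult_in_carrier)

lemma functional_closed:
  assumes "functional l"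
  shows "closedin (norm_topology B) {x \<in> carrier B. l x = 0}"
proof -
  obtain C where C: "\<And>x. x \<in> carrier B \<Longrightarrow> cmod (l x) \<le> C * nrm B x"
    using assms unfolding functional_def by blast
  define C' where "C' = \<bar>C\<bar> + 1"
  have C': "C' > 0" "\<And>x. x \<in> carrier B \<Longrightarrow> cmod (l x) \<le> C' * nrm B x"
    unfolding C'_def using C nrm_nonneg by (auto simp: algebra_simps) (smt (verit) mult_right_mono)
  have "l x = 0" if x: "x \<in> carrier B" and ex: "\<And>\<epsilon>. \<epsilon> > 0 \<Longrightarrow> \<exists>y\<in>{x \<in> carrier B. l x = 0}. nrm B (x \<ominus> y) < \<epsilon>" for x
  proof (rule ccontr)
    assume "l x \<noteq> 0"
    then have "cmod (l x) / C' > 0" using C' by simp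
    from ex[OF this] obtain y where y: "y \<in> carrier B" "l y = 0" "nrm B (x \<ominus> y) < cmod (l x) / C'" by auto
    have "cmod (l x) = cmod (l (x \<ominus> y))" using x y assms by (simp add: functional_minus)
    also have "\<dots> \<le> C' * nrm B (x \<ominus> y)" using x y by (intro C' minus_in_carrier)
    also have "\<dots> < C' * (cmod (l x) / C')" using y C' by (intro mult_strict_left_mono) auto
    finally show False using C' by simp
  qed
  then show ?thesis unfolding closedin_norm_topology by blast
qed

lemma functional_comp:
  assumes l: "functional l" and T: "bounded_linear_map B B T"
  shows "functional (\<lambda>x. l (T x))"
proof -
  obtain C where C: "\<And>x. x \<in> carrier B \<Longrightarrow> cmod (l x) \<le> C * nrm B x"
    using l unfolding functional_def by blast
  obtain D where D: "\<And>x. x \<in> carrier B \<Longrightarrow> nrm B (T x) \<le> D * nrm B x"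
    using T unfolding bounded_linear_map_def by blast
  have T': "T x \<in> carrier B" if "x \<in> carrier B" for x
    using T that by (auto simp: bounded_linear_map_def linear_map_def)
  have "cmod (l (T x)) \<le> (\<bar>C\<bar> * D) * nrm B x" if "x \<in> carrier B" for x
  proof -
    have "cmod (l (T x)) \<le> C * nrm B (T x)" using C T' that by blast
    also have "\<dots> \<le> \<bar>C\<bar> * nrm B (T x)" using T' that nrm_nonneg by (intro mult_right_mono) auto
    also have "\<dots> \<le> \<bar>C\<bar> * (D * nrm B x)" using D that by (intro mult_left_mono) auto
    finally show ?thesis by (simp add: mult.assoc)
  qed
  then show ?thesis
    using l T T' by (intro functionalI[where C = "\<bar>C\<bar> * D"])
      (auto simp: bounded_linear_map_def linear_map_def functional_add functional_smult)
qed

lemma functional_mult_left: "\<lbrakk>functional l; y \<in> carrier B\<rbrakk> \<Longrightarrow> functional (\<lambda>x. l (y \<otimes> x))"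
  by (rule functional_comp)
    (auto simp: bounded_linear_map_def linear_map_def distr_right scale_mult_right mult_closed
      intro!: exI[of _ "nrm B y"] nrm_mult)

lemma functional_mult_right: "\<lbrakk>functional l; y \<in> carrier B\<rbrakk> \<Longrightarrow> functional (\<lambda>x. l (x \<otimes> y))"
  by (rule functional_comp)
    (auto simp: bounded_linear_map_def linear_map_def distr_left scale_mult_left mult_closed
      intro!: exI[of _ "nrm B y"] nrm_mult[THEN order_trans])

lemma functional_combine:
  assumes "functional k" "functional l"
  shows "functional (\<lambda>x. a * k x + l x)"
proof -
  obtain C D where C: "\<And>x. x \<in> carrier B \<Longrightarrow> cmod (k x) \<le> C * nrm B x"
    and D: "\<And>x. x \<in> carrier B \<Longrightarrow> cmod (l x) \<le> D * nrm B x"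
    using assms unfolding functional_def by blast
  have "cmod (a * k x + l x) \<le> (cmod a * C + D) * nrm B x" if "x \<in> carrier B" for x
    using mult_left_mono[OF C[OF that], of "cmod a"] D[OF that] norm_triangle_ineq[of "a * k x" "l x"]
    by (simp add: algebra_simps norm_mult)
  then show ?thesis using assms
    by (intro functionalI[where C = "cmod a * C + D"])
      (auto simp: functional_add functional_smult algebra_simps)
qed

lemma functional_sum:
  assumes "finite S" "\<And>i. i \<in> S \<Longrightarrow> functional (l i)"
  shows "functional (\<lambda>x. \<Sum>i\<in>S. a i * l i x)"
  using assms
proof (induction S rule: finite_induct)
  case empty
  show ?case by (rule functionalI[where C = 0]) auto
qed (simp add: functional_combine)

lemma functional_diff: "\<lbrakk>functional k; functional l\<rbrakk> \<Longrightarrow> functional (\<lambda>x. k x - l x)"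
  using functional_combine[of l k "-1"] by simp

end

text \<open>
  An algebra of formal series \<open>\<Sum>n. f n s\<^sup>n\<close> with coefficient functions \<open>f n\<close> and \<open>s g = (g \<circ> \<sigma>) s\<close>:
  \<open>M f n\<close> is the monomial \<open>f s\<^sup>n\<close>, and \<open>c n x e\<close> is the value at \<open>e\<close> of the \<open>n\<close>-th coefficient of \<open>x\<close>.
\<close>

locale skew_series_algebra = complex_normed_algebra A for A :: "('b, 'k) normed_alg_scheme" (structure) +
  fixes \<sigma> :: "'a::t2_space \<Rightarrow> 'a" and M :: "('a \<Rightarrow> complex) \<Rightarrow> nat \<Rightarrow> 'b"
    and c :: "nat \<Rightarrow> 'b \<Rightarrow> 'a \<Rightarrow> complex" and K :: real
  assumes cpt: "compact (UNIV :: 'a set)" and cont: "continuous_on UNIV \<sigma>"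
    and M_closed: "continuous_on UNIV f \<Longrightarrow> M f n \<in> carrier A"
    and M_add: "\<lbrakk>continuous_on UNIV f; continuous_on UNIV g\<rbrakk> \<Longrightarrow> M (\<lambda>v. f v + g v) n = M f n \<oplus> M g n"
    and M_smult: "continuous_on UNIV f \<Longrightarrow> M (\<lambda>v. a * f v) n = a \<odot> M f n"
    and M_mult: "\<lbrakk>continuous_on UNIV f; continuous_on UNIV g\<rbrakk>
      \<Longrightarrow> M f m \<otimes> M g n = M (\<lambda>v. f v * g ((\<sigma> ^^ m) v)) (m + n)"
    and M_one: "x \<in> carrier A \<Longrightarrow> M (\<lambda>v. 1) 0 \<otimes> x = x" "x \<in> carrier A \<Longrightarrow> x \<otimes> M (\<lambda>v. 1) 0 = x"
    and c_add: "\<lbrakk>x \<in> carrier A; y \<in> carrier A\<rbrakk> \<Longrightarrow> c n (x \<oplus> y) e = c n x e + c n y e"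
    and c_smult: "x \<in> carrier A \<Longrightarrow> c n (a \<odot> x) e = a * c n x e"
    and c_bound: "x \<in> carrier A \<Longrightarrow> cmod (c n x e) \<le> K * nrm A x"
    and c_mult: "\<lbrakk>x \<in> carrier A; y \<in> carrier A\<rbrakk>
      \<Longrightarrow> c n (x \<otimes> y) e = (\<Sum>m\<le>n. c m x e * c (n - m) y ((\<sigma> ^^ m) e))"
    and c_M: "continuous_on UNIV f \<Longrightarrow> c m (M f n) e = (if m = n then f e else 0)"
    and c_cont: "x \<in> carrier A \<Longrightarrow> continuous_on UNIV (c n x)"
    and dense: "\<lbrakk>\<And>f n. continuous_on UNIV f \<Longrightarrow> M f n \<in> T; \<And>x y. \<lbrakk>x \<in> T; y \<in> T\<rbrakk> \<Longrightarrow> x \<oplus> y \<in> T;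
      closedin (norm_topology A) T\<rbrakk> \<Longrightarrow> T = carrier A"
    and c_faithful: "\<lbrakk>x \<in> carrier A; \<And>n e. c n x e = 0\<rbrakk> \<Longrightarrow> x = \<zero>"
begin

lemma functional_c: "functional (\<lambda>x. c n x e)"
  by (rule functionalI[where C = K]) (auto simp: c_add c_smult c_bound)

lemma functional_M_sum:
  assumes "functional l" "finite S" "\<And>i. i \<in> S \<Longrightarrow> continuous_on UNIV (h i)"
  shows "l (M (\<lambda>v. \<Sum>i\<in>S. a i * h i v) m) = (\<Sum>i\<in>S. a i * l (M (h i) m))"
  using assms(2,3)
proof (induction S rule: finite_induct)
  case empty
  have "M (\<lambda>v. 0 * 1) m = 0 \<odot> M (\<lambda>v. 1) m" by (rule M_smult) auto
  then show ?case using functional_smult[OF assms(1), of "M (\<lambda>v. 1) m" 0] by (simp add: M_closed)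
next
  case (insert i S)
  then show ?case
    by (simp add: M_add M_smult functional_add[OF assms(1)] functional_smult[OF assms(1)]
        M_closed smult_in_carrier continuous_on_sum continuous_on_mult)
qed

lemma derivation_bounded_linear: "derivation A D \<Longrightarrow> bounded_linear_map A A D"
  and derivation_closed: "\<lbrakk>derivation A D; x \<in> carrier A\<rbrakk> \<Longrightarrow> D x \<in> carrier A"
  and derivation_add: "\<lbrakk>derivation A D; x \<in> carrier A; y \<in> carrier A\<rbrakk> \<Longrightarrow> D (x \<oplus> y) = D x \<oplus> D y"
  and derivation_mult: "\<lbrakk>derivation A D; x \<in> carrier A; y \<in> carrier A\<rbrakk>
    \<Longrightarrow> D (x \<otimes> y) = D x \<otimes> y \<oplus> x \<otimes> D y"
  unfolding derivation_def bounded_linear_map_def linear_map_def by blast+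

abbreviation orb :: "'a \<Rightarrow> nat \<Rightarrow> 'a" where "orb e i \<equiv> (\<sigma> ^^ i) e"

text \<open>
  The quotient by this ideal is the algebra of upper triangular matrices of size \<open>n + 1\<close> when the
  points \<open>e, \<sigma> e, \<dots>\<close> are distinct: \<open>x\<close> goes to the matrix with entries \<open>c (j - i) x (orb e i)\<close>.
\<close>

definition orbit_ideal :: "'a \<Rightarrow> nat \<Rightarrow> 'b set" where
  "orbit_ideal e n = {x \<in> carrier A. \<forall>m i. m + i \<le> n \<longrightarrow> c m x (orb e i) = 0}"

lemma orbit_ideal_iff: "x \<in> carrier A \<Longrightarrow> x \<in> orbit_ideal e n \<longleftrightarrow> (\<forall>m i. m + i \<le> n \<longrightarrow> c m x (orb e i) = 0)"
  by (simp add: orbit_ideal_def)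

lemma orbit_ideal_carrier: "x \<in> orbit_ideal e n \<Longrightarrow> x \<in> carrier A"
  by (simp add: orbit_ideal_def)

text \<open>The k-th summand of the product formula is the entry (i, i + k) of the first matrix
  times the entry (i + k, i + m) of the second. Both positions stay inside the square of size n + 1,
  so one of the two factors vanishes.\<close>

lemma orbit_ideal_mult:
  assumes "x \<in> carrier A" "y \<in> carrier A" "x \<in> orbit_ideal e n \<or> y \<in> orbit_ideal e n"
  shows "x \<otimes> y \<in> orbit_ideal e n"
proof -
  have "c k x (orb e i) * c (m - k) y (orb (orb e i) k) = 0" if "m + i \<le> n" "k \<le> m" for m i k
  proof -
    have "orb (orb e i) k = orb e (k + i)" by (simp add: funpow_add)
    moreover have "k + i \<le> n" "(m - k) + (k + i) \<le> n" using that by auto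
    ultimately show ?thesis using assms(3) by (auto simp: orbit_ideal_def)
  qed
  then show ?thesis using assms(1,2)
    by (auto simp only: orbit_ideal_iff mult_closed c_mult atMost_iff intro!: sum.neutral)
qed

lemma orbit_ideal_add: "\<lbrakk>x \<in> orbit_ideal e n; y \<in> orbit_ideal e n\<rbrakk> \<Longrightarrow> x \<oplus> y \<in> orbit_ideal e n"
  by (simp add: orbit_ideal_def c_add)

lemma M_in_orbit_ideal:
  "continuous_on UNIV f \<Longrightarrow> M f m \<in> orbit_ideal e n \<longleftrightarrow> (\<forall>i. m + i \<le> n \<longrightarrow> f (orb e i) = 0)"
  by (auto simp: orbit_ideal_iff M_closed c_M)

end

text \<open>The first n + 1 points carry the matrices. The further n + 1 points are the reach of the
  monomials used below: degree at most n + 1 from a point of index at most n ends at index at most 2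
  n + 1.\<close>

locale generic_orbit = skew_series_algebra A \<sigma> M c K
  for A :: "('b, 'k) normed_alg_scheme" (structure) and \<sigma> :: "'a::t2_space \<Rightarrow> 'a" and M c K +
  fixes e :: 'a and n :: nat
  assumes generic: "inj_on (\<lambda>i. (\<sigma> ^^ i) e) {..2 * n + 1}"
begin

abbreviation I where "I \<equiv> orbit_ideal e n"

lemma orb_eq_iff: "\<lbrakk>i \<le> 2 * n + 1; j \<le> 2 * n + 1\<rbrakk> \<Longrightarrow> orb e i = orb e j \<longleftrightarrow> i = j"
  using generic by (auto simp: inj_on_def)

text \<open>Modulo the ideal, \<open>M (h i) m\<close> is the matrix unit in row i and column i + m
  whenever i + m is at most n.\<close>

lemma unit_functions:
  obtains h :: "nat \<Rightarrow> 'a \<Rightarrow> complex" where "\<And>i. i \<le> n \<Longrightarrow> continuous_on UNIV (h i)"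
    "\<And>i k. \<lbrakk>i \<le> n; k \<le> n\<rbrakk> \<Longrightarrow> h i (orb e k) = (if k = i then 1 else 0)"
proof -
  have "\<exists>g :: 'a \<Rightarrow> complex. continuous_on UNIV g \<and> (\<forall>k\<le>n. g (orb e k) = (if k = i then 1 else 0))"
    if i: "i \<le> n" for i
  proof -
    have "finite (orb e ` ({..n} - {i}))" "finite {orb e i}" "orb e ` ({..n} - {i}) \<inter> {orb e i} = {}"
      using i orb_eq_iff by auto
    then obtain g :: "'a \<Rightarrow> complex" where "continuous_on UNIV g"
      "\<And>v. v \<in> orb e ` ({..n} - {i}) \<Longrightarrow> g v = 0" "\<And>v. v \<in> {orb e i} \<Longrightarrow> g v = 1"
      by (rule separating_function[OF cpt]) blast
    then show ?thesis by (intro exI[of _ g]) auto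
  qed
  then have "\<forall>i. \<exists>g :: 'a \<Rightarrow> complex. i \<le> n \<longrightarrow>
      continuous_on UNIV g \<and> (\<forall>k\<le>n. g (orb e k) = (if k = i then 1 else 0))" by blast
  from choice[OF this] show ?thesis using that by blast
qed

text \<open>The right side is \<open>l\<close> applied to the expansion of the matrix of
  \<open>x\<close> in matrix units. Both sides are bounded functionals of \<open>x\<close>, so
  monomials suffice; there, subtracting the interpolating combination of the \<open>h i\<close> from
  the coefficient leaves a monomial in the ideal. In this way control of \<open>l\<close> on the
  monomials in the ideal yields control on the whole ideal.\<close>

lemma functional_expansion:
  assumes l: "functional l" and l0: "\<And>f m. \<lbrakk>continuous_on UNIV f; M f m \<in> I\<rbrakk> \<Longrightarrow> l (M f m) = 0"
    and h: "\<And>i. i \<le> n \<Longrightarrow> continuous_on UNIV (h i)"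
    "\<And>i k. \<lbrakk>i \<le> n; k \<le> n\<rbrakk> \<Longrightarrow> h i (orb e k) = (if k = i then 1 else 0)"
    and x: "x \<in> carrier A"
  shows "l x = (\<Sum>m\<le>n. \<Sum>i\<le>n-m. c m x (orb e i) * l (M (h i) m))"
proof -
  define r where "r x = (\<Sum>m\<le>n. \<Sum>i\<le>n-m. l (M (h i) m) * c m x (orb e i))" for x
  have r: "functional r"
  proof (rule functionalI[where C = "\<Sum>m\<le>n. \<Sum>i\<le>n-m. cmod (l (M (h i) m)) * K"])
    fix x assume x: "x \<in> carrier A"
    have "cmod (r x) \<le> (\<Sum>m\<le>n. \<Sum>i\<le>n-m. cmod (l (M (h i) m)) * (K * nrm A x))"
      unfolding r_def by (intro sum_norm_le) (auto simp: norm_mult intro!: mult_left_mono c_bound x)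
    then show "cmod (r x) \<le> (\<Sum>m\<le>n. \<Sum>i\<le>n-m. cmod (l (M (h i) m)) * K) * nrm A x"
      by (simp add: sum_distrib_right mult.assoc)
  next
    fix x a assume "x \<in> carrier A"
    then show "r (a \<odot> x) = a * r x"
      unfolding r_def sum_distrib_left by (intro sum.cong refl) (simp add: c_smult)
  next
    fix x y assume "x \<in> carrier A" "y \<in> carrier A"
    then show "r (x \<oplus> y) = r x + r y"
      unfolding r_def sum.distrib[symmetric] by (intro sum.cong refl) (simp add: c_add algebra_simps)
  qed
  let ?T = "{x \<in> carrier A. l x - r x = 0}"
  have "?T = carrier A"
  proof (rule dense)
    show "closedin (norm_topology A) ?T" by (intro functional_closed functional_diff l r)
    show "x \<oplus> y \<in> ?T" if "x \<in> ?T" "y \<in> ?T" for x y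
      using that by (simp add: functional_add[OF l] functional_add[OF r])
    fix f :: "'a \<Rightarrow> complex" and m :: nat assume f: "continuous_on UNIV f"
    have "l (M f m) = r (M f m)"
    proof (cases "m \<le> n")
      case True
      define S where "S = {..n-m}"
      have hS: "continuous_on UNIV (h i)" if "i \<in> S" for i using that h by (auto simp: S_def)
      define f1 where "f1 v = (\<Sum>i\<in>S. f (orb e i) * h i v)" for v
      have f1: "continuous_on UNIV f1" unfolding f1_def by (intro continuous_intros hS)
      define f2 where "f2 v = f v + (-1) * f1 v" for v
      have f2: "continuous_on UNIV f2" unfolding f2_def by (intro continuous_intros f f1)
      have "M f2 m \<in> I" unfolding M_in_orbit_ideal[OF f2]
      proof (intro allI impI)
        fix k assume k: "m + k \<le> n"
        have "f1 (orb e k) = (\<Sum>i\<in>S. if k = i then f (orb e i) else 0)"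
          unfolding f1_def using h(2) k by (intro sum.cong) (auto simp: S_def)
        also have "\<dots> = f (orb e k)" using k by (simp add: S_def)
        finally show "f2 (orb e k) = 0" by (simp add: f2_def)
      qed
      then have "l (M f2 m) = 0" using l0 f2 by blast
      then have "l (M f m) = l (M f1 m)"
        unfolding f2_def using f f1
        by (simp only: M_add M_smult continuous_on_mult continuous_on_const functional_add[OF l]
            functional_smult[OF l] M_closed smult_in_carrier) simp
      also have "\<dots> = (\<Sum>i\<in>S. f (orb e i) * l (M (h i) m))"
        unfolding f1_def by (rule functional_M_sum[OF l]) (auto simp: S_def hS h)
      also have "\<dots> = (\<Sum>k\<le>n. if k = m then \<Sum>i\<in>S. f (orb e i) * l (M (h i) m) else 0)"
        using True by simp
      also have "\<dots> = r (M f m)"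
        unfolding r_def by (intro sum.cong refl) (auto simp: c_M f S_def mult.commute)
      finally show ?thesis .
    next
      case False
      then have "M f m \<in> I" using f by (simp add: M_in_orbit_ideal)
      then show ?thesis using False by (simp add: l0 f r_def c_M)
    qed
    then show "M f m \<in> ?T" by (simp add: M_closed f)
  qed
  then show ?thesis using x by (auto simp: r_def mult.commute)
qed

lemma functional_vanishes_orbit_ideal:
  assumes l: "functional l" and l0: "\<And>f m. \<lbrakk>continuous_on UNIV f; M f m \<in> I\<rbrakk> \<Longrightarrow> l (M f m) = 0"
    and x: "x \<in> I"
  shows "l x = 0"
proof -
  obtain h :: "nat \<Rightarrow> 'a \<Rightarrow> complex" where h: "\<And>i. i \<le> n \<Longrightarrow> continuous_on UNIV (h i)"
    "\<And>i k. \<lbrakk>i \<le> n; k \<le> n\<rbrakk> \<Longrightarrow> h i (orb e k) = (if k = i then 1 else 0)"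
    by (rule unit_functions) blast
  have "l x = (\<Sum>m\<le>n. \<Sum>i\<le>n-m. c m x (orb e i) * l (M (h i) m))"
    by (rule functional_expansion[OF l l0 h orbit_ideal_carrier[OF x]])
  also have "\<dots> = 0"
    using x by (intro sum.neutral ballI) (simp add: orbit_ideal_def)
  finally show ?thesis .
qed


text \<open>Leibniz rule: the summand with \<open>D y\<close> is in the ideal because
  \<open>x\<close> is, the other one by either alternative. Factorizations into two ideal elements
  use \<open>y \<in> I\<close>; monomials of high degree use \<open>D x \<in> I\<close>.\<close>

lemma derivation_orbit_ideal_mult:
  assumes D: "derivation A D" and "x \<in> I" "y \<in> carrier A" "D x \<in> I \<or> y \<in> I"
  shows "D (x \<otimes> y) \<in> I"
proof -
  note Dc = derivation_closed[OF D]
  have x: "x \<in> carrier A" using assms orbit_ideal_carrier by blast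
  have "D (x \<otimes> y) = D x \<otimes> y \<oplus> x \<otimes> D y"
    using derivation_mult[OF D x] assms by blast
  moreover have "D x \<otimes> y \<in> I" "x \<otimes> D y \<in> I"
    using assms x Dc by (auto intro: orbit_ideal_mult)
  ultimately show ?thesis by (simp add: orbit_ideal_add)
qed

text \<open>
  Derivations preserve the ideal because its monomials are sums of products of two of its elements:
  one factors the coefficient if it vanishes on the whole orbit, and otherwise multiplies on
  the right by a function that vanishes on the first \<open>n + 1\<close> points of the orbit and is 1 on the
  next ones.
\<close>

lemma derivation_orbit_ideal_monomial:
  assumes D: "derivation A D" and f: "continuous_on UNIV f" and m: "m \<le> n + 1" and fI: "M f m \<in> I"
  shows "D (M f m) \<in> I"
proof -
  note Dadd = derivation_add[OF D]
  have "finite (orb e ` {..n})" "finite (orb e ` {n<..2*n+1})" "orb e ` {..n} \<inter> orb e ` {n<..2*n+1} = {}"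
    using orb_eq_iff by auto
  then obtain g :: "'a \<Rightarrow> complex" where g: "continuous_on UNIV g"
    "\<And>v. v \<in> orb e ` {..n} \<Longrightarrow> g v = 0" "\<And>v. v \<in> orb e ` {n<..2*n+1} \<Longrightarrow> g v = 1"
    by (rule separating_function[OF cpt]) blast
  have g\<sigma>: "continuous_on UNIV (\<lambda>v. g ((\<sigma> ^^ m) v))"
    using continuous_on_compose2[OF g(1) continuous_funpow[OF cont]] by auto
  \<comment> \<open>At \<open>orb e i\<close> with i at most n, either \<open>f\<close> vanishes or
    the m-th iterate leads to a point where \<open>g\<close> is 1, so \<open>F\<close> vanishes at
    the first n + 1 points. The rest of \<open>f\<close> comes from right multiplication by
    \<open>M g 0\<close>, an element of the ideal.\<close>
  define F where "F v = f v * (1 - g ((\<sigma> ^^ m) v) * g ((\<sigma> ^^ m) v))" for v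
  have F: "continuous_on UNIV F" unfolding F_def by (intro continuous_intros f g\<sigma>)
  have F0: "F (orb e i) = 0" if i: "i \<le> n" for i
  proof (cases "m + i \<le> n")
    case True
    then show ?thesis using fI f by (simp add: F_def M_in_orbit_ideal)
  next
    case False
    then have "g (orb e (m + i)) = 1" using i m by (intro g) auto
    then show ?thesis by (simp add: F_def funpow_add)
  qed
  \<comment> \<open>A continuous substitute for a complex square root: z is \<open>r z\<close> times
    the root of its modulus, and both factors vanish only at 0. Division by zero yields 0, which is
    the right value of \<open>r\<close> there.\<close>
  define r where "r z = z / of_real (sqrt (cmod z))" for z :: complex
  have "isCont r z" for z
  proof (cases "z = 0")
    case True
    have "((\<lambda>z. sqrt (cmod z)) \<longlongrightarrow> sqrt (cmod 0)) (at 0)"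
      by (intro tendsto_intros)
    then have "((\<lambda>z. cmod (r z)) \<longlongrightarrow> 0) (at 0)"
      by (simp add: r_def norm_divide real_div_sqrt)
    then have "(r \<longlongrightarrow> 0) (at 0)" by (rule tendsto_norm_zero_cancel)
    then show ?thesis using True by (simp add: isCont_def r_def)
  next
    case False
    then show ?thesis unfolding r_def by (intro continuous_intros) auto
  qed
  then have r: "continuous_on UNIV r" by (simp add: continuous_on_eq_continuous_at)
  define F1 where "F1 v = r (F v)" for v
  define F2 where "F2 v = complex_of_real (sqrt (cmod (F v)))" for v
  have F1: "continuous_on UNIV F1" unfolding F1_def using continuous_on_compose2[OF r F] by auto
  have F2: "continuous_on UNIV F2" unfolding F2_def by (intro continuous_intros F)
  have "F1 v * F2 v = F v" for v by (simp add: F1_def F2_def r_def)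
  then have MF: "M F m = M F1 0 \<otimes> M F2 m" using M_mult[OF F1 F2, of 0 m] by simp
  have "F1 (orb e i) = 0" "F2 (orb e i) = 0" if "i \<le> n" for i
    using F0[OF that] by (auto simp: F1_def F2_def r_def)
  then have "M F1 0 \<in> I" "M F2 m \<in> I" by (auto simp: M_in_orbit_ideal[OF F1] M_in_orbit_ideal[OF F2])
  then have "D (M F m) \<in> I" unfolding MF
    by (intro derivation_orbit_ideal_mult[OF D] orbit_ideal_carrier) auto
  moreover have gI: "M g 0 \<in> I" using g by (auto simp: M_in_orbit_ideal)
  have "D ((M f m \<otimes> M g 0) \<otimes> M g 0) \<in> I"
    by (rule derivation_orbit_ideal_mult[OF D])
      (auto intro!: orbit_ideal_mult simp: gI f g mult_closed M_closed)
  moreover have "M f m = M F m \<oplus> (M f m \<otimes> M g 0) \<otimes> M g 0"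
  proof -
    have "(M f m \<otimes> M g 0) \<otimes> M g 0 = M (\<lambda>v. (f v * g ((\<sigma> ^^ m) v)) * g ((\<sigma> ^^ m) v)) m"
      using M_mult[OF f g(1), of m 0] M_mult[OF continuous_on_mult[OF f g\<sigma>] g(1), of m 0] by simp
    moreover have "M F m \<oplus> \<dots> = M (\<lambda>v. F v + (f v * g ((\<sigma> ^^ m) v)) * g ((\<sigma> ^^ m) v)) m"
      by (rule M_add[symmetric]) (intro F f g\<sigma> continuous_intros)+
    moreover have "(\<lambda>v. F v + (f v * g ((\<sigma> ^^ m) v)) * g ((\<sigma> ^^ m) v)) = f"
      by (auto simp: F_def algebra_simps)
    ultimately show ?thesis by simp
  qed
  ultimately show ?thesis
    by (metis Dadd orbit_ideal_add M_closed f g(1) F mult_closed)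
qed

text \<open>Since \<open>D\<close> is bounded, the entries of the matrix of \<open>D x\<close> are
  bounded functionals of \<open>x\<close>, so it is enough that \<open>D\<close> maps the monomials
  of the ideal into the ideal.\<close>

lemma derivation_orbit_ideal:
  assumes D: "derivation A D" and x: "x \<in> I"
  shows "D x \<in> I"
proof -
  note bl = derivation_bounded_linear[OF D] and Dc = derivation_closed[OF D]
  have mono: "D (M f m) \<in> I" if f: "continuous_on UNIV f" and fI: "M f m \<in> I" for f m
  proof (cases "m \<le> n + 1")
    case False
    \<comment> \<open>Degree n + 1 exceeds the matrix size, so the left factor is in the ideal for
      every \<open>f\<close>, and its image under \<open>D\<close> is already known to be
      there.\<close>
    have eq: "M f m = M f (n + 1) \<otimes> M (\<lambda>v. 1) (m - (n + 1))"
      using M_mult[OF f, of "\<lambda>v. 1" "n + 1" "m - (n + 1)"] False by simp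
    have "M f (n + 1) \<in> I" using f by (simp add: M_in_orbit_ideal)
    then show ?thesis unfolding eq
      by (intro derivation_orbit_ideal_mult[OF D])
        (auto simp: M_closed intro: derivation_orbit_ideal_monomial[OF D f])
  qed (use derivation_orbit_ideal_monomial[OF D f] fI in auto)
  have "c m (D x) (orb e i) = 0" if "m + i \<le> n" for m i
  proof (rule functional_vanishes_orbit_ideal[OF _ _ x])
    show "functional (\<lambda>x. c m (D x) (orb e i))" by (rule functional_comp[OF functional_c bl])
    show "c m (D (M f k)) (orb e i) = 0" if "continuous_on UNIV f" "M f k \<in> I" for f k
      using mono[OF that] \<open>m + i \<le> n\<close> by (auto simp: orbit_ideal_def)
  qed
  then show ?thesis using Dc x orbit_ideal_carrier by (simp add: orbit_ideal_iff)
qed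

definition idempotent_mod :: "'b \<Rightarrow> bool" where
  "idempotent_mod p \<longleftrightarrow> p \<in> carrier A \<and> p \<ominus> p \<otimes> p \<in> I"

text \<open>The diagonal unit in position (i, i), and its sum with the matrix unit in position (i, i
  + m) for m > 0, are idempotent. Their differences give the remaining matrix units, so idempotents
  span modulo the ideal.\<close>

lemma functional_zero_idempotents:
  assumes l: "functional l" and l0: "\<And>x. x \<in> I \<Longrightarrow> l x = 0"
    and idem: "\<And>p. idempotent_mod p \<Longrightarrow> l p = 0"
    and x: "x \<in> carrier A"
  shows "l x = 0"
proof -
  obtain h :: "nat \<Rightarrow> 'a \<Rightarrow> complex" where h: "\<And>i. i \<le> n \<Longrightarrow> continuous_on UNIV (h i)"
    "\<And>i k. \<lbrakk>i \<le> n; k \<le> n\<rbrakk> \<Longrightarrow> h i (orb e k) = (if k = i then 1 else 0)"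
    by (rule unit_functions) blast
  have h\<sigma>: "continuous_on UNIV (\<lambda>v. h i ((\<sigma> ^^ m) v))" if "i \<le> n" for i m
    using continuous_on_compose2[OF h(1)[OF that] continuous_funpow[OF cont]] by auto
  have "l (M (h i) m) = 0" if i: "i \<le> n" for i m
  proof -
    note cl = M_closed mult_closed minus_in_carrier h(1)[OF i] h\<sigma>[OF i] continuous_on_mult
    have p: "M (h i) 0 \<otimes> M (h i) 0 = M (\<lambda>v. h i v * h i v) 0"
      using M_mult[OF h(1)[OF i] h(1)[OF i], of 0 0] by simp
    have "idempotent_mod (M (h i) 0)"
      unfolding idempotent_mod_def p using i
      by (auto simp: cl orbit_ideal_iff functional_minus[OF functional_c] c_M h(2))
    then have l1: "l (M (h i) 0) = 0" by (rule idem)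
    show ?thesis
    proof (cases "m = 0")
      case False
      let ?q = "M (h i) 0 \<oplus> M (h i) m"
      have q: "?q \<otimes> ?q = (M (\<lambda>v. h i v * h i v) 0 \<oplus> M (\<lambda>v. h i v * h i ((\<sigma> ^^ m) v)) m)
        \<oplus> (M (\<lambda>v. h i v * h i v) m \<oplus> M (\<lambda>v. h i v * h i ((\<sigma> ^^ m) v)) (m + m))"
        using M_mult[OF h(1)[OF i] h(1)[OF i], of 0 0] M_mult[OF h(1)[OF i] h(1)[OF i], of 0 m]
          M_mult[OF h(1)[OF i] h(1)[OF i], of m 0] M_mult[OF h(1)[OF i] h(1)[OF i], of m m]
        by (simp add: distr_left distr_right cl)
      \<comment> \<open>Both factors could be nonzero only if k = i and m + k = i, which m > 0
        excludes.\<close>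
      have prod0: "h i (orb e k) * h i (orb e (m + k)) = 0" if "m + k \<le> n" for k
        using that False i by (auto simp: h(2))
      have c0: "c j (?q \<ominus> ?q \<otimes> ?q) (orb e k) = 0" if jk: "j + k \<le> n" for j k
      proof -
        define a b where "a = h i (orb e k)" and "b = h i ((\<sigma> ^^ m) (orb e k))"
        have aa: "a * a = a" using jk i by (auto simp: a_def h(2))
        have ab: "a * b = 0" if "j = m \<or> j = m + m"
          using prod0[of k] that jk by (auto simp: a_def b_def funpow_add)
        have "c j (?q \<ominus> ?q \<otimes> ?q) (orb e k) = (if j = 0 then a else 0) + (if j = m then a else 0)
          - ((if j = 0 then a * a else 0) + (if j = m then a * b else 0)
            + ((if j = m then a * a else 0) + (if j = m + m then a * b else 0)))"
          unfolding q by (simp only: cl functional_minus[OF functional_c] c_add c_M a_def b_def M.add.m_closed)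
        also have "\<dots> = 0"
        proof (cases "j = m \<or> j = m + m")
          case True
          show ?thesis unfolding aa ab[OF True] using False by simp
        next
          case False
          then show ?thesis by (simp add: aa)
        qed
        finally show ?thesis .
      qed
      have "idempotent_mod ?q"
        unfolding idempotent_mod_def using c0 by (simp add: cl orbit_ideal_iff)
      then have "l ?q = 0" by (rule idem)
      then show ?thesis using l1 by (simp add: functional_add[OF l] cl)
    qed (use l1 in simp)
  qed
  then have "(\<Sum>m\<le>n. \<Sum>i\<le>n-m. c m x (orb e i) * l (M (h i) m)) = 0"
    by (intro sum.neutral ballI) simp
  then show ?thesis using functional_expansion[OF l l0 h x] by simp
qed

section \<open>Approximately local derivations modulo the ideal of a generic orbit\<close>

context
  fixes \<delta> assumes \<delta>: "approximately_local_derivation A \<delta>"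
begin

lemma approx_bounded_linear: "bounded_linear_map A A \<delta>"
  using \<delta> by (simp add: approximately_local_derivation_def)

lemma approx_closed: "x \<in> carrier A \<Longrightarrow> \<delta> x \<in> carrier A"
  and approx_add: "\<lbrakk>x \<in> carrier A; y \<in> carrier A\<rbrakk> \<Longrightarrow> \<delta> (x \<oplus> y) = \<delta> x \<oplus> \<delta> y"
  and approx_smult: "x \<in> carrier A \<Longrightarrow> \<delta> (a \<odot> x) = a \<odot> \<delta> x"
  using approx_bounded_linear unfolding bounded_linear_map_def linear_map_def by blast+

lemma approx_minus: "\<lbrakk>x \<in> carrier A; y \<in> carrier A\<rbrakk> \<Longrightarrow> \<delta> (x \<ominus> y) = \<delta> x \<ominus> \<delta> y"
  by (simp add: minus_eq_smult approx_add approx_smult approx_closed smult_in_carrier)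

text \<open>The transfer principle: a bounded linear condition on the value at one fixed
  \<open>x\<close> that all derivations satisfy survives the limit, although the approximating
  derivations depend on \<open>x\<close>.\<close>

lemma approx_functional_zero:
  assumes l: "functional l" and l0: "\<And>D. derivation A D \<Longrightarrow> l (D x) = 0" and x: "x \<in> carrier A"
  shows "l (\<delta> x) = 0"
proof -
  obtain D where D: "\<And>k. derivation A (D k)" "limitin (norm_topology A) (\<lambda>k. D k x) (\<delta> x) sequentially"
    using \<delta> x unfolding approximately_local_derivation_def by blast
  have "D k x \<in> {x \<in> carrier A. l x = 0}" for k
    using derivation_closed[OF D(1) x] l0[OF D(1)] by simp
  then have "\<delta> x \<in> {x \<in> carrier A. l x = 0}"
    by (intro limitin_closedin[OF D(2) functional_closed[OF l]]) auto
  then show ?thesis by simp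
qed

lemma approx_orbit_ideal: "x \<in> I \<Longrightarrow> \<delta> x \<in> I"
proof -
  assume x: "x \<in> I"
  have "c m (\<delta> x) (orb e i) = 0" if "m + i \<le> n" for m i
    using derivation_orbit_ideal[OF _ x] that
    by (intro approx_functional_zero[OF functional_c] orbit_ideal_carrier[OF x])
      (auto simp: orbit_ideal_def)
  then show ?thesis using x orbit_ideal_carrier approx_closed by (simp add: orbit_ideal_iff)
qed

text \<open>For a derivation D, multiplying the Leibniz rule for D(x b) by y expresses x D(b) y
  through D(x b) y and D(x) b y, which both lie in the ideal. The resulting condition is linear in
  D(b) for fixed \<open>b\<close>, so it transfers to \<open>\<delta>\<close>.\<close>

lemma approx_zero_product:
  assumes x: "x \<in> carrier A" and b: "b \<in> carrier A" and y: "y \<in> carrier A"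
    and xb: "x \<otimes> b \<in> I" and bY: "b \<otimes> y \<in> I" and "m + i \<le> n"
  shows "c m ((x \<otimes> \<delta> b) \<otimes> y) (orb e i) = 0"
proof (rule approx_functional_zero[OF _ _ b])
  show "functional (\<lambda>z. c m ((x \<otimes> z) \<otimes> y) (orb e i))"
    by (rule functional_mult_left[OF functional_mult_right[OF functional_c y] x])
  fix D assume D: "derivation A D"
  note Dc = derivation_closed[OF D]
  have "D (x \<otimes> b) = D x \<otimes> b \<oplus> x \<otimes> D b" by (rule derivation_mult[OF D x b])
  then have "D (x \<otimes> b) \<otimes> y = D x \<otimes> (b \<otimes> y) \<oplus> (x \<otimes> D b) \<otimes> y"
    using x b y Dc by (simp add: distr_left mult_closed mult_assoc)
  then have "c m (D (x \<otimes> b) \<otimes> y) (orb e i)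
      = c m (D x \<otimes> (b \<otimes> y)) (orb e i) + c m ((x \<otimes> D b) \<otimes> y) (orb e i)"
    using x b y Dc by (simp add: c_add mult_closed)
  moreover have "D (x \<otimes> b) \<otimes> y \<in> I" "D x \<otimes> (b \<otimes> y) \<in> I"
    by (rule orbit_ideal_mult[OF Dc[OF mult_closed[OF x b]] y disjI1[OF derivation_orbit_ideal[OF D xb]]])
      (rule orbit_ideal_mult[OF Dc[OF x] mult_closed[OF b y] disjI2[OF bY]])
  ultimately show "c m ((x \<otimes> D b) \<otimes> y) (orb e i) = 0"
    using \<open>m + i \<le> n\<close> by (auto simp: orbit_ideal_def)
qed

text \<open>The value at 1 appears when \<delta> is applied to the product of the complements of two
  idempotents. A derivation kills the unit because its Leibniz rule at 1 = 1 1 doubles the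
  value.\<close>

lemma approx_one: "\<delta> (M (\<lambda>v. 1) 0) = \<zero>"
proof (rule c_faithful)
  let ?u = "M (\<lambda>v. 1) 0"
  have u: "?u \<in> carrier A" by (simp add: M_closed)
  then show "\<delta> ?u \<in> carrier A" by (rule approx_closed)
  fix k v
  show "c k (\<delta> ?u) v = 0"
  proof (rule approx_functional_zero[OF functional_c _ u])
    fix D assume D: "derivation A D"
    note Du = derivation_closed[OF D u]
    have "D (?u \<otimes> ?u) = D ?u \<otimes> ?u \<oplus> ?u \<otimes> D ?u" by (rule derivation_mult[OF D u u])
    then have "D ?u = D ?u \<oplus> D ?u" using u Du by (simp add: M_one)
    then have "c k (D ?u) v = c k (D ?u) v + c k (D ?u) v" using Du c_add by metis
    then show "c k (D ?u) v = 0" by simp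
  qed
qed

text \<open>With p' = 1 - p and q' = 1 - q, the zero products give p' \<delta>(p q) q', p
  \<delta>(p' q) q', p' \<delta>(p q') q and p \<delta>(p' q') q, all zero modulo the ideal.
  Expanded, the first minus the second minus the third plus the fourth is exactly \<delta>(p q) -
  \<delta>(p) q - p \<delta>(q).\<close>

lemma approx_idempotents:
  assumes p: "idempotent_mod p" and q: "idempotent_mod q" and mi: "m + i \<le> n"
  shows "c m (\<delta> (p \<otimes> q)) (orb e i) = c m (\<delta> p \<otimes> q) (orb e i) + c m (p \<otimes> \<delta> q) (orb e i)"
proof -
  define u where "u = M (\<lambda>v. 1) 0"
  define l where "l x = c m x (orb e i)" for x
  have l: "functional l" unfolding l_def by (rule functional_c)
  have u: "u \<in> carrier A" by (simp add: u_def M_closed)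
  have pc: "p \<in> carrier A" "q \<in> carrier A" using p q by (auto simp: idempotent_mod_def)
  note cl = pc u mult_closed minus_in_carrier approx_closed
  note one = M_one[folded u_def]
  define p' where "p' = u \<ominus> p"
  define q' where "q' = u \<ominus> q"
  have c': "p' \<in> carrier A" "q' \<in> carrier A" by (auto simp: p'_def q'_def cl)
  have pp: "p' \<otimes> p \<in> I" "p \<otimes> p' \<in> I" using p
    by (auto simp: idempotent_mod_def p'_def mult_minus_left mult_minus_right cl one)
  have qq: "q' \<otimes> q \<in> I" "q \<otimes> q' \<in> I" using q
    by (auto simp: idempotent_mod_def q'_def mult_minus_left mult_minus_right cl one)
  have zero: "l ((x \<otimes> \<delta> (a \<otimes> b)) \<otimes> y) = 0"
    if "x \<in> carrier A" "a \<in> carrier A" "b \<in> carrier A" "y \<in> carrier A" "x \<otimes> a \<in> I" "b \<otimes> y \<in> I" for x a b y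
  proof -
    have "x \<otimes> (a \<otimes> b) \<in> I" "(a \<otimes> b) \<otimes> y \<in> I"
      using that orbit_ideal_mult[of "x \<otimes> a" b] orbit_ideal_mult[of a "b \<otimes> y"]
      by (simp_all add: mult_closed mult_assoc)
    then show ?thesis unfolding l_def using that mi by (intro approx_zero_product) (auto simp: mult_closed)
  qed
  let ?U = "\<delta> (p \<otimes> q)" and ?V = "\<delta> p" and ?W = "\<delta> q"
  note ex = mult_minus_left mult_minus_right cl one approx_minus functional_minus[OF l] functional_add[OF l]
    distr_left distr_right
  have 1: "l ?U - l (p \<otimes> ?U) - l (?U \<otimes> q) + l (p \<otimes> ?U \<otimes> q) = 0"
    using zero[OF c'(1) cl(1,2) c'(2) pp(1) qq(2)] by (simp add: p'_def q'_def ex)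
  have 2: "l (p \<otimes> ?W) - l (p \<otimes> ?U) - l (p \<otimes> ?W \<otimes> q) + l (p \<otimes> ?U \<otimes> q) = 0"
    using zero[OF cl(1) c'(1) cl(2) c'(2) pp(2) qq(2)] by (simp add: p'_def q'_def ex)
  have 3: "l (?V \<otimes> q) - l (?U \<otimes> q) - l (p \<otimes> ?V \<otimes> q) + l (p \<otimes> ?U \<otimes> q) = 0"
    using zero[OF c'(1) cl(1) c'(2) cl(2) pp(1) qq(1)] by (simp add: p'_def q'_def ex) (simp add: algebra_simps)
  have "l (p \<otimes> \<delta> u \<otimes> q) = 0"
  proof -
    have "l \<zero> = l (0 \<odot> u)" by (simp add: smult_zero_left u)
    then have "l \<zero> = 0" using functional_smult[OF l u, of 0] by simp
    moreover have "p \<otimes> \<zero> \<otimes> q = \<zero>"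
      using scale_mult_right[OF cl(1) u, of 0] scale_mult_left[OF mult_closed[OF cl(1) u] cl(2), of 0]
      by (simp add: smult_zero_left cl)
    ultimately show ?thesis by (simp add: approx_one[folded u_def])
  qed
  then have 4: "- l (p \<otimes> ?V \<otimes> q) - l (p \<otimes> ?W \<otimes> q) + l (p \<otimes> ?U \<otimes> q) = 0"
    using zero[OF cl(1) c'(1) c'(2) cl(2) pp(2) qq(1)] by (simp add: p'_def q'_def ex)
  have "l ?U - (l (?V \<otimes> q) + l (p \<otimes> ?W))
    = (l ?U - l (p \<otimes> ?U) - l (?U \<otimes> q) + l (p \<otimes> ?U \<otimes> q))
      - (l (p \<otimes> ?W) - l (p \<otimes> ?U) - l (p \<otimes> ?W \<otimes> q) + l (p \<otimes> ?U \<otimes> q))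
      - (l (?V \<otimes> q) - l (?U \<otimes> q) - l (p \<otimes> ?V \<otimes> q) + l (p \<otimes> ?U \<otimes> q))
      + (- l (p \<otimes> ?V \<otimes> q) - l (p \<otimes> ?W \<otimes> q) + l (p \<otimes> ?U \<otimes> q))"
    by (simp add: algebra_simps)
  also have "\<dots> = 0" unfolding 1 2 3 4 by simp
  finally show ?thesis by (simp add: l_def)
qed

text \<open>The defect of the Leibniz rule is bounded and linear in each argument, and vanishes as
  soon as one argument is in the ideal. So the spanning property of idempotents can be applied to
  one argument after the other.\<close>

lemma approx_derivation_mod:
  assumes x: "x \<in> carrier A" and y: "y \<in> carrier A" and mi: "m + i \<le> n"
  shows "c m (\<delta> (x \<otimes> y)) (orb e i) = c m (\<delta> x \<otimes> y) (orb e i) + c m (x \<otimes> \<delta> y) (orb e i)"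
proof -
  define l where "l x = c m x (orb e i)" for x
  have l: "functional l" unfolding l_def by (rule functional_c)
  have l0: "l x = 0" if "x \<in> I" for x using that mi by (simp add: l_def orbit_ideal_def)
  define E where "E x y = l (\<delta> (x \<otimes> y)) - l (\<delta> x \<otimes> y) - l (x \<otimes> \<delta> y)" for x y
  have E1: "functional (\<lambda>x. E x y)" if y: "y \<in> carrier A" for y
    unfolding E_def using y approx_closed[OF y]
    by (intro functional_diff functional_mult_right[OF functional_comp[OF l approx_bounded_linear]]
        functional_comp[OF functional_mult_right[OF l] approx_bounded_linear] functional_mult_right[OF l])
  have E2: "functional (\<lambda>y. E x y)" if x: "x \<in> carrier A" for x
    unfolding E_def using x approx_closed[OF x]
    by (intro functional_diff functional_mult_left[OF functional_comp[OF l approx_bounded_linear]]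
        functional_comp[OF functional_mult_left[OF l] approx_bounded_linear] functional_mult_left[OF l])
  have E0: "E x y = 0" if "x \<in> carrier A" "y \<in> carrier A" "x \<in> I \<or> y \<in> I" for x y
  proof -
    have "x \<otimes> y \<in> I" "\<delta> x \<otimes> y \<in> I" "x \<otimes> \<delta> y \<in> I"
      using that approx_closed approx_orbit_ideal by (auto intro!: orbit_ideal_mult)
    then show ?thesis using l0 approx_orbit_ideal by (simp add: E_def)
  qed
  have idem: "E p q = 0" if "idempotent_mod p" "idempotent_mod q" for p q
    using approx_idempotents[OF that mi] by (simp add: E_def l_def)
  have E3: "E x q = 0" if q: "idempotent_mod q" for q
    by (rule functional_zero_idempotents[OF E1 _ _ x])
      (use q idem E0 orbit_ideal_carrier in \<open>auto simp: idempotent_mod_def\<close>)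
  have "E x y = 0"
    by (rule functional_zero_idempotents[OF E2[OF x] _ _ y])
      (use x E3 E0 orbit_ideal_carrier in auto)
  then show ?thesis by (simp add: E_def l_def algebra_simps)
qed

end

end

theorem (in skew_series_algebra) approximately_local_derivation_is_derivation:
  assumes free: "topologically_free \<sigma>" and \<delta>: "approximately_local_derivation A \<delta>"
  shows "derivation A \<delta>"
  unfolding derivation_def
proof (intro conjI ballI)
  show bl: "bounded_linear_map A A \<delta>" using \<delta> by (simp add: approximately_local_derivation_def)
  have \<delta>c: "\<delta> x \<in> carrier A" if "x \<in> carrier A" for x
    using bl that unfolding bounded_linear_map_def linear_map_def by blast
  fix x y assume x: "x \<in> carrier A" and y: "y \<in> carrier A"
  define z where "z = \<delta> (x \<otimes> y) \<ominus> (\<delta> x \<otimes> y \<oplus> x \<otimes> \<delta> y)"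
  note cl = x y \<delta>c mult_closed minus_in_carrier
  have z: "z \<in> carrier A" by (simp add: z_def cl)
  have "z = \<zero>"
  proof (rule c_faithful[OF z])
    fix m v
    have "c m z v = 0" if "inj_on (\<lambda>i. (\<sigma> ^^ i) v) {..2 * m + 1}" for v
    proof -
      \<comment> \<open>\<open>c m z v\<close> is the upper right corner of the matrix of size m + 1
        at \<open>v\<close>, so the size parameter is m and the row index is 0.\<close>
      interpret generic_orbit A \<sigma> M c K v m by unfold_locales (rule that)
      show ?thesis
        using approx_derivation_mod[OF \<delta> x y, of m 0]
        by (simp add: z_def functional_minus[OF functional_c] c_add cl)
    qed
    then have "{v. c m z v \<noteq> 0} \<subseteq> {v. \<not> inj_on (\<lambda>i. (\<sigma> ^^ i) v) {..2 * m + 1}}" by auto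
    moreover have "open {v. c m z v \<noteq> 0}"
      using c_cont[OF z] by (intro open_Collect_neq) auto
    ultimately have "{v. c m z v \<noteq> 0} = {}"
      using interior_maximal interior_nongeneric[OF cont free] by blast
    then show "c m z v = 0" by auto
  qed
  then show "\<delta> (x \<otimes> y) = \<delta> x \<otimes> y \<oplus> x \<otimes> \<delta> y"
    by (simp add: z_def minus_eq_zero_iff cl)
qed


section \<open>Adjointable operators on square summable functions\<close>

text \<open>The index type may be uncountable: below it consists of pairs of a level and a point,
  with the points taken as a discrete set. This makes the value of a coefficient at a point a matrix
  entry.\<close>

typedef 'i l2 = "{f :: 'i \<Rightarrow> complex. (\<lambda>i. (cmod (f i))\<^sup>2) summable_on UNIV}"
  morphisms coord Abs_l2
  by (rule exI[of _ "\<lambda>_. 0"]) simp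

lemma summable_coord: "(\<lambda>i. (cmod (coord x i))\<^sup>2) summable_on UNIV"
  using coord[of x] by simp

lemma l2_eqI: "(\<And>i. coord x i = coord y i) \<Longrightarrow> x = y"
  by (simp add: coord_inject[symmetric] fun_eq_iff)

lemma summable_inner_coord: "(\<lambda>i. coord x i \<bullet> coord y i) summable_on UNIV"
proof (rule abs_summable_summable, rule summable_on_comparison_test)
  show "(\<lambda>i. (cmod (coord x i))\<^sup>2 + (cmod (coord y i))\<^sup>2) summable_on UNIV"
    by (intro summable_on_add summable_coord)
  show "norm (coord x i \<bullet> coord y i) \<le> (cmod (coord x i))\<^sup>2 + (cmod (coord y i))\<^sup>2" for i
    using Cauchy_Schwarz_ineq2[of "coord x i" "coord y i"]
      sum_squares_bound[of "cmod (coord x i)" "cmod (coord y i)"]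
      mult_nonneg_nonneg[OF norm_ge_zero[of "coord x i"] norm_ge_zero[of "coord y i"]]
    unfolding real_norm_def by linarith
qed simp

instantiation l2 :: (type) real_inner
begin

definition zero_l2 :: "'a l2" where "0 = Abs_l2 (\<lambda>_. 0)"
definition plus_l2 :: "'a l2 \<Rightarrow> 'a l2 \<Rightarrow> 'a l2" where "x + y = Abs_l2 (\<lambda>i. coord x i + coord y i)"
definition scaleR_l2 :: "real \<Rightarrow> 'a l2 \<Rightarrow> 'a l2" where "r *\<^sub>R x = Abs_l2 (\<lambda>i. r *\<^sub>R coord x i)"
definition uminus_l2 :: "'a l2 \<Rightarrow> 'a l2" where "- x = (-1) *\<^sub>R (x :: 'a l2)"
definition minus_l2 :: "'a l2 \<Rightarrow> 'a l2 \<Rightarrow> 'a l2" where "x - y = x + (- y)" for x y :: "'a l2"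
definition inner_l2 :: "'a l2 \<Rightarrow> 'a l2 \<Rightarrow> real" where "inner_l2 x y = (\<Sum>\<^sub>\<infinity>i. coord x i \<bullet> coord y i)"
definition norm_l2 :: "'a l2 \<Rightarrow> real" where "norm_l2 x = sqrt (x \<bullet> x)"
definition sgn_l2 :: "'a l2 \<Rightarrow> 'a l2" where "sgn_l2 x = inverse (norm x) *\<^sub>R x"
definition dist_l2 :: "'a l2 \<Rightarrow> 'a l2 \<Rightarrow> real" where "dist_l2 x y = norm (x - y)"
definition uniformity_l2 :: "('a l2 \<times> 'a l2) filter"
  where "uniformity_l2 = (INF e\<in>{0<..}. principal {(x, y). dist x y < e})"
definition open_l2 :: "'a l2 set \<Rightarrow> bool"
  where "open_l2 U \<longleftrightarrow> (\<forall>x\<in>U. \<forall>\<^sub>F (x', y) in uniformity. x' = x \<longrightarrow> y \<in> U)"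

lemma coord_zero_l2 [simp]: "coord (0 :: 'a l2) i = 0"
  by (simp add: zero_l2_def Abs_l2_inverse)

lemma coord_plus_l2 [simp]: "coord (x + y :: 'a l2) i = coord x i + coord y i"
proof -
  have "(\<lambda>i. (cmod (coord x i + coord y i))\<^sup>2) summable_on UNIV"
  proof (rule summable_on_comparison_test)
    show "(\<lambda>i. 2 * (cmod (coord x i))\<^sup>2 + 2 * (cmod (coord y i))\<^sup>2) summable_on UNIV"
      by (intro summable_on_add summable_on_cmult_right summable_coord)
    fix i
    have "(cmod (coord x i + coord y i))\<^sup>2 \<le> (cmod (coord x i) + cmod (coord y i))\<^sup>2"
      by (intro power_mono norm_triangle_ineq) auto
    then show "(cmod (coord x i + coord y i))\<^sup>2 \<le> 2 * (cmod (coord x i))\<^sup>2 + 2 * (cmod (coord y i))\<^sup>2"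
      using sum_squares_bound[of "cmod (coord x i)" "cmod (coord y i)"] by (simp add: power2_sum)
  qed simp
  then show ?thesis by (simp add: plus_l2_def Abs_l2_inverse)
qed

lemma coord_scaleR_l2 [simp]: "coord (r *\<^sub>R x :: 'a l2) i = r *\<^sub>R coord x i"
proof -
  have "(\<lambda>i. (cmod (r *\<^sub>R coord x i))\<^sup>2) summable_on UNIV"
    using summable_on_cmult_right[OF summable_coord[of x], of "r\<^sup>2"] by (simp add: power_mult_distrib)
  then show ?thesis by (simp add: scaleR_l2_def Abs_l2_inverse)
qed

lemma coord_uminus_l2 [simp]: "coord (- x :: 'a l2) i = - coord x i"
  by (simp add: uminus_l2_def)

lemma coord_minus_l2 [simp]: "coord (x - y :: 'a l2) i = coord x i - coord y i"
  by (simp add: minus_l2_def)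

instance
proof
  fix x y z :: "'a l2" and r s :: real
  show "x \<bullet> y = y \<bullet> x" by (simp add: inner_l2_def inner_commute)
  show "(x + y) \<bullet> z = x \<bullet> z + y \<bullet> z"
    by (simp add: inner_l2_def inner_add_left infsum_add summable_inner_coord)
  show "(r *\<^sub>R x) \<bullet> y = r * (x \<bullet> y)"
    by (simp add: inner_l2_def infsum_cmult_right')
  show "0 \<le> x \<bullet> x" by (simp add: inner_l2_def infsum_nonneg)
  show "x \<bullet> x = 0 \<longleftrightarrow> x = 0"
  proof
    assume "x \<bullet> x = 0"
    then have "coord x i \<bullet> coord x i = 0" for i
      by (intro nonneg_infsum_le_0D[OF _ summable_inner_coord]) (auto simp: inner_l2_def)
    then show "x = 0" by (intro l2_eqI) auto
  qed (simp add: inner_l2_def)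
qed (auto intro: l2_eqI simp: algebra_simps sgn_l2_def dist_l2_def norm_l2_def uniformity_l2_def open_l2_def)

end

lemma norm_l2_square: "(norm x)\<^sup>2 = (\<Sum>\<^sub>\<infinity>i. (cmod (coord x i))\<^sup>2)"
  by (simp add: power2_norm_eq_inner[of x] inner_l2_def) (simp add: power2_norm_eq_inner)

lemma sum_coord_le_norm: "finite F \<Longrightarrow> (\<Sum>i\<in>F. (cmod (coord x i))\<^sup>2) \<le> (norm x)\<^sup>2"
  unfolding norm_l2_square by (rule finite_sum_le_infsum[OF summable_coord]) auto

lemma coord_le_norm: "cmod (coord x i) \<le> norm x"
  by (rule power2_le_imp_le) (use sum_coord_le_norm[of "{i}" x] in auto)

lemma l2_bounded_sums:
  assumes "\<And>F. finite F \<Longrightarrow> (\<Sum>i\<in>F. (cmod (f i))\<^sup>2) \<le> C\<^sup>2" "C \<ge> 0"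
  shows "coord (Abs_l2 f) = f" "norm (Abs_l2 f) \<le> C"
proof -
  have "(\<lambda>i. (cmod (f i))\<^sup>2) summable_on UNIV"
    by (rule nonneg_bdd_above_summable_on) (use assms in \<open>auto intro!: bdd_aboveI[of _ "C\<^sup>2"]\<close>)
  then show "coord (Abs_l2 f) = f" by (simp add: Abs_l2_inverse)
  then have "(norm (Abs_l2 f))\<^sup>2 \<le> C\<^sup>2"
    unfolding norm_l2_square using assms summable_coord[of "Abs_l2 f"]
    by (intro infsum_le_finite_sums) auto
  then show "norm (Abs_l2 f) \<le> C" using assms power2_le_imp_le by blast
qed

instance l2 :: (type) banach
proof
  fix X :: "nat \<Rightarrow> 'a l2" assume X: "Cauchy X"
  have "Cauchy (\<lambda>n. coord (X n) i)" for i
    unfolding Cauchy_iff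
  proof (intro allI impI)
    fix e :: real assume "e > 0"
    then obtain M where M: "\<And>m n. m \<ge> M \<Longrightarrow> n \<ge> M \<Longrightarrow> norm (X m - X n) < e"
      using X unfolding Cauchy_iff by blast
    have "cmod (coord (X m) i - coord (X n) i) < e" if "m \<ge> M" "n \<ge> M" for m n
      using coord_le_norm[of "X m - X n" i] M[OF that] by simp
    then show "\<exists>M. \<forall>m\<ge>M. \<forall>n\<ge>M. cmod (coord (X m) i - coord (X n) i) < e" by blast
  qed
  then have lim: "(\<lambda>n. coord (X n) i) \<longlonglongrightarrow> lim (\<lambda>n. coord (X n) i)" for i
    using Cauchy_convergent_iff convergent_LIMSEQ_iff by blast
  define f where "f i = lim (\<lambda>n. coord (X n) i)" for i
  \<comment> \<open>The coordinatewise limit \<open>f\<close> is not yet known to be square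
    summable, but its difference from \<open>X n\<close> has bounded finite sums.\<close>
  have close: "coord (Abs_l2 (\<lambda>i. coord (X n) i - f i)) = (\<lambda>i. coord (X n) i - f i)
      \<and> norm (Abs_l2 (\<lambda>i. coord (X n) i - f i)) \<le> e"
    if "e > 0" and M: "\<And>m n. m \<ge> M \<Longrightarrow> n \<ge> M \<Longrightarrow> norm (X m - X n) < e" and n: "n \<ge> M" for e M n
  proof -
    have "(\<Sum>i\<in>F. (cmod (coord (X n) i - f i))\<^sup>2) \<le> e\<^sup>2" if F: "finite F" for F
    proof (rule LIMSEQ_le_const2)
      show "(\<lambda>m. \<Sum>i\<in>F. (cmod (coord (X n) i - coord (X m) i))\<^sup>2) \<longlonglongrightarrow> (\<Sum>i\<in>F. (cmod (coord (X n) i - f i))\<^sup>2)"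
        unfolding f_def by (intro tendsto_intros lim)
      have "(\<Sum>i\<in>F. (cmod (coord (X n) i - coord (X m) i))\<^sup>2) \<le> e\<^sup>2" if "m \<ge> M" for m
        using sum_coord_le_norm[OF F, of "X n - X m"] power_mono[OF less_imp_le[OF M[OF n that]], of 2] by simp
      then show "\<exists>N. \<forall>m\<ge>N. (\<Sum>i\<in>F. (cmod (coord (X n) i - coord (X m) i))\<^sup>2) \<le> e\<^sup>2" by blast
    qed
    then show ?thesis using l2_bounded_sums[of "\<lambda>i. coord (X n) i - f i" e] \<open>e > 0\<close> by simp
  qed
  obtain M where M: "\<And>m n. m \<ge> M \<Longrightarrow> n \<ge> M \<Longrightarrow> norm (X m - X n) < 1"
    using X unfolding Cauchy_iff by (meson zero_less_one)
  \<comment> \<open>Subtracting a square summable difference from \<open>X M\<close> shows that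
    \<open>f\<close> itself is square summable.\<close>
  define L where "L = X M - Abs_l2 (\<lambda>i. coord (X M) i - f i)"
  have L: "coord L i = f i" for i using close[OF _ M, of M] by (simp add: L_def)
  have "X \<longlonglongrightarrow> L"
  proof (rule LIMSEQ_I)
    fix r :: real assume "r > 0"
    then obtain N where N: "\<And>m n. m \<ge> N \<Longrightarrow> n \<ge> N \<Longrightarrow> norm (X m - X n) < r/2"
      using X unfolding Cauchy_iff by (meson half_gt_zero)
    have "norm (X n - L) < r" if "n \<ge> N" for n
    proof -
      have "X n - L = Abs_l2 (\<lambda>i. coord (X n) i - f i)"
        using close[OF _ N that] \<open>r > 0\<close> by (intro l2_eqI) (simp add: L)
      then show ?thesis using close[OF _ N that] \<open>r > 0\<close> by auto
    qed
    then show "\<exists>no. \<forall>n\<ge>no. norm (X n - L) < r" by blast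
  qed
  then show "convergent X" by (rule convergentI)
qed

definition unit_l2 :: "'i \<Rightarrow> 'i l2" where
  "unit_l2 i = Abs_l2 (\<lambda>j. if j = i then 1 else 0)"

lemma coord_unit_l2: "coord (unit_l2 i) j = (if j = i then 1 else 0)"
  and norm_unit_l2: "norm (unit_l2 i) \<le> 1"
proof -
  have "(\<Sum>j\<in>F. (cmod (if j = i then 1 else 0))\<^sup>2) \<le> 1\<^sup>2" if "finite F" for F
  proof -
    have "(\<Sum>j\<in>F. (cmod (if j = i then 1 else 0))\<^sup>2) = (\<Sum>j\<in>F. if j = i then 1 else 0)"
      by (intro sum.cong) auto
    then show ?thesis using that by simp
  qed
  from l2_bounded_sums[of "\<lambda>j. if j = i then 1 else 0" 1] this
  show "coord (unit_l2 i) j = (if j = i then 1 else 0)" "norm (unit_l2 i) \<le> 1"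
    unfolding unit_l2_def by auto
qed

definition l2_operator :: "('i l2 \<Rightarrow> 'i \<Rightarrow> complex) \<Rightarrow> 'i l2 \<Rightarrow>\<^sub>L 'i l2" where
  "l2_operator g = Blinfun (\<lambda>x. Abs_l2 (g x))"

text \<open>A bound for finite partial sums gives square summability and the operator norm at once,
  which reduces every operator below to a finite estimate.\<close>

lemma coord_l2_operator:
  assumes C: "C \<ge> 0" and bd: "\<And>x F. finite F \<Longrightarrow> (\<Sum>i\<in>F. (cmod (g x i))\<^sup>2) \<le> (C * norm x)\<^sup>2"
    and add: "\<And>x y i. g (x + y) i = g x i + g y i" and scale: "\<And>r x i. g (r *\<^sub>R x) i = r *\<^sub>R g x i"
  shows "coord (blinfun_apply (l2_operator g) x) i = g x i"
proof -
  have *: "coord (Abs_l2 (g x)) = g x" "norm (Abs_l2 (g x)) \<le> C * norm x" for x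
    using l2_bounded_sums[of "g x" "C * norm x"] bd C by auto
  have "bounded_linear (\<lambda>x. Abs_l2 (g x))"
    by (rule bounded_linear_intro[where K = C]) (auto intro!: l2_eqI simp: * add scale mult.commute)
  then show ?thesis by (simp add: l2_operator_def bounded_linear_Blinfun_apply *)
qed

lemma inner_complex_adjoint: "(a * b) \<bullet> c = b \<bullet> (cnj a * c)" for a b c :: complex
  by (simp add: inner_complex_def algebra_simps)

text \<open>The type class structure on \<open>l2\<close> is real. Complex scalars act as operators,
  and complex linearity becomes commutation with them.\<close>

definition l2_scale :: "complex \<Rightarrow> 'i l2 \<Rightarrow>\<^sub>L 'i l2" where
  "l2_scale a = l2_operator (\<lambda>x i. a * coord x i)"

lemma coord_l2_scale [simp]: "coord (blinfun_apply (l2_scale a) x) i = a * coord x i"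
  unfolding l2_scale_def
proof (rule coord_l2_operator[where C = "cmod a"])
  fix x and F :: "'a set" assume "finite F"
  then show "(\<Sum>i\<in>F. (cmod (a * coord x i))\<^sup>2) \<le> (cmod a * norm x)\<^sup>2"
    using sum_coord_le_norm[of F x]
    by (simp add: norm_mult power_mult_distrib mult_left_mono flip: sum_distrib_left)
qed (auto simp: algebra_simps)

lemma norm_l2_scale: "norm (blinfun_apply (l2_scale a) x) = cmod a * norm x"
proof -
  have "(norm (blinfun_apply (l2_scale a) x))\<^sup>2 = (cmod a * norm x)\<^sup>2"
    by (simp add: norm_l2_square power_mult_distrib norm_mult infsum_cmult_right')
  then show ?thesis by (rule power2_eq_imp_eq) auto
qed

lemma inner_l2_scale: "blinfun_apply (l2_scale a) x \<bullet> y = x \<bullet> blinfun_apply (l2_scale (cnj a)) y"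
  by (simp add: inner_l2_def inner_complex_adjoint)

definition l2_adjoint :: "('i l2 \<Rightarrow>\<^sub>L 'i l2) \<Rightarrow> ('i l2 \<Rightarrow>\<^sub>L 'i l2) \<Rightarrow> bool" where
  "l2_adjoint T S \<longleftrightarrow> (\<forall>x y. T x \<bullet> y = x \<bullet> S y)"

text \<open>Demanding an adjoint takes the place of the Riesz representation theorem; the Fock
  operators have explicit ones.\<close>

definition adjointable :: "('i l2 \<Rightarrow>\<^sub>L 'i l2) \<Rightarrow> bool" where
  "adjointable T \<longleftrightarrow> (\<forall>a. T o\<^sub>L l2_scale a = l2_scale a o\<^sub>L T) \<and> (\<exists>S. l2_adjoint T S)"

definition adj :: "('i l2 \<Rightarrow>\<^sub>L 'i l2) \<Rightarrow> ('i l2 \<Rightarrow>\<^sub>L 'i l2)" where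
  "adj T = (SOME S. l2_adjoint T S)"

text \<open>
  Adjoints are taken for the real inner product, the real part of the complex one; for complex
  linear operators this gives the same adjoint.
\<close>

definition l2_operators :: "('i l2 \<Rightarrow>\<^sub>L 'i l2) cstar_alg" where
  "l2_operators = \<lparr>carrier = Collect adjointable, mult = (o\<^sub>L), one = id_blinfun, zero = 0, add = (+),
    smult = (\<lambda>a T. l2_scale a o\<^sub>L T), nrm = norm, star = adj\<rparr>"

lemma l2_operators_simps:
  "carrier l2_operators = Collect adjointable" "mult l2_operators = (o\<^sub>L)" "zero l2_operators = 0"
  "add l2_operators = (+)" "smult l2_operators = (\<lambda>a T. l2_scale a o\<^sub>L T)" "nrm l2_operators = norm"
  "star l2_operators = adj"
  by (auto simp: l2_operators_def)

lemma l2_adjoint_unique: "l2_adjoint T S \<Longrightarrow> l2_adjoint T S' \<Longrightarrow> S = S'"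
proof (rule blinfun_eqI)
  fix y assume "l2_adjoint T S" "l2_adjoint T S'"
  then have "x \<bullet> (S y - S' y) = 0" for x by (simp add: l2_adjoint_def inner_diff_right)
  from this[of "S y - S' y"] show "S y = S' y" by simp
qed

lemma adj_eqI: "l2_adjoint T S \<Longrightarrow> adj T = S"
  unfolding adj_def by (rule l2_adjoint_unique[OF someI])

lemma l2_adjoint_adj: "adjointable T \<Longrightarrow> l2_adjoint T (adj T)"
  using adj_eqI by (auto simp: adjointable_def)

lemma l2_adjoint_sym: "l2_adjoint T S \<Longrightarrow> l2_adjoint S T"
  by (metis inner_commute l2_adjoint_def)

lemma l2_adjoint_add: "l2_adjoint T S \<Longrightarrow> l2_adjoint T' S' \<Longrightarrow> l2_adjoint (T + T') (S + S')"
  by (simp add: l2_adjoint_def plus_blinfun.rep_eq inner_add_left inner_add_right)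

lemma l2_adjoint_compose: "l2_adjoint T S \<Longrightarrow> l2_adjoint T' S' \<Longrightarrow> l2_adjoint (T o\<^sub>L T') (S' o\<^sub>L S)"
  by (simp add: l2_adjoint_def)

lemma l2_adjoint_scale: "l2_adjoint (l2_scale a) (l2_scale (cnj a))"
  by (simp add: l2_adjoint_def inner_l2_scale)

lemma l2_scale_compose: "l2_scale (a * b) = l2_scale a o\<^sub>L l2_scale b"
  by (intro blinfun_eqI l2_eqI) simp

lemma l2_scale_add: "l2_scale (a + b) = l2_scale a + l2_scale b"
  by (intro blinfun_eqI l2_eqI) (simp add: plus_blinfun.rep_eq algebra_simps)

lemma l2_scale_one: "l2_scale 1 = id_blinfun"
  by (intro blinfun_eqI l2_eqI) simp

lemma adjointableI: "\<lbrakk>l2_adjoint T S; \<And>a. T o\<^sub>L l2_scale a = l2_scale a o\<^sub>L T\<rbrakk> \<Longrightarrow> adjointable T"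
  by (auto simp: adjointable_def)

lemma blinfun_compose_add_left: "(S + T) o\<^sub>L U = (S o\<^sub>L U) + (T o\<^sub>L U)"
  by (rule blinfun_eqI) (simp add: plus_blinfun.rep_eq)

lemma blinfun_compose_add_right: "U o\<^sub>L (S + T) = (U o\<^sub>L S) + (U o\<^sub>L T)"
  by (rule blinfun_eqI) (simp add: plus_blinfun.rep_eq blinfun.add_right)

lemma blinfun_compose_assoc: "(S o\<^sub>L T) o\<^sub>L U = S o\<^sub>L (T o\<^sub>L U)"
  by (rule blinfun_eqI) simp

lemma blinfun_compose_id_left: "id_blinfun o\<^sub>L T = T"
  by (rule blinfun_eqI) simp

lemma adjointable_commute: "adjointable T \<Longrightarrow> T o\<^sub>L l2_scale a = l2_scale a o\<^sub>L T"
  by (simp add: adjointable_def)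

lemma adjointable_add: "adjointable S \<Longrightarrow> adjointable T \<Longrightarrow> adjointable (S + T)"
  by (rule adjointableI[OF l2_adjoint_add[OF l2_adjoint_adj l2_adjoint_adj]])
    (auto simp: blinfun_compose_add_left blinfun_compose_add_right adjointable_commute)

lemma adjointable_compose: "adjointable S \<Longrightarrow> adjointable T \<Longrightarrow> adjointable (S o\<^sub>L T)"
  by (rule adjointableI[OF l2_adjoint_compose[OF l2_adjoint_adj l2_adjoint_adj]])
    (auto simp: blinfun_compose_assoc adjointable_commute, simp add: adjointable_commute flip: blinfun_compose_assoc)

lemma adjointable_l2_scale: "adjointable (l2_scale a)"
  by (rule adjointableI[OF l2_adjoint_scale]) (simp add: mult.commute flip: l2_scale_compose)

lemma adjointable_zero: "adjointable 0"
  by (rule adjointableI[of _ 0]) (auto simp: l2_adjoint_def)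

lemma adjointable_adj: assumes "adjointable T" shows "adjointable (adj T)"
proof (rule adjointableI[OF l2_adjoint_sym[OF l2_adjoint_adj[OF assms]]])
  fix a
  have "l2_adjoint (l2_scale (cnj a) o\<^sub>L T) (adj T o\<^sub>L l2_scale a)"
    using l2_adjoint_compose[OF l2_adjoint_scale l2_adjoint_adj[OF assms], of "cnj a"] by simp
  moreover have "l2_adjoint (T o\<^sub>L l2_scale (cnj a)) (l2_scale a o\<^sub>L adj T)"
    using l2_adjoint_compose[OF l2_adjoint_adj[OF assms] l2_adjoint_scale, of "cnj a"] by simp
  ultimately show "adj T o\<^sub>L l2_scale a = l2_scale a o\<^sub>L adj T"
    using l2_adjoint_unique by (simp add: adjointable_commute[OF assms])
qed

lemma norm_adj_le: assumes "adjointable T" shows "norm (adj T) \<le> norm T"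
proof (rule norm_blinfun_bound)
  fix y
  let ?z = "blinfun_apply (adj T) y"
  have "(norm ?z)\<^sup>2 = T ?z \<bullet> y"
    using l2_adjoint_adj[OF assms] by (simp add: l2_adjoint_def power2_norm_eq_inner)
  also have "\<dots> \<le> norm (T ?z) * norm y" by (rule norm_cauchy_schwarz)
  also have "\<dots> \<le> (norm T * norm ?z) * norm y" by (intro mult_right_mono norm_blinfun) auto
  finally have "norm ?z * norm ?z \<le> (norm T * norm y) * norm ?z" by (simp add: power2_eq_square mult_ac)
  then show "norm ?z \<le> norm T * norm y"
    by (cases "norm ?z = 0") (auto simp: mult_le_cancel_right_pos)
qed simp

lemma norm_adj_compose: assumes "adjointable T" shows "norm (adj T o\<^sub>L T) = (norm T)\<^sup>2"
proof (rule antisym)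
  have "norm (adj T o\<^sub>L T) \<le> norm (adj T) * norm T" by (rule norm_blinfun_compose)
  also have "\<dots> \<le> norm T * norm T" by (intro mult_right_mono norm_adj_le assms) auto
  finally show "norm (adj T o\<^sub>L T) \<le> (norm T)\<^sup>2" by (simp add: power2_eq_square)
  have "norm T \<le> sqrt (norm (adj T o\<^sub>L T))"
  proof (rule norm_blinfun_bound)
    fix x
    have "(norm (T x))\<^sup>2 = x \<bullet> (adj T o\<^sub>L T) x"
      using l2_adjoint_adj[OF assms] by (simp add: l2_adjoint_def power2_norm_eq_inner)
    also have "\<dots> \<le> norm x * (norm (adj T o\<^sub>L T) * norm x)"
      by (rule order_trans[OF norm_cauchy_schwarz]) (intro mult_left_mono norm_blinfun norm_ge_zero)
    also have "\<dots> = (sqrt (norm (adj T o\<^sub>L T)) * norm x)\<^sup>2"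
      by (simp add: power_mult_distrib) (simp add: power2_eq_square)
    finally show "norm (T x) \<le> sqrt (norm (adj T o\<^sub>L T)) * norm x" by (rule power2_le_imp_le) simp
  qed simp
  then have "(norm T)\<^sup>2 \<le> (sqrt (norm (adj T o\<^sub>L T)))\<^sup>2" by (intro power_mono) auto
  then show "(norm T)\<^sup>2 \<le> norm (adj T o\<^sub>L T)" by simp
qed

lemma norm_l2_scale_compose: "norm (l2_scale a o\<^sub>L T) = cmod a * norm T"
proof (rule antisym)
  show "norm (l2_scale a o\<^sub>L T) \<le> cmod a * norm T"
    by (rule norm_blinfun_bound) (auto simp: norm_l2_scale mult.assoc intro!: mult_left_mono norm_blinfun)
  show "cmod a * norm T \<le> norm (l2_scale a o\<^sub>L T)"
  proof (cases "a = 0")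
    case False
    have "norm T \<le> norm (l2_scale a o\<^sub>L T) / cmod a"
    proof (rule norm_blinfun_bound)
      fix x
      have "cmod a * norm (T x) \<le> norm (l2_scale a o\<^sub>L T) * norm x"
        using norm_blinfun[of "l2_scale a o\<^sub>L T" x] by (simp add: norm_l2_scale)
      then show "norm (T x) \<le> norm (l2_scale a o\<^sub>L T) / cmod a * norm x"
        using False by (simp add: field_simps)
    qed simp
    then show ?thesis using False by (simp add: field_simps)
  qed simp
qed

lemma normed_algebra_l2_operators: "complex_normed_algebra l2_operators"
proof -
  have "Module.module complex_ring l2_operators"
  proof (rule moduleI)
    show "cring complex_ring" by (rule cring_complex_ring)
    show "abelian_group l2_operators"
    proof (rule abelian_groupI)
      fix T assume "T \<in> carrier l2_operators"
      then have T: "adjointable T" by (simp add: l2_operators_simps)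
      have "(l2_scale (-1) o\<^sub>L T) + T = 0"
        by (intro blinfun_eqI l2_eqI) (simp add: plus_blinfun.rep_eq)
      then show "\<exists>S\<in>carrier l2_operators. S \<oplus>\<^bsub>l2_operators\<^esub> T = \<zero>\<^bsub>l2_operators\<^esub>"
        using adjointable_compose[OF adjointable_l2_scale T, of "-1"]
        by (intro bexI[of _ "l2_scale (-1) o\<^sub>L T"]) (auto simp: l2_operators_simps)
    qed (auto simp: l2_operators_simps adjointable_add adjointable_zero)
  qed (auto simp: l2_operators_simps complex_ring_def adjointable_compose adjointable_l2_scale
      l2_scale_add l2_scale_compose l2_scale_one blinfun_compose_add_left blinfun_compose_add_right
      blinfun_compose_assoc blinfun_compose_id_left)
  then show ?thesis
  proof (rule complex_normed_algebra.intro, unfold_locales)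
    fix S T :: "'a l2 \<Rightarrow>\<^sub>L 'a l2" and a
    assume S: "S \<in> carrier l2_operators"
    then show "S \<otimes>\<^bsub>l2_operators\<^esub> (a \<odot>\<^bsub>l2_operators\<^esub> T) = a \<odot>\<^bsub>l2_operators\<^esub> (S \<otimes>\<^bsub>l2_operators\<^esub> T)"
      by (simp add: l2_operators_simps adjointable_commute flip: blinfun_compose_assoc)
  qed (auto simp: l2_operators_simps adjointable_compose blinfun_compose_assoc blinfun_compose_add_left
      blinfun_compose_add_right norm_l2_scale_compose norm_triangle_ineq norm_blinfun_compose)
qed

lemma cstar_algebra_l2_operators: "cstar_algebra (l2_operators :: ('i l2 \<Rightarrow>\<^sub>L 'i l2) cstar_alg)"
proof -
  let ?L = "l2_operators :: ('i l2 \<Rightarrow>\<^sub>L 'i l2) cstar_alg"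
  interpret complex_normed_algebra ?L by (rule normed_algebra_l2_operators)
  have minus: "S \<ominus>\<^bsub>?L\<^esub> T = S - T" if "adjointable T" for S T
    using that by (simp add: minus_eq_smult l2_operators_simps)
      (intro blinfun_eqI l2_eqI, simp add: plus_blinfun.rep_eq minus_blinfun.rep_eq uminus_blinfun.rep_eq)
  have adj_diff: "adj (S - T) = adj S - adj T" if "adjointable S" "adjointable T" for S T :: "'i l2 \<Rightarrow>\<^sub>L 'i l2"
    using l2_adjoint_adj[OF that(1)] l2_adjoint_adj[OF that(2)] by (intro adj_eqI)
      (simp add: l2_adjoint_def minus_blinfun.rep_eq inner_diff_left inner_diff_right)
  have adjointable_diff: "adjointable (S - T)" if "adjointable S" "adjointable T" for S T :: "'i l2 \<Rightarrow>\<^sub>L 'i l2"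
    using minus_in_carrier[of S T] that by (simp add: minus l2_operators_simps)
  show ?thesis
  proof unfold_locales
    show "metric.mcomplete"
    proof (rule mcompleteI)
      fix X :: "nat \<Rightarrow> _" assume "\<And>k. X k \<in> carrier ?L"
        and C: "\<And>\<epsilon>. \<epsilon> > 0 \<Longrightarrow> \<exists>N. \<forall>m\<ge>N. \<forall>n\<ge>N. nrm ?L (X m \<ominus>\<^bsub>?L\<^esub> X n) < \<epsilon>"
      then have X: "\<And>k. adjointable (X k)" by (simp add: l2_operators_simps)
      have C': "\<exists>N. \<forall>m\<ge>N. \<forall>n\<ge>N. norm (X m - X n) < \<epsilon>" if "\<epsilon> > 0" for \<epsilon>
        using C[OF that] X by (simp add: minus) (simp add: l2_operators_simps)
      then have "Cauchy X" by (simp add: Cauchy_iff)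
      then obtain T where T: "X \<longlonglongrightarrow> T" using Cauchy_convergent convergent_def by blast
      \<comment> \<open>Since adjoints are part of the definition, the limit needs one: passing to
        adjoints does not increase norms of differences, so the adjoints converge as well.\<close>
      have "\<exists>N. \<forall>m\<ge>N. \<forall>n\<ge>N. norm (adj (X m) - adj (X n)) < \<epsilon>" if "\<epsilon> > 0" for \<epsilon>
      proof -
        obtain N where "\<And>m n. m \<ge> N \<Longrightarrow> n \<ge> N \<Longrightarrow> norm (X m - X n) < \<epsilon>" using C'[OF \<open>\<epsilon> > 0\<close>] by blast
        then show ?thesis
          using norm_adj_le[OF adjointable_diff[OF X X]] by (metis X adj_diff order_le_less_trans)
      qed
      then have "Cauchy (\<lambda>n. adj (X n))" by (simp add: Cauchy_iff)
      then obtain S where S: "(\<lambda>n. adj (X n)) \<longlonglongrightarrow> S" using Cauchy_convergent convergent_def by blast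
      have apply_lim: "(\<lambda>n. blinfun_apply (Y n) x) \<longlonglongrightarrow> blinfun_apply Z x" if "Y \<longlonglongrightarrow> Z"
        for Y :: "nat \<Rightarrow> 'i l2 \<Rightarrow>\<^sub>L 'i l2" and Z x
        using that by (intro tendsto_intros)
      have "adjointable T"
      proof (rule adjointableI)
        show "l2_adjoint T S" unfolding l2_adjoint_def
        proof (intro allI)
          fix x y
          have "(\<lambda>n. X n x \<bullet> y) \<longlonglongrightarrow> T x \<bullet> y" by (intro tendsto_inner apply_lim T tendsto_const)
          moreover have "(\<lambda>n. x \<bullet> adj (X n) y) \<longlonglongrightarrow> x \<bullet> S y"
            by (intro tendsto_inner apply_lim S tendsto_const)
          moreover have "X n x \<bullet> y = x \<bullet> adj (X n) y" for n
            using l2_adjoint_adj[OF X] by (simp add: l2_adjoint_def)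
          ultimately show "T x \<bullet> y = x \<bullet> S y" using LIMSEQ_unique by simp
        qed
        fix a
        show "T o\<^sub>L l2_scale a = l2_scale a o\<^sub>L T"
        proof (rule blinfun_eqI)
          fix x
          have "(\<lambda>n. X n (l2_scale a x)) \<longlonglongrightarrow> T (l2_scale a x)" by (rule apply_lim[OF T])
          moreover have "(\<lambda>n. l2_scale a (X n x)) \<longlonglongrightarrow> l2_scale a (T x)"
            by (intro tendsto_intros apply_lim[OF T])
          moreover have "X n (l2_scale a x) = l2_scale a (X n x)" for n
            using adjointable_commute[OF X[of n], of a] by (metis blinfun_apply_blinfun_compose)
          ultimately show "(T o\<^sub>L l2_scale a) x = (l2_scale a o\<^sub>L T) x" using LIMSEQ_unique by simp
        qed
      qed
      moreover have "(\<lambda>k. norm (X k - T)) \<longlonglongrightarrow> 0" using T by (simp add: LIM_zero_iff tendsto_norm_zero_iff)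
      ultimately show "\<exists>l\<in>carrier ?L. (\<lambda>k. nrm ?L (X k \<ominus>\<^bsub>?L\<^esub> l)) \<longlonglongrightarrow> 0"
        by (intro bexI[of _ T]) (auto simp: minus, auto simp: l2_operators_simps)
    qed
  next
    fix S T :: "'i l2 \<Rightarrow>\<^sub>L 'i l2" and a
    assume "S \<in> carrier ?L"
    then have S: "adjointable S" by (simp add: l2_operators_simps)
    show "star ?L S \<in> carrier ?L" using S by (simp add: l2_operators_simps adjointable_adj)
    show "star ?L (star ?L S) = S"
      using l2_adjoint_sym[OF l2_adjoint_adj[OF S]] by (simp add: l2_operators_simps adj_eqI)
    show "nrm ?L (star ?L S \<otimes>\<^bsub>?L\<^esub> S) = (nrm ?L S)\<^sup>2"
      using S by (simp add: l2_operators_simps norm_adj_compose)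
    show "star ?L (a \<odot>\<^bsub>?L\<^esub> S) = cnj a \<odot>\<^bsub>?L\<^esub> star ?L S"
      using l2_adjoint_compose[OF l2_adjoint_scale l2_adjoint_adj[OF S], of a] adjointable_commute[OF adjointable_adj[OF S]]
      by (simp add: l2_operators_simps adj_eqI)
    assume "T \<in> carrier ?L"
    then have T: "adjointable T" by (simp add: l2_operators_simps)
    show "star ?L (S \<oplus>\<^bsub>?L\<^esub> T) = star ?L S \<oplus>\<^bsub>?L\<^esub> star ?L T"
      using S T by (simp add: l2_operators_simps adj_eqI l2_adjoint_add l2_adjoint_adj)
    show "star ?L (S \<otimes>\<^bsub>?L\<^esub> T) = star ?L T \<otimes>\<^bsub>?L\<^esub> star ?L S"
      using S T by (simp add: l2_operators_simps adj_eqI l2_adjoint_compose l2_adjoint_adj)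
  qed
qed


section \<open>The Fock representation and the Fejer kernel\<close>

context
  fixes \<sigma> :: "'a::t2_space \<Rightarrow> 'a"
  assumes cpt: "compact (UNIV :: 'a set)" and cov: "covering_space UNIV \<sigma> UNIV"
begin

definition fock_mult :: "('a \<Rightarrow> complex) \<Rightarrow> (nat \<times> 'a) l2 \<Rightarrow>\<^sub>L (nat \<times> 'a) l2" where
  "fock_mult f = l2_operator (\<lambda>x (k, e). f e * coord x (k, e))"

text \<open>This creates one edge: the path of length k with range e continues, after its first
  edge, as the path of length k - 1 with range \<open>\<sigma> e\<close>. Level 0 is separate
  because \<open>0 - 1 = 0\<close> for natural numbers.\<close>

definition fock_shift :: "(nat \<times> 'a) l2 \<Rightarrow>\<^sub>L (nat \<times> 'a) l2" where
  "fock_shift = l2_operator (\<lambda>x (k, e). if k = 0 then 0 else coord x (k - 1, \<sigma> e))"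

text \<open>The adjoint of \<open>fock_shift\<close>: it removes the first edge, summing over all
  edges that could have been there.\<close>

definition fock_fold :: "(nat \<times> 'a) l2 \<Rightarrow>\<^sub>L (nat \<times> 'a) l2" where
  "fock_fold = l2_operator (\<lambda>x (k, v). \<Sum>e | \<sigma> e = v. coord x (Suc k, e))"

lemma coord_fock_mult:
  assumes f: "continuous_on UNIV f"
  shows "coord (blinfun_apply (fock_mult f) x) (k, e) = f e * coord x (k, e)"
proof -
  let ?g = "\<lambda>x (k, e). f e * coord x (k, e)"
  define C where "C = (SUP v. cmod (f v))"
  have le: "cmod (f v) \<le> C" for v unfolding C_def by (rule cmod_le_SUP[OF cpt f])
  have C: "C \<ge> 0" using le[of undefined] norm_ge_zero order_trans by blast
  have "coord (blinfun_apply (fock_mult f) x) (k, e) = ?g x (k, e)"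
    unfolding fock_mult_def
  proof (rule coord_l2_operator[OF C])
    fix x and F :: "(nat \<times> 'a) set" assume F: "finite F"
    have "(\<Sum>i\<in>F. (cmod (?g x i))\<^sup>2) \<le> (\<Sum>i\<in>F. C\<^sup>2 * (cmod (coord x i))\<^sup>2)"
      using le C by (intro sum_mono) (auto simp: norm_mult power_mult_distrib intro!: mult_right_mono power_mono)
    also have "\<dots> = C\<^sup>2 * (\<Sum>i\<in>F. (cmod (coord x i))\<^sup>2)" by (simp add: sum_distrib_left)
    also have "\<dots> \<le> C\<^sup>2 * (norm x)\<^sup>2" by (intro mult_left_mono sum_coord_le_norm F) auto
    finally show "(\<Sum>i\<in>F. (cmod (?g x i))\<^sup>2) \<le> (C * norm x)\<^sup>2"
      by (simp add: power_mult_distrib)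
  qed (auto simp: algebra_simps split: prod.splits)
  then show ?thesis by simp
qed

text \<open>The cardinality of the fibre is the fibre sum of the constant 1, hence continuous on a
  compact space.\<close>

lemma bounded_fibres: obtains N :: real where "N \<ge> 0" "\<And>v. real (card {e. \<sigma> e = v}) \<le> N"
proof -
  have c: "continuous_on UNIV (\<lambda>v. \<Sum>e | \<sigma> e = v. (1::complex))"
    by (rule continuous_fibre_sum[OF cpt cov]) auto
  have le: "real (card {e. \<sigma> e = v}) \<le> (SUP v. cmod (\<Sum>e | \<sigma> e = v. (1::complex)))" for v
    using cmod_le_SUP[OF cpt c, of v] by simp
  show ?thesis by (rule that[OF order_trans[OF of_nat_0_le_iff le] le])
qed

lemma coord_fock_shift:
  "coord (blinfun_apply fock_shift x) (k, e) = (if k = 0 then 0 else coord x (k - 1, \<sigma> e))"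
proof -
  let ?g = "\<lambda>x (k, e). if k = 0 then 0 else coord x (k - 1, \<sigma> e)"
  obtain N where N: "N \<ge> 0" "\<And>v. real (card {e. \<sigma> e = v}) \<le> N" by (rule bounded_fibres) blast
  have "coord (blinfun_apply fock_shift x) (k, e) = ?g x (k, e)"
    unfolding fock_shift_def
  \<comment> \<open>The map from (k, e) to (k - 1, \<open>\<sigma> e\<close>) on positive levels is
    at most N to one, so each coordinate of \<open>x\<close> is counted at most N times.\<close>
  proof (rule coord_l2_operator[where C = "sqrt N"])
    fix x and F :: "(nat \<times> 'a) set" assume F: "finite F"
    let ?h = "\<lambda>(k, e). (k - 1, \<sigma> e) :: nat \<times> 'a"
    define F' where "F' = {(k, e) \<in> F. k \<noteq> 0}"
    have F': "finite F'" using F unfolding F'_def by (rule rev_finite_subset) auto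
    have "(\<Sum>i\<in>F. (cmod (?g x i))\<^sup>2)
        = (\<Sum>i\<in>F'. (cmod (coord x (?h i)))\<^sup>2)"
      by (rule sum.mono_neutral_cong_right) (use F in \<open>auto simp: F'_def split: prod.splits\<close>)
    also have "\<dots> = (\<Sum>p\<in>?h ` F'. \<Sum>i | i \<in> F' \<and> ?h i = p. (cmod (coord x (?h i)))\<^sup>2)"
      by (rule sum.image_gen[OF F'])
    also have "\<dots> \<le> (\<Sum>p\<in>?h ` F'. N * (cmod (coord x p))\<^sup>2)"
    proof (rule sum_mono)
      fix p assume "p \<in> ?h ` F'"
      have "card {i \<in> F'. ?h i = p} \<le> card ((\<lambda>e. (Suc (fst p), e)) ` {e. \<sigma> e = snd p})"
        using finite_fibre[OF cpt cov] by (intro card_mono) (auto simp: F'_def image_iff)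
      also have "\<dots> \<le> card {e. \<sigma> e = snd p}" by (rule card_image_le[OF finite_fibre[OF cpt cov]])
      finally have "real (card {i \<in> F'. ?h i = p}) \<le> N" using N(2)[of "snd p"] by linarith
      then show "(\<Sum>i | i \<in> F' \<and> ?h i = p. (cmod (coord x (?h i)))\<^sup>2) \<le> N * (cmod (coord x p))\<^sup>2"
        by (simp add: mult_right_mono)
    qed
    also have "\<dots> = N * (\<Sum>p\<in>?h ` F'. (cmod (coord x p))\<^sup>2)" by (simp add: sum_distrib_left)
    also have "\<dots> \<le> N * (norm x)\<^sup>2" using F' N by (intro mult_left_mono sum_coord_le_norm) auto
    finally show "(\<Sum>i\<in>F. (cmod (?g x i))\<^sup>2) \<le> (sqrt N * norm x)\<^sup>2"
      using N by (simp add: power_mult_distrib)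
  qed (use N in \<open>auto split: prod.splits\<close>)
  then show ?thesis by simp
qed

text \<open>The bound is Cauchy-Schwarz on each fibre. Fibres over different points are disjoint, so
  no coordinate of \<open>x\<close> is counted twice.\<close>

lemma coord_fock_fold:
  "coord (blinfun_apply fock_fold x) (k, v) = (\<Sum>e | \<sigma> e = v. coord x (Suc k, e))"
proof -
  let ?g = "\<lambda>x (k, v). \<Sum>e | \<sigma> e = v. coord x (Suc k, e)"
  note fin = finite_fibre[OF cpt cov]
  obtain N where N: "N \<ge> 0" "\<And>v. real (card {e. \<sigma> e = v}) \<le> N" by (rule bounded_fibres) blast
  have "coord (blinfun_apply fock_fold x) (k, v) = ?g x (k, v)"
    unfolding fock_fold_def
  proof (rule coord_l2_operator[where C = "sqrt N"])
    fix x and F :: "(nat \<times> 'a) set" assume F: "finite F"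
    have "(\<Sum>i\<in>F. (cmod (?g x i))\<^sup>2)
      \<le> (\<Sum>i\<in>F. N * (\<Sum>e | \<sigma> e = snd i. (cmod (coord x (Suc (fst i), e)))\<^sup>2))"
    proof (rule sum_mono)
      fix i :: "nat \<times> 'a"
      let ?E = "{e. \<sigma> e = snd i}"
      have "(cmod (\<Sum>e\<in>?E. coord x (Suc (fst i), e)))\<^sup>2 \<le> (\<Sum>e\<in>?E. cmod (coord x (Suc (fst i), e)))\<^sup>2"
        by (intro power_mono norm_sum) auto
      also have "\<dots> \<le> (\<Sum>e\<in>?E. (cmod (coord x (Suc (fst i), e)))\<^sup>2) * card ?E"
        by (rule sum_squared_le_sum_of_squares)
      also have "\<dots> \<le> (\<Sum>e\<in>?E. (cmod (coord x (Suc (fst i), e)))\<^sup>2) * N"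
        by (intro mult_left_mono N sum_nonneg) auto
      finally show "(cmod (?g x i))\<^sup>2
          \<le> N * (\<Sum>e\<in>?E. (cmod (coord x (Suc (fst i), e)))\<^sup>2)"
        by (cases i) (simp add: mult.commute)
    qed
    also have "\<dots> = N * (\<Sum>(i, e)\<in>Sigma F (\<lambda>i. {e. \<sigma> e = snd i}). (cmod (coord x (Suc (fst i), e)))\<^sup>2)"
      using F fin by (simp add: sum.Sigma flip: sum_distrib_left)
    also have "(\<Sum>(i, e)\<in>Sigma F (\<lambda>i. {e. \<sigma> e = snd i}). (cmod (coord x (Suc (fst i), e)))\<^sup>2)
        = (\<Sum>p\<in>(\<lambda>(i, e). (Suc (fst i), e)) ` Sigma F (\<lambda>i. {e. \<sigma> e = snd i}). (cmod (coord x p))\<^sup>2)"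
      by (subst sum.reindex) (auto simp: inj_on_def intro!: sum.cong)
    also have "N * \<dots> \<le> N * (norm x)\<^sup>2"
      using F fin N by (intro mult_left_mono sum_coord_le_norm) auto
    finally show "(\<Sum>i\<in>F. (cmod (?g x i))\<^sup>2) \<le> (sqrt N * norm x)\<^sup>2"
      using N by (simp add: power_mult_distrib)
  qed (use N in \<open>auto simp: sum.distrib scaleR_sum_right split: prod.splits\<close>)
  then show ?thesis by simp
qed

lemma l2_adjoint_fock_mult:
  assumes f: "continuous_on UNIV f"
  shows "l2_adjoint (fock_mult f) (fock_mult (\<lambda>v. cnj (f v)))"
proof -
  have "continuous_on UNIV (\<lambda>v. cnj (f v))" by (intro continuous_intros f)
  then show ?thesis unfolding l2_adjoint_def inner_l2_def
    by (auto intro!: infsum_cong simp: coord_fock_mult f inner_complex_adjoint split: prod.splits)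
qed

text \<open>The map \<open>h\<close> identifies the indices of positive level with pairs of an index
  and an element of the fibre over it. Summing over the fibres first turns one inner product into
  the other.\<close>

lemma l2_adjoint_fock_shift: "l2_adjoint fock_shift fock_fold"
  unfolding l2_adjoint_def
proof (intro allI)
  fix x y :: "(nat \<times> 'a) l2"
  note fin = finite_fibre[OF cpt cov]
  let ?S = "Sigma UNIV (\<lambda>p :: nat \<times> 'a. {e. \<sigma> e = snd p})"
  let ?g = "\<lambda>(p, e). coord x p \<bullet> coord y (Suc (fst p), e)"
  define h :: "(nat \<times> 'a) \<times> 'a \<Rightarrow> nat \<times> 'a" where "h = (\<lambda>(p, e). (Suc (fst p), e))"
  have inj: "inj_on h ?S" by (auto simp: inj_on_def h_def)
  have img: "h ` ?S = {0<..} \<times> UNIV"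
  proof (intro equalityI subsetI)
    fix q :: "nat \<times> 'a" assume "q \<in> {0<..} \<times> UNIV"
    then have "q = h ((fst q - 1, \<sigma> (snd q)), snd q)" by (cases q) (auto simp: h_def)
    then show "q \<in> h ` ?S" by (rule image_eqI) auto
  qed (auto simp: h_def)
  have g: "?g s = ((\<lambda>q. coord (fock_shift x) q \<bullet> coord y q) \<circ> h) s" if "s \<in> ?S" for s
    using that by (auto simp: h_def coord_fock_shift)
  have "(\<lambda>q. coord (fock_shift x) q \<bullet> coord y q) summable_on h ` ?S"
    using summable_inner_coord by (rule summable_on_subset_banach) auto
  then have "((\<lambda>q. coord (fock_shift x) q \<bullet> coord y q) \<circ> h) summable_on ?S"
    using summable_on_reindex[OF inj] by blast
  then have sum: "?g summable_on ?S"
    using g by (subst summable_on_cong) auto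
  have "fock_shift x \<bullet> y = (\<Sum>\<^sub>\<infinity>q\<in>h ` ?S. coord (fock_shift x) q \<bullet> coord y q)"
    unfolding inner_l2_def img by (rule infsum_cong_neutral) (auto simp: coord_fock_shift split: if_splits)
  also have "\<dots> = infsum ((\<lambda>q. coord (fock_shift x) q \<bullet> coord y q) \<circ> h) ?S"
    by (rule infsum_reindex[OF inj])
  also have "\<dots> = infsum ?g ?S" using g by (intro infsum_cong) simp
  also have "\<dots> = (\<Sum>\<^sub>\<infinity>p\<in>UNIV. \<Sum>\<^sub>\<infinity>e\<in>{e. \<sigma> e = snd p}. coord x p \<bullet> coord y (Suc (fst p), e))"
    using infsum_Sigma'_banach[OF sum] by simp
  also have "\<dots> = (\<Sum>\<^sub>\<infinity>p\<in>UNIV. coord x p \<bullet> coord (fock_fold y) p)"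
    using fin by (intro infsum_cong) (auto simp: coord_fock_fold inner_sum_right split: prod.splits)
  finally show "fock_shift x \<bullet> y = x \<bullet> fock_fold y" by (simp add: inner_l2_def)
qed

lemma adjointable_fock_mult: "continuous_on UNIV f \<Longrightarrow> adjointable (fock_mult f)"
  by (rule adjointableI[OF l2_adjoint_fock_mult]) (auto intro!: blinfun_eqI l2_eqI simp: coord_fock_mult)

lemma adjointable_fock_shift: "adjointable fock_shift"
  by (rule adjointableI[OF l2_adjoint_fock_shift]) (auto intro!: blinfun_eqI l2_eqI simp: coord_fock_shift)

text \<open>
  A path of length \<open>k\<close> in the graph is determined by its range \<open>e\<close>, so the Fock representation
  acts on square summable functions of \<open>(k, e)\<close>.
\<close>

lemma fock_representation:
  "toeplitz_representation C_algebra (graph_correspondence (EV_graph \<sigma>)) l2_operators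
    fock_mult (\<lambda>F. fock_mult F o\<^sub>L fock_shift)"
proof -
  let ?C = "C_algebra :: ('a \<Rightarrow> complex) cstar_alg"
  let ?X = "graph_correspondence (EV_graph \<sigma>)"
  interpret X: cstar_correspondence ?C ?X by (rule EV_cstar_correspondence[OF cpt cov])
  interpret L: cstar_algebra "l2_operators :: ((nat \<times> 'a) l2 \<Rightarrow>\<^sub>L (nat \<times> 'a) l2) cstar_alg"
    by (rule cstar_algebra_l2_operators)
  note simps = C_algebra_simps graph_correspondence_simps l2_operators_simps
  have cm: "continuous_on UNIV (\<lambda>v. f v * g v)" "continuous_on UNIV (\<lambda>v. f v + g v)"
    "continuous_on UNIV (\<lambda>v. a * f v)" "continuous_on UNIV (\<lambda>v. cnj (f v))"
    if "continuous_on UNIV f" "continuous_on UNIV g" for f g :: "'a \<Rightarrow> complex" and a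
    using that by (auto intro!: continuous_intros)
  note cf = coord_fock_mult coord_fock_shift coord_fock_fold
  show ?thesis
  proof unfold_locales
    show "star_hom ?C l2_operators fock_mult"
      unfolding star_hom_def linear_map_def
      by (auto simp: simps adjointable_fock_mult adj_eqI[OF l2_adjoint_fock_mult] cm plus_blinfun.rep_eq
          cf algebra_simps intro!: blinfun_eqI l2_eqI)
    show "linear_map ?X l2_operators (\<lambda>F. fock_mult F o\<^sub>L fock_shift)"
      unfolding linear_map_def
      by (auto simp: simps adjointable_fock_mult adjointable_fock_shift adjointable_compose cm
          plus_blinfun.rep_eq cf algebra_simps intro!: blinfun_eqI l2_eqI)
  next
    fix f F assume "f \<in> carrier ?C" "F \<in> carrier ?X"
    then show "fock_mult f \<otimes>\<^bsub>l2_operators\<^esub> (fock_mult F o\<^sub>L fock_shift) = fock_mult (lact ?X f F) o\<^sub>L fock_shift"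
      by (auto simp: simps cm cf intro!: blinfun_eqI l2_eqI)
  next
    fix F H assume "F \<in> carrier ?X" "H \<in> carrier ?X"
    then have F: "continuous_on UNIV F" and H: "continuous_on UNIV H" by (auto simp: simps)
    have ip: "continuous_on UNIV (\<lambda>v. \<Sum>e | \<sigma> e = v. cnj (F e) * H e)"
      by (intro continuous_fibre_sum[OF cpt cov] continuous_intros F H)
    have "adj (fock_mult F o\<^sub>L fock_shift) = fock_fold o\<^sub>L fock_mult (\<lambda>v. cnj (F v))"
      by (intro adj_eqI l2_adjoint_compose l2_adjoint_fock_mult l2_adjoint_fock_shift F)
    moreover have "(fock_fold o\<^sub>L fock_mult (\<lambda>v. cnj (F v))) o\<^sub>L (fock_mult H o\<^sub>L fock_shift)
        = fock_mult (\<lambda>v. \<Sum>e | \<sigma> e = v. cnj (F e) * H e)"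
    proof (intro blinfun_eqI l2_eqI)
      fix x and p :: "nat \<times> 'a"
      obtain k v where p: "p = (k, v)" by force
      show "coord (((fock_fold o\<^sub>L fock_mult (\<lambda>v. cnj (F v))) o\<^sub>L (fock_mult H o\<^sub>L fock_shift)) x) p
          = coord (fock_mult (\<lambda>v. \<Sum>e | \<sigma> e = v. cnj (F e) * H e) x) p"
        by (simp add: p cf ip H cm[OF F F] sum_distrib_right mult.assoc)
    qed
    ultimately show "star l2_operators (fock_mult F o\<^sub>L fock_shift) \<otimes>\<^bsub>l2_operators\<^esub> (fock_mult H o\<^sub>L fock_shift)
        = fock_mult (ip ?X F H)"
      by (simp add: simps)
  qed
qed

end

text \<open>Orthogonality of the characters of the cyclic group of order \<open>M\<close>; for
  exponents below \<open>M\<close>, congruence modulo \<open>M\<close> is equality.\<close>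

lemma cis_power_sum:
  assumes "a < M" "b < M"
  shows "(\<Sum>j<M. cis (2 * pi * real j / real M) ^ a * cnj (cis (2 * pi * real j / real M)) ^ b)
    = (if a = b then of_nat M else 0)"
proof -
  let ?z = "\<lambda>j. cis (2 * pi * real j / real M)"
  have M: "M > 0" using assms by simp
  have geo: "(\<Sum>j<M. ?z j ^ d) = 0" if d: "0 < d" "d < M" for d
  proof -
    let ?q = "?z d"
    have "inj_on ?z {..<M}"
      using Complex.bij_betw_roots_unity[OF M] by (simp add: bij_betw_def)
    then have "?q \<noteq> ?z 0"
      using inj_onD[of ?z "{..<M}" d 0] d M by blast
    then have q: "?q \<noteq> 1" by simp
    have "?z j ^ d = ?q ^ j" for j by (simp add: Complex.DeMoivre mult_ac)
    moreover have "?q ^ M = 1"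
      using Complex.bij_betw_roots_unity[OF M] d by (auto simp: bij_betw_def)
    ultimately show ?thesis using geometric_sum[OF q, of M] by simp
  qed
  have unit: "?z j * cnj (?z j) = 1" for j by (simp add: complex_mult_cnj)
  show ?thesis
  proof (cases a b rule: linorder_cases)
    case less
    have "?z j ^ a * cnj (?z j) ^ b = cnj (?z j ^ (b - a))" for j
    proof -
      have "?z j ^ a * cnj (?z j) ^ b = (?z j * cnj (?z j)) ^ a * cnj (?z j) ^ (b - a)"
        using less by (simp add: power_mult_distrib flip: power_add)
      then show ?thesis by (simp add: unit)
    qed
    moreover have "(\<Sum>j<M. cnj (?z j ^ (b - a))) = 0"
      using arg_cong[OF geo[of "b - a"], of cnj] less assms by (simp only: cnj_sum) simp
    ultimately show ?thesis using less by simp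
  next
    case equal
    then show ?thesis using unit by (simp flip: power_mult_distrib)
  next
    case greater
    have "?z j ^ a * cnj (?z j) ^ b = ?z j ^ (a - b)" for j
    proof -
      have "?z j ^ a * cnj (?z j) ^ b = (?z j * cnj (?z j)) ^ b * ?z j ^ (a - b)"
        using greater by (simp add: power_mult_distrib flip: power_add)
      then show ?thesis by (simp add: unit)
    qed
    then show ?thesis using geo[of "a - b"] greater assms by simp
  qed
qed

text \<open>The Fejer kernel, sampled at the roots of unity of order \<open>M\<close>.\<close>

definition fejer_weight :: "nat \<Rightarrow> nat \<Rightarrow> nat \<Rightarrow> real" where
  "fejer_weight N M j = (cmod (\<Sum>i<N. cis (2 * pi * real j / real M) ^ i))\<^sup>2 / (real M * real N)"

text \<open>The condition on \<open>M\<close> keeps all exponents n + i and l below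
  \<open>M\<close>, so there is no aliasing and the N - n pairs with n + i = l are what remains.
  Truncated subtraction gives 0 for n at least \<open>N\<close>, as it should.\<close>

lemma fejer_coefficient:
  assumes N: "N > 0" and M: "n + N \<le> M"
  shows "(\<Sum>j<M. complex_of_real (fejer_weight N M j) * cis (2 * pi * real j / real M) ^ n)
    = of_nat (N - n) / of_nat N"
proof -
  let ?z = "\<lambda>j. cis (2 * pi * real j / real M)"
  have "complex_of_real (fejer_weight N M j) * ?z j ^ n
      = (\<Sum>i<N. \<Sum>l<N. ?z j ^ (n + i) * cnj (?z j) ^ l) / (of_nat M * of_nat N)" for j
  proof -
    have "complex_of_real ((cmod (\<Sum>i<N. ?z j ^ i))\<^sup>2) = (\<Sum>i<N. ?z j ^ i) * (\<Sum>l<N. cnj (?z j) ^ l)"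
      by (simp only: complex_norm_square of_real_power[symmetric] cnj_sum complex_cnj_power)
    then have "complex_of_real ((cmod (\<Sum>i<N. ?z j ^ i))\<^sup>2) * ?z j ^ n
        = (\<Sum>i<N. \<Sum>l<N. ?z j ^ i * cnj (?z j) ^ l) * ?z j ^ n"
      by (simp only: sum_product)
    also have "\<dots> = (\<Sum>i<N. \<Sum>l<N. ?z j ^ (n + i) * cnj (?z j) ^ l)"
      unfolding sum_distrib_right by (intro sum.cong refl) (simp add: power_add mult_ac)
    finally have "complex_of_real ((cmod (\<Sum>i<N. ?z j ^ i))\<^sup>2) * ?z j ^ n
        = (\<Sum>i<N. \<Sum>l<N. ?z j ^ (n + i) * cnj (?z j) ^ l)" .
    then show ?thesis by (simp add: fejer_weight_def)
  qed
  then have "(\<Sum>j<M. complex_of_real (fejer_weight N M j) * ?z j ^ n)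
      = (\<Sum>j<M. \<Sum>i<N. \<Sum>l<N. ?z j ^ (n + i) * cnj (?z j) ^ l) / (of_nat M * of_nat N)"
    by (simp add: sum_divide_distrib)
  also have "(\<Sum>j<M. \<Sum>i<N. \<Sum>l<N. ?z j ^ (n + i) * cnj (?z j) ^ l)
      = (\<Sum>i<N. \<Sum>l<N. \<Sum>j<M. ?z j ^ (n + i) * cnj (?z j) ^ l)"
    by (subst sum.swap) (intro sum.cong refl sum.swap)
  also have "\<dots> = (\<Sum>i<N. \<Sum>l<N. if n + i = l then of_nat M else 0)"
    using M by (intro sum.cong refl cis_power_sum) auto
  also have "\<dots> = (\<Sum>i<N. if i < N - n then of_nat M else 0)"
    by (intro sum.cong) auto
  also have "\<dots> = (\<Sum>i<N - n. of_nat M)"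
    by (rule sum.mono_neutral_cong_right) auto
  also have "\<dots> / (of_nat M * of_nat N) = of_nat (N - n) / (of_nat N :: complex)"
    using N M by (simp add: field_simps)
  finally show ?thesis .
qed

lemma fejer_weight_nonneg: "fejer_weight N M j \<ge> 0"
  by (simp add: fejer_weight_def)

lemma fejer_weight_sum: "\<lbrakk>N > 0; N \<le> M\<rbrakk> \<Longrightarrow> (\<Sum>j<M. fejer_weight N M j) = 1"
  using fejer_coefficient[of N 0 M] by (simp flip: of_real_sum)


section \<open>The tensor algebra of a covering map\<close>

context complex_normed_algebra
begin

primrec psum :: "(nat \<Rightarrow> 'a) \<Rightarrow> nat \<Rightarrow> 'a" where
  "psum f 0 = \<zero>"
| "psum f (Suc n) = psum f n \<oplus> f n"

lemma psum_closed: "(\<And>i. i < n \<Longrightarrow> f i \<in> carrier B) \<Longrightarrow> psum f n \<in> carrier B"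
  by (induction n) auto

lemma psum_cong: "(\<And>i. i < n \<Longrightarrow> f i = g i) \<Longrightarrow> psum f n = psum g n"
  by (induction n) auto

lemma psum_add:
  "\<lbrakk>\<And>i. i < n \<Longrightarrow> f i \<in> carrier B; \<And>i. i < n \<Longrightarrow> g i \<in> carrier B\<rbrakk>
    \<Longrightarrow> psum (\<lambda>i. f i \<oplus> g i) n = psum f n \<oplus> psum g n"
  by (induction n) (auto simp: M.a_ac psum_closed)

lemma psum_smult: "x \<in> carrier B \<Longrightarrow> psum (\<lambda>i. a i \<odot> x) n = (\<Sum>i<n. a i) \<odot> x"
  by (induction n) (auto simp: smult_zero_left smult_add_left)

lemma psum_single:
  "\<lbrakk>\<And>i. i < n \<Longrightarrow> i \<noteq> k \<Longrightarrow> f i = \<zero>; k < n \<Longrightarrow> f k \<in> carrier B\<rbrakk>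
    \<Longrightarrow> psum f n = (if k < n then f k else \<zero>)"
  by (induction n) (auto simp: less_Suc_eq)

lemma nrm_psum_le: "(\<And>i. i < n \<Longrightarrow> f i \<in> carrier B) \<Longrightarrow> nrm B (psum f n) \<le> (\<Sum>i<n. nrm B (f i))"
proof (induction n)
  case (Suc n)
  then have "nrm B (psum f n \<oplus> f n) \<le> nrm B (psum f n) + nrm B (f n)"
    by (intro nrm_triangle psum_closed) auto
  then show ?case using Suc by (simp add: less_Suc_eq)
qed simp

end

locale EV_representation =
  universal_toeplitz_representation C_algebra "graph_correspondence (EV_graph \<sigma>)" B \<pi> t
  for \<sigma> :: "'a::t2_space \<Rightarrow> 'a" and B :: "'b cstar_alg" (structure) and \<pi> t +
  assumes cpt: "compact (UNIV :: 'a set)" and cov: "covering_space UNIV \<sigma> UNIV"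
begin

lemmas simps = C_algebra_simps graph_correspondence_simps

lemma cont_\<sigma>: "continuous_on UNIV \<sigma>"
  by (rule covering_space_imp_continuous[OF cov])

lemma cont_comp: "continuous_on UNIV g \<Longrightarrow> continuous_on UNIV (\<lambda>v. g ((\<sigma> ^^ n) v))" for g :: "'a \<Rightarrow> complex"
  using continuous_on_compose2[OF _ continuous_funpow[OF cont_\<sigma>]] by auto

lemma cont_comp1: "continuous_on UNIV g \<Longrightarrow> continuous_on UNIV (\<lambda>v. g (\<sigma> v))" for g :: "'a \<Rightarrow> complex"
  using cont_comp[of g 1] by simp

lemma pi_closed: "continuous_on UNIV f \<Longrightarrow> \<pi> f \<in> carrier B"
  using \<pi>_closed[of f] by (simp add: simps)

lemma pi_add: "\<lbrakk>continuous_on UNIV f; continuous_on UNIV g\<rbrakk> \<Longrightarrow> \<pi> (\<lambda>v. f v + g v) = \<pi> f \<oplus> \<pi> g"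
  using \<pi>_add[of f g] by (simp add: simps)

lemma pi_mult: "\<lbrakk>continuous_on UNIV f; continuous_on UNIV g\<rbrakk> \<Longrightarrow> \<pi> (\<lambda>v. f v * g v) = \<pi> f \<otimes> \<pi> g"
  using \<pi>_mult[of f g] by (simp add: simps)

lemma pi_smult: "continuous_on UNIV f \<Longrightarrow> \<pi> (\<lambda>v. a * f v) = a \<odot> \<pi> f"
  using \<pi>_smult[of f a] by (simp add: simps)

lemma pi_star: "continuous_on UNIV f \<Longrightarrow> star B (\<pi> f) = \<pi> (\<lambda>v. cnj (f v))"
  using \<pi>_star[of f] by (simp add: simps)

lemma pi_bound:
  assumes f: "continuous_on UNIV f" and C: "\<And>v. cmod (f v) \<le> C"
  shows "nrm B (\<pi> f) \<le> 2 * C"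
proof -
  interpret P: cstar_algebra_hom C_algebra B \<pi> by unfold_locales (rule rep_hom)
  have "nrm B (\<pi> f) \<le> 2 * (SUP v. cmod (f v))" using P.hom_bounded[of f] f by (simp add: simps)
  also have "(SUP v. cmod (f v)) \<le> C" by (rule cSUP_least) (auto simp: C)
  finally show ?thesis by simp
qed

definition s where "s = t (\<lambda>_. 1)"

lemma t_closed': "continuous_on UNIV F \<Longrightarrow> t F \<in> carrier B"
  using t_closed[of F] by (simp add: simps)

lemma s_closed: "s \<in> carrier B"
  unfolding s_def by (rule t_closed') auto

text \<open>The range map is the identity, so the constant 1 generates the correspondence as a left
  module.\<close>

lemma t_eq: "continuous_on UNIV F \<Longrightarrow> t F = \<pi> F \<otimes> s"
  using rep_lact[of F "\<lambda>_. 1"] by (simp add: simps s_def)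

lemma t_ip: "\<lbrakk>continuous_on UNIV F; continuous_on UNIV H\<rbrakk>
    \<Longrightarrow> star B (t F) \<otimes> t H = \<pi> (\<lambda>v. \<Sum>e | \<sigma> e = v. cnj (F e) * H e)"
  using rep_ip[of F H] by (simp add: simps)

text \<open>Compatibility of \<open>t\<close> with the right action is not among the axioms of a
  Toeplitz representation. For the two sides x and y, the inner product relation shows that x* x, x*
  y, y* x and y* y coincide, so (x - y)* (x - y) = 0.\<close>

lemma s_pi:
  assumes g: "continuous_on UNIV g"
  shows "s \<otimes> \<pi> g = \<pi> (\<lambda>v. g (\<sigma> v)) \<otimes> s"
proof -
  define g' where "g' v = g (\<sigma> v)" for v
  have g': "continuous_on UNIV g'" unfolding g'_def by (rule cont_comp1[OF g])
  define n where "n v = (\<Sum>e | \<sigma> e = v. (1::complex))" for v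
  have n: "continuous_on UNIV n" unfolding n_def
    by (rule continuous_fibre_sum[OF cpt cov]) auto
  note c = g g' n continuous_on_mult continuous_on_cnj continuous_on_const
  define x where "x = s \<otimes> \<pi> g"
  define y where "y = t g'"
  note cl = B.mult_closed pi_closed s_closed t_closed' B.star_closed
  have x: "x \<in> carrier B" and y: "y \<in> carrier B" by (auto simp: x_def y_def cl c)
  define w where "w = \<pi> (\<lambda>v. cnj (g v) * (n v * g v))"
  have w: "w \<in> carrier B" by (simp add: w_def cl c)
  have ss: "star B s \<otimes> s = \<pi> n"
    using t_ip[of "\<lambda>_. 1" "\<lambda>_. 1"] by (simp add: s_def n_def[abs_def])
  have sy: "star B s \<otimes> y = \<pi> (\<lambda>v. n v * g v)"
  proof -
    have "(\<Sum>e | \<sigma> e = v. cnj 1 * g' e) = n v * g v" for v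
      unfolding n_def sum_distrib_right by (intro sum.cong) (auto simp: g'_def)
    then show ?thesis using t_ip[of "\<lambda>_. 1" g'] g' by (simp add: s_def y_def)
  qed
  have ys: "star B y \<otimes> s = \<pi> (\<lambda>v. cnj (g v) * n v)"
  proof -
    have "(\<Sum>e | \<sigma> e = v. cnj (g' e) * 1) = cnj (g v) * n v" for v
      unfolding n_def sum_distrib_left by (intro sum.cong) (auto simp: g'_def)
    then show ?thesis using t_ip[of g' "\<lambda>_. 1"] g' by (simp add: s_def y_def)
  qed
  have yy: "star B y \<otimes> y = w"
  proof -
    have "(\<Sum>e | \<sigma> e = v. cnj (g' e) * g' e) = cnj (g v) * (n v * g v)" for v
      unfolding n_def sum_distrib_left sum_distrib_right by (intro sum.cong) (auto simp: g'_def)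
    then show ?thesis using t_ip[of g' g'] g' by (simp add: y_def w_def)
  qed
  have sx: "star B x = \<pi> (\<lambda>v. cnj (g v)) \<otimes> star B s" by (simp add: x_def B.star_mult cl c pi_star)
  have "star B x \<otimes> x = \<pi> (\<lambda>v. cnj (g v)) \<otimes> ((star B s \<otimes> s) \<otimes> \<pi> g)"
    unfolding sx by (simp add: x_def B.mult_assoc cl c)
  then have xx: "star B x \<otimes> x = w" by (simp add: ss w_def pi_mult c)
  have "star B x \<otimes> y = \<pi> (\<lambda>v. cnj (g v)) \<otimes> (star B s \<otimes> y)"
    unfolding sx by (simp add: B.mult_assoc cl c y)
  then have xy: "star B x \<otimes> y = w" by (simp add: sy w_def pi_mult c)
  have "star B y \<otimes> x = (star B y \<otimes> s) \<otimes> \<pi> g"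
    by (simp add: x_def B.mult_assoc cl c y)
  then have yx: "star B y \<otimes> x = w" by (simp add: ys w_def c mult.assoc flip: pi_mult)
  have "star B (x \<ominus> y) \<otimes> (x \<ominus> y) = \<zero>"
    using x y w by (simp add: B.star_minus B.mult_minus_left B.mult_minus_right cl B.minus_in_carrier
        xx xy yx yy B.minus_self)
  then have "nrm B (x \<ominus> y) = 0" using B.cstar_identity[of "x \<ominus> y"] x y by (simp add: B.minus_in_carrier)
  then have "x = y" using x y by (simp add: B.nrm_eq_0 B.minus_in_carrier B.minus_eq_zero_iff)
  then show ?thesis using t_eq[OF g'] by (simp add: x_def y_def g'_def[abs_def])
qed

primrec mono :: "('a \<Rightarrow> complex) \<Rightarrow> nat \<Rightarrow> 'b" where
  "mono f 0 = \<pi> f"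
| "mono f (Suc n) = mono f n \<otimes> s"

lemma mono_closed: "continuous_on UNIV f \<Longrightarrow> mono f n \<in> carrier B"
  by (induction n) (auto simp: pi_closed B.mult_closed s_closed)

lemma mono_add: "\<lbrakk>continuous_on UNIV f; continuous_on UNIV g\<rbrakk> \<Longrightarrow> mono (\<lambda>v. f v + g v) n = mono f n \<oplus> mono g n"
  by (induction n) (auto simp: pi_add B.distr_left mono_closed s_closed)

lemma mono_smult: "continuous_on UNIV f \<Longrightarrow> mono (\<lambda>v. a * f v) n = a \<odot> mono f n"
  by (induction n) (auto simp: pi_smult B.scale_mult_left mono_closed s_closed)

lemma mono_mult_pi:
  "\<lbrakk>continuous_on UNIV f; continuous_on UNIV g\<rbrakk> \<Longrightarrow> mono f m \<otimes> \<pi> g = mono (\<lambda>v. f v * g ((\<sigma> ^^ m) v)) m"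
proof (induction m arbitrary: g)
  case (Suc m)
  have "mono f (Suc m) \<otimes> \<pi> g = (mono f m \<otimes> \<pi> (\<lambda>v. g (\<sigma> v))) \<otimes> s"
    using Suc.prems by (simp add: B.mult_assoc mono_closed pi_closed s_closed s_pi cont_comp1)
  also have "mono f m \<otimes> \<pi> (\<lambda>v. g (\<sigma> v)) = mono (\<lambda>v. f v * g (\<sigma> ((\<sigma> ^^ m) v))) m"
    using Suc.prems by (intro Suc.IH cont_comp1)
  finally show ?case by simp
qed (simp add: pi_mult)

lemma mono_mult:
  assumes "continuous_on UNIV f" "continuous_on UNIV g"
  shows "mono f m \<otimes> mono g n = mono (\<lambda>v. f v * g ((\<sigma> ^^ m) v)) (m + n)"
proof (induction n)
  case (Suc n)
  have "mono f m \<otimes> mono g (Suc n) = (mono f m \<otimes> mono g n) \<otimes> s"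
    using assms by (simp add: B.mult_assoc mono_closed s_closed)
  then show ?case by (simp add: Suc.IH)
qed (simp add: mono_mult_pi assms)

lemma mono_bound:
  assumes f: "continuous_on UNIV f" and C: "\<And>v. cmod (f v) \<le> C"
  shows "nrm B (mono f n) \<le> 2 * C * nrm B s ^ n"
proof (induction n)
  case (Suc n)
  have "nrm B (mono f (Suc n)) \<le> nrm B (mono f n) * nrm B s"
    using f by (simp add: B.nrm_mult mono_closed s_closed)
  also have "\<dots> \<le> (2 * C * nrm B s ^ n) * nrm B s"
    by (intro mult_right_mono Suc.IH B.nrm_nonneg s_closed)
  finally show ?case by (simp add: mult_ac)
qed (simp add: pi_bound[OF assms])

section \<open>The tensor algebra as a closure of polynomials in one generator\<close>

abbreviation tensor where "tensor \<equiv> EV_tensor_algebra \<sigma> B \<pi> t"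

abbreviation generators where
  "generators \<equiv> \<pi> ` carrier C_algebra \<union> t ` carrier (graph_correspondence (EV_graph \<sigma>))"

lemma tensor_simps:
  "carrier tensor = closed_algebra_generated B generators" "mult tensor = mult B" "zero tensor = zero B"
  "add tensor = add B" "smult tensor = smult B" "nrm tensor = nrm B"
  by (auto simp: EV_tensor_algebra_def tensor_algebra_def)

lemma tensor_least: "\<lbrakk>generators \<subseteq> V; closed_subalgebra B V\<rbrakk> \<Longrightarrow> carrier tensor \<subseteq> V"
  by (auto simp: tensor_simps closed_algebra_generated_def)

lemma generators_tensor: "generators \<subseteq> carrier tensor"
  unfolding tensor_simps closed_algebra_generated_def by blast

lemma tensor_carrier: "x \<in> carrier tensor \<Longrightarrow> x \<in> carrier B"
proof -
  have "closed_subalgebra B (carrier B)"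
    by (rule B.closed_subalgebraI[of _ "\<zero>"])
      (auto simp: B.smult_in_carrier B.mult_closed B.closedin_norm_topology)
  moreover have "generators \<subseteq> carrier B" using \<pi>_closed t_closed by auto
  ultimately show "x \<in> carrier tensor \<Longrightarrow> x \<in> carrier B" using tensor_least by blast
qed

lemma tensor_closed:
  assumes x: "x \<in> carrier tensor"
  shows "\<zero> \<in> carrier tensor" "a \<odot> x \<in> carrier tensor"
    and "y \<in> carrier tensor \<Longrightarrow> x \<oplus> y \<in> carrier tensor"
    and "y \<in> carrier tensor \<Longrightarrow> x \<otimes> y \<in> carrier tensor"
proof -
  have *: "a \<odot> x \<in> V" "y \<in> V \<Longrightarrow> x \<oplus> y \<in> V" "y \<in> V \<Longrightarrow> x \<otimes> y \<in> V"
    if "closed_subalgebra B V" "x \<in> V" for V x y a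
    using that B.submoduleE(4,5)[of V] by (auto simp: closed_subalgebra_def complex_ring_def)
  have a: "a \<odot> x \<in> carrier tensor" for a
    using x * unfolding tensor_simps closed_algebra_generated_def by auto
  then show "a \<odot> x \<in> carrier tensor" .
  show "y \<in> carrier tensor \<Longrightarrow> x \<oplus> y \<in> carrier tensor"
    and "y \<in> carrier tensor \<Longrightarrow> x \<otimes> y \<in> carrier tensor"
    using x * unfolding tensor_simps closed_algebra_generated_def by auto
  show "\<zero> \<in> carrier tensor" using a[of 0] tensor_carrier[OF x] by (simp add: B.smult_zero_left)
qed

lemma tensor_normed_algebra: "complex_normed_algebra tensor"
proof -
  have "s \<in> carrier tensor"
    using generators_tensor by (auto simp: s_def simps)
  then show ?thesis
    by (intro complex_normed_algebra_pullback[OF B.complex_normed_algebra_axioms, where \<kappa> = "\<lambda>x. x"])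
      (auto simp: tensor_carrier tensor_simps(2-) tensor_closed)
qed

sublocale T: complex_normed_algebra tensor
  by (rule tensor_normed_algebra)

lemma tensor_minus: "\<lbrakk>x \<in> carrier tensor; y \<in> carrier tensor\<rbrakk> \<Longrightarrow> x \<ominus>\<^bsub>tensor\<^esub> y = x \<ominus> y"
  by (simp add: T.minus_eq_smult B.minus_eq_smult tensor_carrier tensor_simps(2-))

text \<open>Coefficients absorb scalars, so sums of monomials form a subspace, and by
  \<open>mono_mult\<close> a subalgebra.\<close>

inductive_set polys where
  polys_mono: "continuous_on UNIV f \<Longrightarrow> mono f n \<in> polys"
| polys_add: "\<lbrakk>x \<in> polys; y \<in> polys\<rbrakk> \<Longrightarrow> x \<oplus> y \<in> polys"

lemma mono_tensor: "continuous_on UNIV f \<Longrightarrow> mono f n \<in> carrier tensor"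
proof (induction n)
  case 0
  then show ?case using generators_tensor by (auto simp: simps)
next
  case (Suc n)
  have "s \<in> carrier tensor" using generators_tensor by (auto simp: s_def simps)
  then show ?case using Suc tensor_closed(4) by simp
qed

lemma polys_tensor: "x \<in> polys \<Longrightarrow> x \<in> carrier tensor"
  by (induction rule: polys.induct) (auto simp: mono_tensor tensor_closed)

lemma polys_carrier: "polys \<subseteq> carrier B"
  using polys_tensor tensor_carrier by blast

lemma polys_smult: "x \<in> polys \<Longrightarrow> a \<odot> x \<in> polys"
proof (induction rule: polys.induct)
  case (polys_mono f n)
  then show ?case using polys.polys_mono[of "\<lambda>v. a * f v" n]
    by (simp only: mono_smult continuous_on_mult continuous_on_const)
next
  case (polys_add x y)
  have "a \<odot> (x \<oplus> y) = a \<odot> x \<oplus> a \<odot> y"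
    using polys_add.hyps polys_carrier by (intro B.smult_add_right) auto
  then show ?case using polys.polys_add[OF polys_add.IH] by simp
qed

lemma polys_mult: "x \<in> polys \<Longrightarrow> y \<in> polys \<Longrightarrow> x \<otimes> y \<in> polys"
proof (induction rule: polys.induct)
  case (polys_mono f n)
  show ?case using \<open>y \<in> polys\<close>
  proof (induction rule: polys.induct)
    case (polys_mono g k)
    show ?case
      unfolding mono_mult[OF \<open>continuous_on UNIV f\<close> polys_mono]
      by (rule polys.polys_mono[OF continuous_on_mult[OF \<open>continuous_on UNIV f\<close> cont_comp[OF polys_mono]]])
  next
    case (polys_add y y')
    have "mono f n \<otimes> (y \<oplus> y') = mono f n \<otimes> y \<oplus> mono f n \<otimes> y'"
      using polys_add.hyps polys_carrier \<open>continuous_on UNIV f\<close> by (intro B.distr_right mono_closed) auto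
    then show ?case using polys.polys_add[OF polys_add.IH] by simp
  qed
next
  case (polys_add x x')
  have "(x \<oplus> x') \<otimes> y = x \<otimes> y \<oplus> x' \<otimes> y"
    using polys_add.hyps polys_carrier \<open>y \<in> polys\<close> by (intro B.distr_left) auto
  then show ?case using polys.polys_add[OF polys_add.IH] polys_add.prems by simp
qed

lemma tensor_subset_closure: "carrier tensor \<subseteq> B.norm_closure polys"
proof (rule tensor_least)
  have "mono f 0 \<in> polys" "mono f 1 \<in> polys" if "continuous_on UNIV f" for f
    using polys_mono[OF that] by blast+
  then have "\<pi> f \<in> polys" "t f \<in> polys" if "continuous_on UNIV f" for f
    using that t_eq[OF that] by simp_all
  then have "generators \<subseteq> polys" by (auto simp: simps)
  then show "generators \<subseteq> B.norm_closure polys"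
    using B.norm_closure_subset[OF polys_carrier] by (rule subset_trans)
  show "closed_subalgebra B (B.norm_closure polys)"
    by (rule B.closed_subalgebra_norm_closure[OF polys_carrier polys_mono[OF continuous_on_const]
          polys_add polys_smult polys_mult])
qed

lemma polys_dense:
  assumes "x \<in> carrier tensor" "\<epsilon> > 0"
  obtains y where "y \<in> polys" "nrm B (x \<ominus> y) < \<epsilon>"
  by (rule B.norm_closureD[OF subsetD[OF tensor_subset_closure assms(1)] assms(2)])

lemma tensor_dense:
  assumes mono: "\<And>f n. continuous_on UNIV f \<Longrightarrow> mono f n \<in> S"
    and add: "\<And>x y. \<lbrakk>x \<in> S; y \<in> S\<rbrakk> \<Longrightarrow> x \<oplus> y \<in> S" and closed: "closedin (norm_topology tensor) S"
  shows "S = carrier tensor"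
proof
  note closed' = closed[unfolded T.closedin_norm_topology]
  show "S \<subseteq> carrier tensor" by (rule conjunct1[OF closed'])
  have S: "y \<in> S" if "y \<in> polys" for y
    using that by (induction rule: polys.induct) (use mono add in blast)+
  show "carrier tensor \<subseteq> S"
  proof
    fix x assume x: "x \<in> carrier tensor"
    have "\<exists>y\<in>S. nrm tensor (x \<ominus>\<^bsub>tensor\<^esub> y) < \<epsilon>" if "\<epsilon> > 0" for \<epsilon>
    proof -
      obtain y where "y \<in> polys" "nrm B (x \<ominus> y) < \<epsilon>" by (rule polys_dense[OF x \<open>\<epsilon> > 0\<close>])
      then show ?thesis using S x polys_tensor by (intro bexI[of _ y]) (simp_all add: tensor_minus tensor_simps(6))
    qed
    then show "x \<in> S" using conjunct2[OF closed'] x by blast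
  qed
qed

section \<open>Coefficients read off from the Fock representation\<close>

definition \<Phi> :: "'b \<Rightarrow> (nat \<times> 'a) l2 \<Rightarrow>\<^sub>L (nat \<times> 'a) l2" where
  "\<Phi> = (SOME \<phi>. star_hom B l2_operators \<phi> \<and> (\<forall>f. continuous_on UNIV f \<longrightarrow> \<phi> (\<pi> f) = fock_mult f)
    \<and> \<phi> s = fock_mult (\<lambda>_. 1) o\<^sub>L fock_shift \<sigma>)"

lemma \<Phi>: "star_hom B l2_operators \<Phi>" "continuous_on UNIV f \<Longrightarrow> \<Phi> (\<pi> f) = fock_mult f"
  "\<Phi> s = fock_mult (\<lambda>_. 1) o\<^sub>L fock_shift \<sigma>"
proof -
  obtain \<phi> where "star_hom B l2_operators \<phi>" "\<And>f. f \<in> carrier C_algebra \<Longrightarrow> \<phi> (\<pi> f) = fock_mult f"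
    "\<And>F. F \<in> carrier (graph_correspondence (EV_graph \<sigma>)) \<Longrightarrow> \<phi> (t F) = fock_mult F o\<^sub>L fock_shift \<sigma>"
    using universal_any_type[OF fock_representation[OF cpt cov]] by blast
  then have "\<exists>\<phi>. star_hom B l2_operators \<phi> \<and> (\<forall>f. continuous_on UNIV f \<longrightarrow> \<phi> (\<pi> f) = fock_mult f)
    \<and> \<phi> s = fock_mult (\<lambda>_. 1) o\<^sub>L fock_shift \<sigma>"
    by (intro exI[of _ \<phi>]) (auto simp: simps s_def)
  from someI_ex[OF this] show "star_hom B l2_operators \<Phi>" "continuous_on UNIV f \<Longrightarrow> \<Phi> (\<pi> f) = fock_mult f"
    "\<Phi> s = fock_mult (\<lambda>_. 1) o\<^sub>L fock_shift \<sigma>"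
    unfolding \<Phi>_def by blast+
qed

sublocale \<Phi>: cstar_algebra_hom B l2_operators \<Phi>
  by (intro cstar_algebra_hom.intro cstar_algebra_hom_axioms.intro \<Phi> B.cstar_algebra_axioms cstar_algebra_l2_operators)

lemma \<Phi>_add: "\<lbrakk>x \<in> carrier B; y \<in> carrier B\<rbrakk> \<Longrightarrow> coord (\<Phi> (x \<oplus> y) u) p = coord (\<Phi> x u) p + coord (\<Phi> y u) p"
  by (simp add: \<Phi>.hom_add l2_operators_simps plus_blinfun.rep_eq)

lemma \<Phi>_smult: "x \<in> carrier B \<Longrightarrow> coord (\<Phi> (a \<odot> x) u) p = a * coord (\<Phi> x u) p"
  by (simp add: \<Phi>.hom_smult l2_operators_simps)

lemma \<Phi>_mult: "\<lbrakk>x \<in> carrier B; y \<in> carrier B\<rbrakk> \<Longrightarrow> \<Phi> (x \<otimes> y) u = \<Phi> x (\<Phi> y u)"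
  by (simp add: \<Phi>.hom_mult l2_operators_simps)

lemma \<Phi>_bound: "x \<in> carrier B \<Longrightarrow> cmod (coord (\<Phi> x u) p) \<le> 2 * norm u * nrm B x"
proof -
  assume x: "x \<in> carrier B"
  have "cmod (coord (\<Phi> x u) p) \<le> norm (\<Phi> x) * norm u"
    by (rule order_trans[OF coord_le_norm norm_blinfun])
  also have "\<dots> \<le> (2 * nrm B x) * norm u"
    using \<Phi>.hom_bounded[OF x] by (intro mult_right_mono) (auto simp: l2_operators_simps)
  finally show ?thesis by (simp add: mult_ac)
qed

lemma \<Phi>_functional: "T.functional (\<lambda>x. coord (\<Phi> x u) p)"
  by (rule T.functionalI[where C = "2 * norm u"])
    (auto simp: tensor_simps(2-) \<Phi>_add \<Phi>_smult \<Phi>_bound tensor_carrier)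

lemma \<Phi>_mono:
  assumes f: "continuous_on UNIV f"
  shows "coord (\<Phi> (mono f n) u) (k, e) = (if n \<le> k then f e * coord u (k - n, (\<sigma> ^^ n) e) else 0)"
proof (induction n arbitrary: u)
  case 0
  then show ?case by (simp add: \<Phi> f coord_fock_mult[OF cpt cov])
next
  case (Suc n)
  have s: "coord (\<Phi> s u) (j, v) = (if j = 0 then 0 else coord u (j - 1, \<sigma> v))" for j v
    by (simp add: \<Phi> coord_fock_mult[OF cpt cov] coord_fock_shift[OF cpt cov])
  show ?case by (auto simp: \<Phi>_mult mono_closed f s_closed Suc.IH s)
qed

text \<open>Degree n is the only one that takes level 0 to level n, and \<open>mono f n\<close>
  takes the basis vector at (0, \<open>\<sigma>^n e\<close>) to a vector with value
  \<open>f e\<close> at (n, e). So this matrix entry isolates the n-th coefficient.\<close>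

definition coef :: "nat \<Rightarrow> 'b \<Rightarrow> 'a \<Rightarrow> complex" where
  "coef n x e = coord (\<Phi> x (unit_l2 (0, (\<sigma> ^^ n) e))) (n, e)"

lemma coef_add: "\<lbrakk>x \<in> carrier B; y \<in> carrier B\<rbrakk> \<Longrightarrow> coef n (x \<oplus> y) e = coef n x e + coef n y e"
  and coef_smult: "x \<in> carrier B \<Longrightarrow> coef n (a \<odot> x) e = a * coef n x e"
  by (auto simp: coef_def \<Phi>_add \<Phi>_smult)

lemma coef_minus: "\<lbrakk>x \<in> carrier B; y \<in> carrier B\<rbrakk> \<Longrightarrow> coef n (x \<ominus> y) e = coef n x e - coef n y e"
  by (simp add: B.minus_eq_smult coef_add coef_smult B.smult_in_carrier)

lemma coef_bound: "x \<in> carrier B \<Longrightarrow> cmod (coef n x e) \<le> 2 * nrm B x"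
proof -
  assume x: "x \<in> carrier B"
  let ?u = "unit_l2 (0, (\<sigma> ^^ n) e) :: (nat \<times> 'a) l2"
  have "cmod (coef n x e) \<le> norm ?u * (2 * nrm B x)"
    using \<Phi>_bound[OF x, of ?u "(n, e)"] by (simp add: coef_def mult_ac)
  also have "\<dots> \<le> 1 * (2 * nrm B x)"
    using B.nrm_nonneg[OF x] by (intro mult_right_mono norm_unit_l2) auto
  finally show ?thesis by simp
qed

lemma coef_mono: "continuous_on UNIV f \<Longrightarrow> coef m (mono f n) e = (if m = n then f e else 0)"
  by (auto simp: coef_def \<Phi>_mono coord_unit_l2)

text \<open>Both sides are bounded functionals of \<open>x\<close>, so monomials suffice. The sum is
  finite because degree m raises the level by m. Taking for \<open>u\<close> the image of a basis
  vector under a second element yields the product formula.\<close>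

lemma \<Phi>_expansion:
  assumes x: "x \<in> carrier tensor"
  shows "coord (\<Phi> x u) (k, e) = (\<Sum>m\<le>k. coef m x e * coord u (k - m, (\<sigma> ^^ m) e))"
proof -
  define l where "l x = coord (\<Phi> x u) (k, e) - (\<Sum>m\<le>k. coord u (k - m, (\<sigma> ^^ m) e) * coef m x e)" for x
  have l: "T.functional l"
    unfolding l_def coef_def by (intro T.functional_diff T.functional_sum \<Phi>_functional) auto
  have "{x \<in> carrier tensor. l x = 0} = carrier tensor"
  proof (rule tensor_dense)
    fix f :: "'a \<Rightarrow> complex" and n assume f: "continuous_on UNIV f"
    have "(\<Sum>m\<le>k. coord u (k - m, (\<sigma> ^^ m) e) * coef m (mono f n) e)
        = (\<Sum>m\<le>k. if m = n then coord u (k - m, (\<sigma> ^^ m) e) * f e else 0)"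
      by (intro sum.cong) (auto simp: coef_mono f)
    then have "l (mono f n) = 0" by (simp add: l_def \<Phi>_mono f)
    then show "mono f n \<in> {x \<in> carrier tensor. l x = 0}" using mono_tensor[OF f] by simp
  next
    fix x y assume "x \<in> {x \<in> carrier tensor. l x = 0}" "y \<in> {x \<in> carrier tensor. l x = 0}"
    then show "x \<oplus> y \<in> {x \<in> carrier tensor. l x = 0}"
      using T.functional_add[OF l, of x y] by (auto simp: tensor_simps(2-) tensor_closed)
  qed (rule T.functional_closed[OF l])
  then show ?thesis using x by (auto simp: l_def mult.commute)
qed

lemma coef_mult:
  assumes x: "x \<in> carrier tensor" and y: "y \<in> carrier tensor"
  shows "coef n (x \<otimes> y) e = (\<Sum>m\<le>n. coef m x e * coef (n - m) y ((\<sigma> ^^ m) e))"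
proof -
  let ?u = "unit_l2 (0, (\<sigma> ^^ n) e) :: (nat \<times> 'a) l2"
  have "coef n (x \<otimes> y) e = (\<Sum>m\<le>n. coef m x e * coord (\<Phi> y ?u) (n - m, (\<sigma> ^^ m) e))"
    using x y by (simp add: coef_def[of n "x \<otimes> y"] \<Phi>_mult tensor_carrier \<Phi>_expansion)
  also have "\<dots> = (\<Sum>m\<le>n. coef m x e * coef (n - m) y ((\<sigma> ^^ m) e))"
  proof (intro sum.cong refl)
    fix m assume "m \<in> {..n}"
    then have "(\<sigma> ^^ (n - m)) ((\<sigma> ^^ m) e) = (\<sigma> ^^ n) e"
      by (metis atMost_iff comp_apply funpow_add le_add_diff_inverse2)
    then show "coef m x e * coord (\<Phi> y ?u) (n - m, (\<sigma> ^^ m) e) = coef m x e * coef (n - m) y ((\<sigma> ^^ m) e)"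
      by (simp add: coef_def[of "n - m" y])
  qed
  finally show ?thesis .
qed

lemma coef_cont_polys: "x \<in> polys \<Longrightarrow> continuous_on UNIV (coef n x)"
proof (induction rule: polys.induct)
  case (polys_mono f k)
  then have "coef n (mono f k) = (if n = k then f else (\<lambda>_. 0))" by (auto simp: coef_mono)
  then show ?case using polys_mono by simp
next
  case (polys_add x y)
  then have "coef n (x \<oplus> y) = (\<lambda>e. coef n x e + coef n y e)"
    using polys_carrier by (auto simp: coef_add subset_iff)
  then show ?case using polys_add by (simp add: continuous_on_add)
qed

text \<open>The Fock space sees the points as a discrete set, so continuity is not automatic. It
  holds for polynomials and survives uniform limits, because \<open>coef_bound\<close> is uniform in
  the point.\<close>

lemma coef_cont:
  assumes x: "x \<in> carrier tensor"
  shows "continuous_on UNIV (coef n x)"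
proof -
  have "\<exists>y. y \<in> polys \<and> nrm B (x \<ominus> y) < 1 / real (Suc k)" for k
    using polys_dense[OF x, of "1 / real (Suc k)"] by auto
  then obtain Y where Y: "\<And>k. Y k \<in> polys" "\<And>k. nrm B (x \<ominus> Y k) < 1 / real (Suc k)" by metis
  have "uniform_limit UNIV (\<lambda>k. coef n (Y k)) (coef n x) sequentially"
    unfolding uniform_limit_iff
  proof (intro allI impI)
    fix \<epsilon> :: real assume "\<epsilon> > 0"
    have "(\<lambda>k. 2 / real (Suc k)) \<longlonglongrightarrow> 0" by (rule LIMSEQ_Suc) (rule lim_const_over_n)
    from order_tendstoD(2)[OF this \<open>\<epsilon> > 0\<close>]
    show "\<forall>\<^sub>F k in sequentially. \<forall>e\<in>UNIV. dist (coef n (Y k) e) (coef n x e) < \<epsilon>"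
    proof (rule eventually_mono, intro ballI)
      fix k e assume "2 / real (Suc k) < \<epsilon>"
      moreover have "cmod (coef n (x \<ominus> Y k) e) \<le> 2 * nrm B (x \<ominus> Y k)"
        using Y polys_carrier tensor_carrier[OF x] by (intro coef_bound B.minus_in_carrier) auto
      ultimately have "cmod (coef n (x \<ominus> Y k) e) < \<epsilon>" using Y(2)[of k] by simp
      then show "dist (coef n (Y k) e) (coef n x e) < \<epsilon>"
        using Y polys_carrier tensor_carrier[OF x] by (subst dist_commute) (simp add: dist_norm coef_minus subset_iff)
    qed
  qed
  then show ?thesis
  proof (rule uniform_limit_theorem[rotated])
    show "\<forall>\<^sub>F k in sequentially. continuous_on UNIV (coef n (Y k))"
      by (intro always_eventually allI coef_cont_polys Y)
  qed simp
qed

text \<open>Multiplying \<open>t\<close> by \<open>z\<close> gives another Toeplitz representation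
  in \<open>B\<close>, where the inner product relation uses \<open>cnj z * z = 1\<close>.
  Universality is applied with \<open>B\<close> itself as the target.\<close>

lemma gauge_exists:
  assumes z: "cmod z = 1"
  shows "\<exists>\<gamma>. star_hom B B \<gamma> \<and> (\<forall>f n. continuous_on UNIV f \<longrightarrow> \<gamma> (mono f n) = z ^ n \<odot> mono f n)"
proof -
  have zz: "cnj z * z = 1" using z by (simp add: complex_norm_square[symmetric] mult.commute)
  have "toeplitz_representation C_algebra (graph_correspondence (EV_graph \<sigma>)) B \<pi> (\<lambda>F. z \<odot> t F)"
  proof unfold_locales
    show "star_hom C_algebra B \<pi>" by (rule rep_hom)
    show "linear_map (graph_correspondence (EV_graph \<sigma>)) B (\<lambda>F. z \<odot> t F)"
      by (auto simp: linear_map_def t_closed t_add t_smult B.smult_in_carrier B.smult_add_right mult.commute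
          simp flip: B.smult_assoc)
  qed (auto simp: B.scale_mult_right \<pi>_closed t_closed rep_lact rep_ip B.star_scale B.scale_mult_left
      B.star_closed B.smult_in_carrier ip_closed zz zz[unfolded mult.commute[of "cnj z"]] B.smult_one_left simp flip: B.smult_assoc)
  then obtain \<gamma> where \<gamma>: "star_hom B B \<gamma>" "\<And>f. f \<in> carrier C_algebra \<Longrightarrow> \<gamma> (\<pi> f) = \<pi> f"
    "\<And>F. F \<in> carrier (graph_correspondence (EV_graph \<sigma>)) \<Longrightarrow> \<gamma> (t F) = z \<odot> t F"
    using universal_any_type by blast
  interpret \<gamma>: cstar_algebra_hom B B \<gamma> by unfold_locales (rule \<gamma>)
  have \<gamma>s: "\<gamma> s = z \<odot> s" using \<gamma>(3) by (simp add: s_def simps)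
  have "\<gamma> (mono f n) = z ^ n \<odot> mono f n" if f: "continuous_on UNIV f" for f n
  proof (induction n)
    case 0
    then show ?case using f \<gamma>(2) by (simp add: simps B.smult_one_left pi_closed)
  next
    case (Suc n)
    then show ?case using f
      by (simp add: \<gamma>.hom_mult mono_closed s_closed \<gamma>s B.scale_mult_left B.scale_mult_right
          B.smult_in_carrier B.mult_closed mult.commute flip: B.smult_assoc)
  qed
  then show ?thesis using \<gamma>(1) by blast
qed

definition gauge :: "complex \<Rightarrow> 'b \<Rightarrow> 'b" where
  "gauge z = (SOME \<gamma>. star_hom B B \<gamma> \<and> (\<forall>f n. continuous_on UNIV f \<longrightarrow> \<gamma> (mono f n) = z ^ n \<odot> mono f n))"

lemma gauge:
  assumes "cmod z = 1"
  shows "cstar_algebra_hom B B (gauge z)"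
    and "continuous_on UNIV f \<Longrightarrow> gauge z (mono f n) = z ^ n \<odot> mono f n"
  using someI_ex[OF gauge_exists[OF assms]] B.cstar_algebra_axioms
  unfolding gauge_def[symmetric] by (auto simp: cstar_algebra_hom_def cstar_algebra_hom_axioms_def)

text \<open>Sampling at roots of unity replaces the integral over the circle. The automorphisms are
  chosen separately for each z, and a finite sum asks for no continuity in z.\<close>

definition gauge_average :: "nat \<Rightarrow> nat \<Rightarrow> 'b \<Rightarrow> 'b" where
  "gauge_average N M x
    = B.psum (\<lambda>j. complex_of_real (fejer_weight N M j) \<odot> gauge (cis (2 * pi * real j / real M)) x) M"

text \<open>The same Cesaro mean in a second form: this one depends only on the coefficients of x,
  whereas the norm of \<open>gauge_average\<close> is controlled by that of x. The argument needs
  both.\<close>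

definition fejer_sum :: "nat \<Rightarrow> 'b \<Rightarrow> 'b" where
  "fejer_sum N x = B.psum (\<lambda>n. (of_nat (N - n) / of_nat N) \<odot> mono (coef n x) n) N"

lemma fejer_sum_closed: "x \<in> carrier tensor \<Longrightarrow> fejer_sum N x \<in> carrier B"
  unfolding fejer_sum_def by (intro B.psum_closed B.smult_in_carrier mono_closed coef_cont)

lemma fejer_sum_add:
  assumes x: "x \<in> carrier tensor" and y: "y \<in> carrier tensor"
  shows "fejer_sum N (x \<oplus> y) = fejer_sum N x \<oplus> fejer_sum N y"
proof -
  have "coef n (x \<oplus> y) = (\<lambda>e. coef n x e + coef n y e)" for n
    using x y tensor_carrier by (auto simp: coef_add)
  then have "fejer_sum N (x \<oplus> y) = B.psum (\<lambda>n. (of_nat (N - n) / of_nat N) \<odot> mono (coef n x) n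
      \<oplus> (of_nat (N - n) / of_nat N) \<odot> mono (coef n y) n) N"
    using x y by (simp add: fejer_sum_def mono_add coef_cont mono_closed B.smult_add_right)
  also have "\<dots> = fejer_sum N x \<oplus> fejer_sum N y"
    unfolding fejer_sum_def using x y
    by (intro B.psum_add B.smult_in_carrier mono_closed coef_cont)
  finally show ?thesis .
qed

lemma mono_zero: "mono (\<lambda>_. 0) n = \<zero>"
  using mono_smult[of "\<lambda>_. 0" 0 n] mono_closed[of "\<lambda>_. 0" n] by (simp add: B.smult_zero_left)

lemma fejer_sum_mono:
  assumes f: "continuous_on UNIV f"
  shows "fejer_sum N (mono f n) = (of_nat (N - n) / of_nat N) \<odot> mono f n"
proof -
  have c: "coef k (mono f n) = (if k = n then f else (\<lambda>_. 0))" for k by (auto simp: coef_mono f)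
  have "fejer_sum N (mono f n) = (if n < N then (of_nat (N - n) / of_nat N) \<odot> mono (coef n (mono f n)) n else \<zero>)"
    unfolding fejer_sum_def
    by (rule B.psum_single) (auto simp: c mono_zero B.smult_zero_right B.smult_in_carrier mono_closed f)
  then show ?thesis using f by (auto simp: c B.smult_zero_left mono_closed)
qed

lemma gauge_average_mono:
  assumes f: "continuous_on UNIV f" and N: "N > 0" and M: "n + N \<le> M"
  shows "gauge_average N M (mono f n) = (of_nat (N - n) / of_nat N) \<odot> mono f n"
proof -
  have "gauge_average N M (mono f n)
    = B.psum (\<lambda>j. (complex_of_real (fejer_weight N M j) * cis (2 * pi * real j / real M) ^ n) \<odot> mono f n) M"
    unfolding gauge_average_def by (rule B.psum_cong) (simp add: gauge f B.smult_assoc mono_closed)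
  then show ?thesis by (simp add: B.psum_smult mono_closed f fejer_coefficient[OF N M])
qed

lemma gauge_average_add:
  assumes x: "x \<in> carrier B" and y: "y \<in> carrier B"
  shows "gauge_average N M (x \<oplus> y) = gauge_average N M x \<oplus> gauge_average N M y"
proof -
  have g: "cstar_algebra_hom B B (gauge (cis r))" for r by (rule gauge) simp
  note cl = cstar_algebra_hom.hom_closed[OF g]
  show ?thesis unfolding gauge_average_def
    by (subst B.psum_add[symmetric])
      (simp_all add: cl x y B.smult_in_carrier cstar_algebra_hom.hom_add[OF g] B.smult_add_right)
qed

lemma gauge_average_bound:
  assumes x: "x \<in> carrier B" and N: "N > 0" "N \<le> M"
  shows "nrm B (gauge_average N M x) \<le> 2 * nrm B x"
proof -
  let ?g = "\<lambda>j. gauge (cis (2 * pi * real j / real M)) x"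
  have g: "cstar_algebra_hom B B (gauge (cis r))" for r by (rule gauge) simp
  note cl = cstar_algebra_hom.hom_closed[OF g x]
  have "nrm B (gauge_average N M x) \<le> (\<Sum>j<M. nrm B (complex_of_real (fejer_weight N M j) \<odot> ?g j))"
    unfolding gauge_average_def by (intro B.nrm_psum_le B.smult_in_carrier cl)
  also have "\<dots> \<le> (\<Sum>j<M. fejer_weight N M j * (2 * nrm B x))"
    using cstar_algebra_hom.hom_bounded[OF g x]
    by (intro sum_mono) (simp add: B.nrm_scale cl fejer_weight_nonneg mult_left_mono)
  also have "\<dots> = 2 * nrm B x"
    using fejer_weight_sum[OF N] by (simp flip: sum_distrib_right)
  finally show ?thesis .
qed

text \<open>The number of sample points must reach the degree plus \<open>N\<close>. Stating this as
  an eventual property lets sums of monomials be treated without a notion of degree.\<close>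

lemma fejer_sum_average:
  assumes "x \<in> polys" and N: "N > 0"
  shows "\<forall>\<^sub>F M in sequentially. gauge_average N M x = fejer_sum N x"
  using assms(1)
proof (induction rule: polys.induct)
  case (polys_mono f n)
  show ?case using eventually_ge_at_top[of "n + N"]
    by eventually_elim (simp add: gauge_average_mono fejer_sum_mono polys_mono N)
next
  case (polys_add x y)
  show ?case using polys_add.IH
  proof eventually_elim
    case (elim M)
    then show ?case using polys_add.hyps polys_tensor polys_carrier
      by (simp add: gauge_average_add fejer_sum_add subsetD[OF polys_carrier])
  qed
qed

lemma fejer_sum_bound:
  assumes x: "x \<in> polys" and N: "N > 0"
  shows "nrm B (fejer_sum N x) \<le> 2 * nrm B x"
proof -
  have "\<forall>\<^sub>F M in sequentially. nrm B (fejer_sum N x) \<le> 2 * nrm B x"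
    using fejer_sum_average[OF x N] eventually_ge_at_top[of N]
    by eventually_elim (use gauge_average_bound[OF subsetD[OF polys_carrier x] N] in metis)
  then show ?thesis by simp
qed

lemma fejer_sum_tendsto:
  assumes "x \<in> polys"
  shows "(\<lambda>N. nrm B (fejer_sum N x \<ominus> x)) \<longlonglongrightarrow> 0"
  using assms
proof (induction rule: polys.induct)
  case (polys_mono f n)
  have "\<forall>\<^sub>F N in sequentially. real n / real N * nrm B (mono f n) = nrm B (fejer_sum N (mono f n) \<ominus> mono f n)"
    using eventually_gt_at_top[of n]
  proof (rule eventually_mono)
    fix N assume N: "n < N"
    have "fejer_sum N (mono f n) \<ominus> mono f n = (of_nat (N - n) / of_nat N + (-1)) \<odot> mono f n"
      using polys_mono by (simp only: fejer_sum_mono B.minus_eq_smult mono_closed B.smult_add_left)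
    also have "of_nat (N - n) / of_nat N + (-1) = - complex_of_real (real n / real N)"
      using N by (simp add: of_nat_diff field_simps)
    finally show "real n / real N * nrm B (mono f n) = nrm B (fejer_sum N (mono f n) \<ominus> mono f n)"
      using polys_mono by (simp only: B.nrm_scale mono_closed norm_minus_cancel norm_of_real) simp
  qed
  moreover have "(\<lambda>N. real n / real N * nrm B (mono f n)) \<longlonglongrightarrow> 0 * nrm B (mono f n)"
    by (intro tendsto_mult tendsto_const lim_const_over_n)
  ultimately show ?case using tendsto_cong by force
next
  case (polys_add x y)
  have x: "x \<in> carrier tensor" "x \<in> carrier B" and y: "y \<in> carrier tensor" "y \<in> carrier B"
    using polys_add polys_tensor polys_carrier by auto
  have eq: "fejer_sum N (x \<oplus> y) \<ominus> (x \<oplus> y) = (fejer_sum N x \<ominus> x) \<oplus> (fejer_sum N y \<ominus> y)" for N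
    using x y by (simp add: fejer_sum_add B.minus_add_minus fejer_sum_closed)
  have lim: "(\<lambda>N. nrm B (fejer_sum N x \<ominus> x) + nrm B (fejer_sum N y \<ominus> y)) \<longlonglongrightarrow> 0"
    using tendsto_add[OF polys_add.IH] by simp
  show ?case
    by (rule tendsto_sandwich[OF _ _ tendsto_const lim])
      (use x y in \<open>auto simp: eq B.nrm_nonneg B.nrm_triangle B.minus_in_carrier fejer_sum_closed\<close>)
qed

text \<open>
  If all coefficients of \<open>x\<close> vanish, then those of a polynomial \<open>y\<close> close to \<open>x\<close> are small, hence
  so are its Fejer sums, which are close to \<open>y\<close>.
\<close>

lemma coef_faithful:
  assumes x: "x \<in> carrier tensor" and zero: "\<And>n e. coef n x e = 0"
  shows "x = \<zero>"
proof -
  note xB = tensor_carrier[OF x] and pB = subsetD[OF polys_carrier]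
  note cl = xB pB polys_tensor fejer_sum_closed B.minus_in_carrier
  \<comment> \<open>One \<epsilon> from x to y, one from y to its Fejer sum, four for the Fejer sum
    of the difference \<open>w\<close> (of norm at most 2 \<epsilon>), and one for the Fejer sum of
    \<open>y'\<close>.\<close>
  have "nrm B x \<le> 7 * \<epsilon>" if \<epsilon>: "\<epsilon> > 0" for \<epsilon>
  proof -
    obtain y where y: "y \<in> polys" "nrm B (x \<ominus> y) < \<epsilon>" by (rule polys_dense[OF x \<epsilon>])
    obtain N where N: "N > 0" "nrm B (fejer_sum N y \<ominus> y) < \<epsilon>"
    proof -
      have "\<forall>\<^sub>F N in sequentially. N > 0 \<and> nrm B (fejer_sum N y \<ominus> y) < \<epsilon>"
        using order_tendstoD(2)[OF fejer_sum_tendsto[OF y(1)] \<epsilon>] eventually_gt_at_top[of 0]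
        by eventually_elim auto
      then show ?thesis using that by (auto simp: eventually_sequentially)
    qed
    \<comment> \<open>The 4 is the product of the factors 2 in \<open>mono_bound\<close> and
      \<open>coef_bound\<close>. \<open>C\<close> depends on \<open>N\<close>, and \<open>N\<close>
      on \<open>y\<close>; therefore a second, finer approximation \<open>y'\<close> is chosen
      afterwards.\<close>
    define C where "C = (\<Sum>n<N. 4 * nrm B s ^ n)"
    have C: "C \<ge> 0" unfolding C_def by (intro sum_nonneg) (auto simp: B.nrm_nonneg s_closed)
    obtain y' where y': "y' \<in> polys" "nrm B (x \<ominus> y') < min \<epsilon> (\<epsilon> / (C + 1))"
      using polys_dense[OF x, of "min \<epsilon> (\<epsilon> / (C + 1))"] \<epsilon> C by auto
    define d where "d = nrm B (x \<ominus> y')"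
    have d: "d < \<epsilon>" "d * C \<le> \<epsilon>" "d \<ge> 0"
    proof -
      have "d * (C + 1) < \<epsilon>" using y'(2) C by (simp add: d_def field_simps)
      moreover show "d \<ge> 0" unfolding d_def by (simp add: B.nrm_nonneg cl y')
      ultimately show "d * C \<le> \<epsilon>" by (simp add: algebra_simps)
      show "d < \<epsilon>" using y'(2) by (simp add: d_def)
    qed
    have small: "cmod (coef n y' e) \<le> 2 * d" for n e
      using coef_bound[of "x \<ominus> y'" n e] zero[of n e] y'
      by (simp add: cl coef_minus d_def)
    have 1: "nrm B (fejer_sum N y') \<le> \<epsilon>"
    proof -
      have mc: "mono (coef n y') n \<in> carrier B" for n
        using y' by (intro mono_closed coef_cont_polys)
      have "nrm B (fejer_sum N y') \<le> (\<Sum>n<N. nrm B ((of_nat (N - n) / of_nat N) \<odot> mono (coef n y') n))"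
        unfolding fejer_sum_def by (intro B.nrm_psum_le B.smult_in_carrier mc)
      also have "\<dots> \<le> (\<Sum>n<N. 1 * (2 * (2 * d) * nrm B s ^ n))"
      proof (intro sum_mono)
        fix n
        have "nrm B (mono (coef n y') n) \<le> 2 * (2 * d) * nrm B s ^ n"
          by (rule mono_bound[OF coef_cont_polys[OF y'(1)] small])
        moreover have "cmod (of_nat (N - n) / of_nat N) \<le> 1" using N by (simp add: norm_divide divide_le_eq_1)
        ultimately show "nrm B ((of_nat (N - n) / of_nat N) \<odot> mono (coef n y') n) \<le> 1 * (2 * (2 * d) * nrm B s ^ n)"
          unfolding B.nrm_scale[OF mc] by (intro mult_mono) (auto simp: B.nrm_nonneg mc)
      qed
      also have "\<dots> = d * C" by (simp add: C_def sum_distrib_left mult_ac)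
      finally show ?thesis using d by simp
    qed
    have my': "(-1) \<odot> y' \<in> polys" by (rule polys_smult[OF y'(1)])
    define w where "w = y \<oplus> (-1) \<odot> y'"
    have w: "w \<in> polys" unfolding w_def by (rule polys_add[OF y(1) my'])
    have wy: "w \<oplus> y' = y"
      using B.minus_add_cancel[of y y'] y y' by (simp add: w_def cl B.minus_eq_smult)
    have 2: "nrm B (fejer_sum N y) \<le> nrm B (fejer_sum N w) + nrm B (fejer_sum N y')"
      using fejer_sum_add[of w y' N] w y' B.nrm_triangle[of "fejer_sum N w" "fejer_sum N y'"]
      by (simp add: cl wy)
    have "nrm B w \<le> nrm B (y \<ominus> x) + nrm B (x \<ominus> y')"
      using B.nrm_minus_triangle[of y x y'] y y' by (simp add: w_def cl B.minus_eq_smult)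
    also have "\<dots> \<le> 2 * \<epsilon>" using y d B.nrm_minus_commute[of y x] by (simp add: cl d_def)
    finally have 3: "nrm B (fejer_sum N w) \<le> 4 * \<epsilon>" using fejer_sum_bound[OF w N(1)] by simp
    have "nrm B y \<le> nrm B (y \<ominus> fejer_sum N y) + nrm B (fejer_sum N y)"
      using y by (intro B.nrm_le_minus) (auto simp: cl)
    then have "nrm B y \<le> 6 * \<epsilon>" using 1 2 3 N B.nrm_minus_commute[of y "fejer_sum N y"] y by (simp add: cl)
    moreover have "nrm B x \<le> nrm B (x \<ominus> y) + nrm B y" using y by (intro B.nrm_le_minus) (auto simp: cl)
    ultimately show ?thesis using y by simp
  qed
  \<comment> \<open>With this \<epsilon> the estimate says that the norm is at most half of
    itself.\<close>
  from this[of "nrm B x / 14"] have "\<not> nrm B x > 0" by (intro notI) simp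
  then have "nrm B x = 0" using B.nrm_nonneg[OF xB] by linarith
  then show ?thesis using B.nrm_eq_0[OF xB] by simp
qed

text \<open>\<open>B\<close> is not assumed to be unital. The image of the constant 1 acts as a unit
  on coefficients, and these determine the elements of the tensor algebra.\<close>

lemma tensor_one:
  assumes x: "x \<in> carrier tensor"
  shows "mono (\<lambda>_. 1) 0 \<otimes> x = x" "x \<otimes> mono (\<lambda>_. 1) 0 = x"
proof -
  let ?u = "mono (\<lambda>_. 1) 0"
  have u: "?u \<in> carrier tensor" by (rule mono_tensor) auto
  have eqI: "y = x" if y: "y \<in> carrier tensor" and c: "\<And>n e. coef n y e = coef n x e" for y
  proof -
    have "y \<ominus> x \<in> carrier tensor" using T.minus_in_carrier[OF y x] by (simp add: tensor_minus x y)
    then have "y \<ominus> x = \<zero>" using x y by (intro coef_faithful) (auto simp: coef_minus tensor_carrier c)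
    then show ?thesis using x y by (simp add: B.minus_eq_zero_iff tensor_carrier)
  qed
  have c: "coef n ?u e = (if n = 0 then 1 else 0)" for n e by (simp add: coef_mono del: mono.simps)
  show "?u \<otimes> x = x"
  proof (rule eqI)
    fix n e
    have "coef n (?u \<otimes> x) e = (\<Sum>m\<le>n. if m = 0 then coef n x e else 0)"
      unfolding coef_mult[OF u x] by (intro sum.cong) (auto simp: c simp del: mono.simps)
    then show "coef n (?u \<otimes> x) e = coef n x e" by simp
  qed (use tensor_closed(4)[OF u x] in simp)
  show "x \<otimes> ?u = x"
  proof (rule eqI)
    fix n e
    have "coef n (x \<otimes> ?u) e = (\<Sum>m\<le>n. if m = n then coef n x e else 0)"
      unfolding coef_mult[OF x u] by (intro sum.cong) (auto simp: c simp del: mono.simps)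
    then show "coef n (x \<otimes> ?u) e = coef n x e" by simp
  qed (use tensor_closed(4)[OF x u] in simp)
qed

sublocale skew_series_algebra tensor \<sigma> mono coef 2
proof unfold_locales
  show "mono f n \<in> carrier tensor" if "continuous_on UNIV f" for f n by (rule mono_tensor[OF that])
  show "S = carrier tensor"
    if "\<And>f n. continuous_on UNIV f \<Longrightarrow> mono f n \<in> S" "\<And>x y. \<lbrakk>x \<in> S; y \<in> S\<rbrakk> \<Longrightarrow> x \<oplus>\<^bsub>tensor\<^esub> y \<in> S"
      "closedin (norm_topology tensor) S" for S
    using that(1,2) by (intro tensor_dense that(3)) (simp_all add: tensor_simps(4))
  show "x = \<zero>\<^bsub>tensor\<^esub>" if "x \<in> carrier tensor" "\<And>n e. coef n x e = 0" for x
    using coef_faithful[OF that] by (simp add: tensor_simps)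
qed (auto simp: tensor_simps(2-) cpt cont_\<sigma> mono_add mono_smult mono_mult tensor_one[unfolded mono.simps] tensor_carrier
    coef_add coef_smult coef_bound coef_mult coef_mono coef_cont)

end

theorem corollary4p9:
  fixes \<sigma> :: "'a::t2_space \<Rightarrow> 'a"
    and B :: "'b cstar_alg"
    and \<pi> t :: "('a \<Rightarrow> complex) \<Rightarrow> 'b"
    and \<delta> :: "'b \<Rightarrow> 'b"
  assumes "compact (UNIV :: 'a set)"
    and "covering_space UNIV \<sigma> UNIV"
    and "topologically_free \<sigma>"
    and "universal_toeplitz_representation C_algebra (graph_correspondence (EV_graph \<sigma>)) B \<pi> t"
    and "approximately_local_derivation (EV_tensor_algebra \<sigma> B \<pi> t) \<delta>"
  shows "derivation (EV_tensor_algebra \<sigma> B \<pi> t) \<delta>"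
proof -
  interpret universal_toeplitz_representation C_algebra "graph_correspondence (EV_graph \<sigma>)" B \<pi> t
    by fact
  interpret EV_representation \<sigma> B \<pi> t by unfold_locales fact+
  show ?thesis by (rule approximately_local_derivation_is_derivation) fact+
qed

end
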